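(* Let $q=p^r$ be a prime power ($p$ prime), let $n\ge 1$, and let $M$ be chosen uniformly at random from $\mathrm{GL}(n,\mathbb{F}_q)$. Fix a strictly increasing sequence $b_1<\cdots<b_k$ of positive integers, each coprime to $p$. Then for any $a_1,\ldots,a_k\in\mathbb{F}_q$, $$\left|\mathbb{P}_{M\in \mathrm{GL}(n,\mathbb{F}_q)}\big(\forall\, 1\le i\le k:\ \mathrm{Tr}(M^{b_i})=a_i\big)-q^{-k}\right|\le q^{-\frac{n^2}{2b_k}}\Big(1+\frac{1}{q-1}\Big)^n\binom{n-1+b_k}{n}.$$
   Context: $\mathrm{GL}(n,\mathbb{F}_q)$ is the group of invertible $n\times n$ matrices over the finite field $\mathbb{F}_q$; "uniformly at random" is Haar probability measure on this finite group. *)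

theory Defs
  imports "HOL-Analysis.Analysis"
begin

text \<open>Matrix power with respect to matrix multiplication (the componentwise
  power of the vec type is not matrix power).\<close>
primrec matpow :: "'a::semiring_1^'n^'n \<Rightarrow> nat \<Rightarrow> 'a^'n^'n" where
  "matpow A 0 = mat 1"
| "matpow A (Suc m) = A ** matpow A m"

end

theory Submission
  imports "HOL-Number_Theory.Cong" "Jordan_Normal_Form.Char_Poly"
    "HOL-Algebra.Algebraic_Closure_Type" Defs
begin

text \<open>
  Expanding the event into additive characters of the field reduces the claim to a bound for
  the means \<open>c n\<close> of \<open>\<psi> (tr g(M))\<close> over \<open>GL(n, q)\<close>, where \<open>g\<close> is a nonzero combination of
  powers \<open>X^b\<close>. Counting pairs \<open>(M, v)\<close> of a matrix and a vector by the cyclic subspace that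
  \<open>v\<close> generates gives \<open>q^n c n = (\<Sum>j\<le>n. L j c (n - j))\<close>, where \<open>L j\<close> sums \<open>\<psi> (\<Sum>x. g(x))\<close>, with
  \<open>x\<close> ranging over the roots, over the monic polynomials of degree \<open>j\<close> with nonzero roots.
  As \<open>d = deg g\<close> is prime to \<open>p\<close>, Newton's identities give \<open>L j = 0\<close> for \<open>j > d\<close>. So the
  generating function of \<open>L\<close> is a product of \<open>d\<close> factors \<open>1 - \<gamma> u\<close>, and that of \<open>c\<close> is the
  product of the \<open>1 - \<gamma> u / q^i\<close> over \<open>i \<ge> 1\<close>, expanded by Euler's identity. The power sums of
  the \<open>\<gamma>\<close> are, up to sign, the character sums of \<open>g\<close> over the extensions of the field;
  Bombieri's form of Stepanov's method bounds these by a multiple of \<open>q^(m/2)\<close>, hence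
  \<open>|\<gamma>| \<le> sqrt q\<close>.
\<close>

text \<open>The shape of the bound comes from Euler's expansion. The coefficient of
  \<open>u^m\<close> in the product attached to one \<open>\<gamma>\<close> has order
  \<open>\<gamma>^m q^(-m(m+1)/2)\<close>, and \<open>sqrt q\<close> is the size of
  \<open>\<gamma>\<close> at which this becomes \<open>q^(-m^2/2)\<close>. Convexity over the ways
  to write \<open>n\<close> as a sum of \<open>d\<close> such degrees gives the exponent
  \<open>n^2/(2d)\<close>, and the number of these ways is the binomial coefficient. Polynomials
  \<open>g\<close> of degree below \<open>b_k\<close> are brought to the common
  \<open>d = b_k\<close> by zero values of \<open>\<gamma>\<close>. Stepanov's method bounds numbers
  of points only from above, and here only over extensions of even degree \<open>2s\<close>, where
  \<open>q^s\<close> is the square root of the field order. For the size of \<open>\<gamma>\<close>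
  it is enough that the power sums of the \<open>\<gamma>^2/q\<close> stay bounded, so the constants
  of the point count do not enter the final estimate. That \<open>d\<close> is prime to
  \<open>p\<close> serves twice: in the vanishing of \<open>L j\<close>, and on the curve
  \<open>y^q = y + g(x)\<close>, where it makes the pole orders \<open>q\<close> of \<open>x\<close>
  and \<open>d\<close> of \<open>y\<close> coprime.\<close>

hide_const (open) Polynomials.degree Polynomials.lead_coeff Coset.order
  UnivPoly.up_ring.coeff UnivPoly.up_ring.monom Divisibility.prime

section \<open>Finite fields and their algebraic closure\<close>

lemma finite_field_power_card:
  fixes x :: "'a::{field,finite}"
  shows "x ^ CARD('a) = x"
proof (cases "x = 0")
  case False
  have inj: "inj_on ((*) x) (UNIV - {0})" using False by (auto intro: inj_onI)
  have img: "(*) x ` (UNIV - {0}) = UNIV - {0}"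
  proof
    show "UNIV - {0} \<subseteq> (*) x ` (UNIV - {0})"
    proof
      fix y :: 'a assume "y \<in> UNIV - {0}"
      hence "y = x * (y / x)" "y / x \<in> UNIV - {0}" using False by auto
      thus "y \<in> (*) x ` (UNIV - {0})" by blast
    qed
  qed (use False in auto)
  have "prod id (UNIV - {0::'a}) = prod id ((*) x ` (UNIV - {0}))" using img by simp
  also have "\<dots> = (\<Prod>y\<in>UNIV - {0}. x * y)" by (subst prod.reindex[OF inj]) simp
  also have "\<dots> = x ^ (CARD('a) - 1) * prod id (UNIV - {0})"
    by (simp add: prod.distrib card_Diff_singleton)
  finally have "x ^ (CARD('a) - 1) = 1"
    by simp
  hence "x * x ^ (CARD('a) - 1) = x" by simp
  thus ?thesis by (metis finite_UNIV_card_ge_0 finite_code power_eq_if not_gr_zero)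
qed (simp add: power_0_left)

lemma prime_CHAR_finite: "prime CHAR('a::{field,finite})"
  by (simp add: prime_CHAR_semidom finite_imp_CHAR_pos)

text \<open>A maximal proper additive subgroup \<open>H\<close> of order a power of the characteristic has
  index \<open>CHAR('a)\<close>, which yields both the prime power order of the field and an additive
  character.\<close>

lemma finite_field_hyperplane:
  obtains H :: "'a::{field,finite} set" and v :: 'a and k :: nat
  where "0 \<in> H" "\<And>x y. x \<in> H \<Longrightarrow> y \<in> H \<Longrightarrow> x + y \<in> H" "card H = CHAR('a) ^ k"
    "bij_betw (\<lambda>(h, t). h + of_nat t * v) (H \<times> {..<CHAR('a)}) UNIV"
proof -
  define p where "p = CHAR('a)"
  have p: "prime p" unfolding p_def by (rule prime_CHAR_finite)
  define sub where "sub = (\<lambda>H::'a set. 0 \<in> H \<and> (\<forall>x\<in>H. \<forall>y\<in>H. x + y \<in> H) \<and> (\<exists>k. card H = p ^ k))"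
  define SS where "SS = {H. sub H \<and> H \<noteq> UNIV}"
  have "{0} \<in> SS"
  proof -
    have "(1::'a) \<notin> {0}" by simp
    hence "{0} \<noteq> (UNIV :: 'a set)" by blast
    thus ?thesis unfolding SS_def sub_def by (auto intro: exI[of _ 0])
  qed
  then obtain H where H: "H \<in> SS" and max: "\<And>H'. H' \<in> SS \<Longrightarrow> card H' \<le> card H"
    using arg_max_nat_lemma[of "\<lambda>H. H \<in> SS" "{0}" card "Suc (CARD('a))"]
    by (metis card_mono finite_code less_Suc_eq_le top_greatest)
  obtain v where v: "v \<notin> H" using H SS_def by auto
  have H0: "0 \<in> H" and Hadd: "\<And>x y. x \<in> H \<Longrightarrow> y \<in> H \<Longrightarrow> x + y \<in> H"
    using H unfolding SS_def sub_def by auto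
  obtain k where k: "card H = p ^ k" using H unfolding SS_def sub_def by auto
  have Hmul: "of_nat m * x \<in> H" if "x \<in> H" for m x
    by (induction m) (auto simp: H0 distrib_right intro: Hadd that)
  \<comment> \<open>\<open>sub\<close> asks for closure under sums; negation is multiplication by
    \<open>p - 1\<close>.\<close>
  have Hneg: "-x \<in> H" if "x \<in> H" for x
  proof -
    have "of_nat (p - 1) * x = (of_nat p - 1) * x"
      using prime_ge_1_nat[OF p] by (simp add: of_nat_diff)
    also have "\<dots> = -x" by (simp add: p_def)
    finally show ?thesis using Hmul[OF that] by metis
  qed
  have Hdiff: "x - y \<in> H" if "x \<in> H" "y \<in> H" for x y
    using Hadd[OF that(1) Hneg[OF that(2)]] by simp
  define f where "f = (\<lambda>(h, t). h + of_nat t * v)"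
  \<comment> \<open>Two representations with different \<open>t\<close> would put
    \<open>(t' - t) v\<close> into \<open>H\<close>, and inverting \<open>t' - t\<close> modulo
    \<open>p\<close> would put \<open>v\<close> there too.\<close>
  have aux: "False" if "h \<in> H" "h' \<in> H" "t < t'" "t' < p" "h + of_nat t * v = h' + of_nat t' * v" for h h' t t'
  proof -
    have "of_nat (t' - t) * v = h - h'"
      using that by (simp add: of_nat_diff algebra_simps)
    hence "of_nat (t' - t) * v \<in> H" using Hdiff that by auto
    moreover have "coprime (t' - t) p"
      using p that by (metis coprime_commute diff_le_self le_less_trans nat_dvd_not_less prime_imp_coprime zero_less_diff)
    then obtain w where "[(t' - t) * w = 1] (mod p)"
      by (metis One_nat_def cong_solve_coprime_nat)
    hence "of_nat ((t' - t) * w) = (1::'a)"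
      using of_nat_eq_iff_cong_CHAR[where 'a='a] unfolding p_def by (metis of_nat_1)
    hence "of_nat w * (of_nat (t' - t) * v) = v"
      by (metis mult.assoc mult.commute mult.left_neutral of_nat_mult)
    ultimately show False using Hmul v by metis
  qed
  have inj: "inj_on f (H \<times> {..<p})"
  proof (rule inj_onI)
    fix a b assume ab: "a \<in> H \<times> {..<p}" "b \<in> H \<times> {..<p}" "f a = f b"
    obtain h t h' t' where [simp]: "a = (h, t)" "b = (h', t')" by (cases a, cases b)
    have e: "h + of_nat t * v = h' + of_nat t' * v" using ab by (simp add: f_def)
    have "t = t'"
      using aux[of h h' t t'] aux[of h' h t' t] e ab by (cases t t' rule: linorder_cases) auto
    thus "a = b" using e by simp
  qed
  have sub': "sub (f ` (H \<times> {..<p}))"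
    unfolding sub_def
  proof (intro conjI ballI)
    show "0 \<in> f ` (H \<times> {..<p})"
      using H0 prime_gt_0_nat[OF p] by (intro image_eqI[of _ _ "(0,0)"]) (auto simp: f_def)
    show "\<exists>k. card (f ` (H \<times> {..<p})) = p ^ k"
      by (rule exI[of _ "Suc k"]) (simp add: card_image[OF inj] k)
  next
    fix x y assume "x \<in> f ` (H \<times> {..<p})" "y \<in> f ` (H \<times> {..<p})"
    then obtain h t h' t' where ht: "h \<in> H" "h' \<in> H" "x = h + of_nat t * v" "y = h' + of_nat t' * v"
      by (auto simp: f_def)
    have "of_nat (t + t') = (of_nat ((t + t') mod p) :: 'a)"
      unfolding of_nat_eq_iff_cong_CHAR p_def cong_def by simp
    hence "x + y = f (h + h', (t + t') mod p)"
      using ht unfolding f_def by (simp add: algebra_simps) (metis distrib_left of_nat_add)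
    thus "x + y \<in> f ` (H \<times> {..<p})"
      using ht Hadd prime_gt_0_nat[OF p] by auto
  qed
  have "card (f ` (H \<times> {..<p})) > card H"
    using prime_gt_1_nat[OF p] k by (simp add: card_image[OF inj] card_cartesian_product)
  hence "f ` (H \<times> {..<p}) \<notin> SS" using max by (meson not_le)
  hence "f ` (H \<times> {..<p}) = UNIV" using sub' unfolding SS_def by auto
  hence "bij_betw f (H \<times> {..<p}) UNIV" using inj by (simp add: bij_betw_def)
  thus thesis using that[of H k v] H0 Hadd k unfolding f_def p_def by blast
qed

lemma finite_field_card_prime_power:
  obtains r where "CARD('a::{field,finite}) = CHAR('a) ^ r" "r > 0"
proof -
  obtain H :: "'a set" and v :: 'a and k where H: "card H = CHAR('a) ^ k"
    "bij_betw (\<lambda>(h, t). h + of_nat t * v) (H \<times> {..<CHAR('a)}) UNIV"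
    using finite_field_hyperplane by metis
  have "CARD('a) = CHAR('a) ^ Suc k"
    using bij_betw_same_card[OF H(2)] H(1) by (simp add: card_cartesian_product mult.commute)
  thus thesis using that by blast
qed

text \<open>The coordinate of \<open>x\<close> along \<open>v\<close> modulo the hyperplane
  \<open>H\<close> is an additive map onto the integers modulo \<open>p\<close>. Composed with the
  powers of a primitive \<open>p\<close>-th root of unity it is a character with kernel
  \<open>H\<close>.\<close>

lemma finite_field_additive_character:
  obtains \<psi> :: "'a::{field,finite} \<Rightarrow> complex"
  where "\<And>x y. \<psi> (x + y) = \<psi> x * \<psi> y" "\<And>x. cmod (\<psi> x) = 1" "\<exists>x. \<psi> x \<noteq> 1"
proof -
  define p where "p = CHAR('a)"
  have p: "prime p" unfolding p_def by (rule prime_CHAR_finite)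
  obtain H :: "'a set" and v :: 'a and k where H: "0 \<in> H" "\<And>x y. x \<in> H \<Longrightarrow> y \<in> H \<Longrightarrow> x + y \<in> H"
    and "bij_betw (\<lambda>(h, t). h + of_nat t * v) (H \<times> {..<CHAR('a)}) UNIV"
    using finite_field_hyperplane by metis
  hence bij: "bij_betw (\<lambda>(h, t). h + of_nat t * v) (H \<times> {..<p}) UNIV" unfolding p_def by simp
  define g where "g = the_inv_into (H \<times> {..<p}) (\<lambda>(h, t). h + of_nat t * v)"
  have g: "g x \<in> H \<times> {..<p}" "fst (g x) + of_nat (snd (g x)) * v = x" for x
    using bij unfolding g_def bij_betw_def
    by (auto simp: the_inv_into_into case_prod_beta' dest: f_the_inv_into_f[of _ _ x])
  have g_eq: "g (h + of_nat t * v) = (h, t)" if "h \<in> H" "t < p" for h t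
    using bij that unfolding g_def bij_betw_def
    by (metis (no_types, lifting) SigmaI case_prod_conv lessThan_iff the_inv_into_f_f)
  define z where "z = cis (2 * pi / real p)"
  have zp: "z ^ p = 1"
    using prime_gt_0_nat[OF p] unfolding z_def Complex.DeMoivre by simp
  have z_mod: "z ^ (t mod p) = z ^ t" for t
    by (metis zp mult_div_mod_eq mult_1 power_add power_mult power_one)
  have z1: "z \<noteq> 1"
  proof
    assume "z = 1"
    hence "cos (2 * pi / real p) = 1" unfolding z_def by (metis cis.sel(1) one_complex.sel(1))
    then obtain n :: int where "2 * pi / real p = of_int n * 2 * pi" using cos_one_2pi_int by blast
    hence "pi * (2 / real p) = pi * (2 * of_int n)" by (simp add: mult_ac)
    hence "2 / real p = 2 * of_int n" using mult_left_cancel[OF pi_neq_zero] by blast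
    hence "1 = of_int n * real p" using prime_gt_0_nat[OF p] by (simp add: field_simps)
    hence "1 = n * int p" by (metis of_int_1 of_int_eq_iff of_int_mult of_int_of_nat_eq)
    thus False using prime_gt_1_nat[OF p] by (metis dvd_triv_right int_dvd_int_iff nat_dvd_1_iff_1 of_nat_1 less_irrefl)
  qed
  define \<psi> where "\<psi> = (\<lambda>x. z ^ snd (g x))"
  show thesis
  proof (rule that[of \<psi>])
    fix x y
    have "of_nat (snd (g x) + snd (g y)) = (of_nat ((snd (g x) + snd (g y)) mod p) :: 'a)"
      unfolding of_nat_eq_iff_cong_CHAR p_def cong_def by simp
    moreover have "x + y = (fst (g x) + fst (g y)) + of_nat (snd (g x) + snd (g y)) * v"
      using g(2)[of x] g(2)[of y] by (simp add: algebra_simps)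
    ultimately have "x + y = (fst (g x) + fst (g y)) + of_nat ((snd (g x) + snd (g y)) mod p) * v"
      by simp
    hence "g (x + y) = (fst (g x) + fst (g y), (snd (g x) + snd (g y)) mod p)"
      using g_eq g(1)[of x] g(1)[of y] H(2) prime_gt_0_nat[OF p]
      by (metis mem_Times_iff mod_less_divisor)
    thus "\<psi> (x + y) = \<psi> x * \<psi> y" by (simp add: \<psi>_def z_mod power_add)
  next
    show "cmod (\<psi> x) = 1" for x by (simp add: \<psi>_def norm_power z_def)
  next
    have "g (0 + of_nat 1 * v) = (0, 1)" using g_eq H(1) prime_gt_1_nat[OF p] by blast
    thus "\<exists>x. \<psi> x \<noteq> 1" using z1 by (intro exI[of _ v]) (simp add: \<psi>_def)
  qed
qed

lemma frob_add:
  fixes x y :: "'a::{field,finite} alg_closure"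
  shows "(x + y) ^ (CARD('a) ^ m) = x ^ (CARD('a) ^ m) + y ^ (CARD('a) ^ m)"
proof -
  obtain r where "CARD('a) = CHAR('a) ^ r" using finite_field_card_prime_power by blast
  thus ?thesis
    using freshmans_dream'[where 'a="'a alg_closure" and n="r * m"] prime_CHAR_finite[where 'a='a]
    by (simp add: power_mult)
qed

lemma frob_sum:
  fixes f :: "'b \<Rightarrow> 'a::{field,finite} alg_closure"
  shows "sum f A ^ (CARD('a) ^ m) = (\<Sum>x\<in>A. f x ^ (CARD('a) ^ m))"
proof -
  obtain r where "CARD('a) = CHAR('a) ^ r" using finite_field_card_prime_power by blast
  thus ?thesis
    using freshmans_dream_sum'[where 'a="'a alg_closure" and n="r * m" and f=f and A=A, OF _ refl]
      prime_CHAR_finite[where 'a='a]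
    by (simp add: power_mult)
qed

lemma power_card_power_to_ac:
  fixes x :: "'a::{field,finite}"
  shows "to_ac x ^ (CARD('a) ^ m) = to_ac x"
proof (induction m)
  case (Suc m)
  have "to_ac x ^ (CARD('a) ^ Suc m) = to_ac (x ^ CARD('a)) ^ (CARD('a) ^ m)"
    by (simp only: power_Suc power_mult to_ac_power)
  thus ?case using Suc by (simp add: finite_field_power_card)
qed simp


section \<open>Evaluating polynomials over the base field in its algebraic closure\<close>

interpretation to_ac: field_hom "to_ac :: 'a::field \<Rightarrow> 'a alg_closure"
  by standard auto
interpretation map_to_ac: map_poly_inj_idom_hom "to_ac :: 'a::field \<Rightarrow> 'a alg_closure" ..

text \<open>All finite extensions live inside one closure: an extension is a set of points there,
  and polynomials over the base field are evaluated after embedding their coefficients.\<close>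

definition ev :: "'a::field poly \<Rightarrow> 'a alg_closure \<Rightarrow> 'a alg_closure" where
  "ev p x = poly (map_poly to_ac p) x"

lemma ev_simps [simp]:
  "ev 0 x = 0" "ev 1 x = 1" "ev (p + p') x = ev p x + ev p' x"
  "ev (p - p') x = ev p x - ev p' x"
  "ev (p * p') x = ev p x * ev p' x" "ev (p ^ n) x = ev p x ^ n"
  "ev (monom c n) x = to_ac c * x ^ n" "ev (Polynomial.smult c p) x = to_ac c * ev p x"
  by (simp_all add: ev_def hom_distribs poly_monom)

lemma ev_sum: "ev (\<Sum>i\<in>A. f i) x = (\<Sum>i\<in>A. ev (f i) x)"
  by (simp add: ev_def map_to_ac.hom_sum poly_sum)

lemma ev_altdef: "ev p x = (\<Sum>i\<le>degree p. to_ac (coeff p i) * x ^ i)"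
  by (simp add: ev_def poly_altdef)

lemma ev_frob:
  fixes p :: "'a::{field,finite} poly"
  shows "ev p x ^ (CARD('a) ^ m) = ev p (x ^ (CARD('a) ^ m))"
  by (simp add: ev_altdef frob_sum power_mult_distrib power_card_power_to_ac mult.commute flip: power_mult)

lemma finite_ev_roots:
  assumes "p \<noteq> 0"
  shows "finite {x. ev p x = 0}" "card {x. ev p x = 0} \<le> degree p"
proof -
  have "map_poly to_ac p \<noteq> 0" using assms by simp
  thus "finite {x. ev p x = 0}" "card {x. ev p x = 0} \<le> degree p"
    using poly_roots_finite[of "map_poly to_ac p"] card_poly_roots_bound[of "map_poly to_ac p"]
    by (simp_all add: ev_def)
qed

section \<open>Points on Artin--Schreier curves\<close>

lemma card_field_ge_2: "CARD('a::{field,finite}) \<ge> 2"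
proof -
  have "card {0, 1::'a} \<le> CARD('a)" by (rule card_mono) auto
  thus ?thesis by simp
qed

type_synonym quad = "nat \<times> nat \<times> nat \<times> nat"

locale artin_schreier =
  fixes g :: "'a::{field,finite} poly" and q d :: nat
  assumes q_def: "q = CARD('a)" and d_def: "d = degree g"
    and deg_pos: "d > 0" and cop: "coprime d q"
begin

text \<open>\<open>ypow N j\<close> is the coefficient of \<open>y^j\<close> in \<open>y^N\<close> reduced by \<open>y^q = y + g(x)\<close>.\<close>

primrec ypow :: "nat \<Rightarrow> nat \<Rightarrow> 'a poly" where
  "ypow 0 = (\<lambda>j. if j = 0 then 1 else 0)"
| "ypow (Suc N) = (\<lambda>j. if j = 0 then g * ypow N (q - 1)
     else if j = 1 then ypow N 0 + ypow N (q - 1) else ypow N (j - 1))"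

lemma q2: "q \<ge> 2" unfolding q_def by (rule card_field_ge_2)

lemma ypow_eval:
  assumes "y ^ q = y + ev g x"
  shows "y ^ N = (\<Sum>j<q. ev (ypow N j) x * y ^ j)"
proof (induction N)
  case 0
  have "(\<Sum>j<q. ev (ypow 0 j) x * y ^ j) = (\<Sum>j<q. if j = 0 then 1 else 0)"
    by (intro sum.cong) auto
  thus ?case using q2 by simp
next
  case (Suc N)
  obtain r where r: "q = Suc (Suc r)" using q2 by (metis Suc_diff_Suc Suc_1 le_Suc_ex plus_1_eq_Suc add_Suc)
  have r': "q - 1 = Suc r" using r by simp
  define E where "E = (\<lambda>j. ev (ypow N j) x)"
  have "y ^ Suc N = y * (\<Sum>j<Suc (Suc r). E j * y ^ j)" using Suc r by (simp add: E_def)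
  also have "\<dots> = (\<Sum>j<Suc r. E j * y ^ Suc j) + E (Suc r) * y ^ q"
    by (simp only: sum.lessThan_Suc r distrib_left sum_distrib_left power_Suc mult_ac)
  also have "\<dots> = E 0 * y + (\<Sum>j<r. E (Suc j) * y ^ Suc (Suc j)) + E (Suc r) * (y + ev g x)"
    unfolding assms by (simp only: sum.lessThan_Suc_shift power_Suc power_0 mult_1_right)
  also have "\<dots> = ev g x * E (Suc r) + ((E 0 + E (Suc r)) * y + (\<Sum>j<r. E (Suc j) * y ^ Suc (Suc j)))"
    by (simp add: algebra_simps)
  also have "\<dots> = (\<Sum>j<Suc (Suc r). ev (ypow (Suc N) j) x * y ^ j)"
    unfolding sum.lessThan_Suc_shift using r' by (simp add: E_def)
  finally show ?case using r by simp
qed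

text \<open>At infinity \<open>x\<close> has a pole of order \<open>q\<close> and \<open>y\<close>
  one of order \<open>d\<close>. The power \<open>y^N\<close> has order \<open>d * N\<close>, and
  replacing \<open>y^q\<close> by \<open>y + g(x)\<close> introduces no term of larger
  order.\<close>

lemma ypow_coeff_bound:
  "j < q \<Longrightarrow> coeff (ypow N j) i \<noteq> 0 \<Longrightarrow> q * i + d * j \<le> d * N"
proof (induction N arbitrary: i j)
  case 0
  thus ?case by (auto split: if_splits simp: coeff_1)
next
  case (Suc N)
  have IHlast: "q * i + d * (q - 1) \<le> d * N" if "coeff (ypow N (q - 1)) i \<noteq> 0" for i
    using Suc.IH[of "q - 1" i] that q2 by simp
  have dq: "q * d = d * (q - 1) + d" using q2 by (cases q) auto
  consider "j = 0" | "j = 1" | "j \<ge> 2" by linarith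
  thus ?case
  proof cases
    case 1
    define P where "P = ypow N (q - 1)"
    have nz: "coeff (g * P) i \<noteq> 0" using Suc.prems 1 by (simp add: P_def)
    hence "P \<noteq> 0" by auto
    hence "q * degree P + d * (q - 1) \<le> d * N" using IHlast unfolding P_def by simp
    moreover have "i \<le> d + degree P" using nz degree_mult_le[of g P] le_degree[of "g * P" i] d_def by linarith
    hence "q * i \<le> q * d + q * degree P" by (metis distrib_left mult_le_mono2)
    ultimately show ?thesis using 1 dq by simp
  next
    case 2
    hence "coeff (ypow N 0) i \<noteq> 0 \<or> coeff (ypow N (q - 1)) i \<noteq> 0" using Suc.prems by auto
    thus ?thesis
    proof
      assume "coeff (ypow N 0) i \<noteq> 0"
      thus ?thesis using Suc.IH[of 0 i] q2 2 by simp
    next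
      assume "coeff (ypow N (q - 1)) i \<noteq> 0"
      thus ?thesis using IHlast[of i] 2 by simp
    qed
  next
    case 3
    hence "q * i + d * (j - 1) \<le> d * N" using Suc.IH[of "j - 1" i] Suc.prems by simp
    moreover have "d * j = d * (j - 1) + d" using 3 by (cases j) auto
    ultimately show ?thesis by simp
  qed
qed

text \<open>A term of full pole order \<open>d * N\<close> survives the reduction: each of the
  \<open>N div q\<close> replacements of \<open>y^q\<close> contributes the leading term of
  \<open>g\<close>, and \<open>y^(N mod q)\<close> is left over.\<close>

lemma ypow_coeff_lead: "coeff (ypow N (N mod q)) (d * (N div q)) \<noteq> 0"
proof (induction N)
  case (Suc N)
  have N: "d * N = q * (d * (N div q)) + d * (N mod q)"
  proof -
    have "d * N = d * (q * (N div q) + N mod q)" by simp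
    thus ?thesis by (simp only: distrib_left mult_ac)
  qed
  have q0: "q > 0" using q2 by simp
  show ?case
  proof (cases "N mod q = q - 1")
    case True
    have m: "Suc N mod q = 0" "Suc N div q = Suc (N div q)"
      using True q2 by (simp_all add: mod_Suc div_Suc)
    define P where "P = ypow N (q - 1)"
    have P: "coeff P (d * (N div q)) \<noteq> 0" using Suc True by (simp add: P_def)
    have "i \<le> d * (N div q)" if "coeff P i \<noteq> 0" for i
    proof -
      have "q * i \<le> q * (d * (N div q))"
        using ypow_coeff_bound[of "q - 1" N i] that q2 N True unfolding P_def by simp
      thus ?thesis using q0 by simp
    qed
    hence "degree P \<le> d * (N div q)" by (meson degree_le leI order.asym not_le)
    hence deg: "degree P = d * (N div q)" using le_degree[OF P] by simp
    have "coeff (g * P) (d + degree P) = coeff g d * coeff P (degree P)"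
      unfolding d_def by (rule coeff_mult_degree_sum)
    also have "\<dots> \<noteq> 0" using P deg_pos deg d_def by auto
    finally show ?thesis using m deg by (simp add: P_def algebra_simps)
  next
    case False
    have m: "Suc N mod q = Suc (N mod q)" "Suc N div q = N div q"
      using False q2 by (auto simp: mod_Suc div_Suc)
    show ?thesis
    proof (cases "N mod q = 0")
      case True
      \<comment> \<open>The coefficient at \<open>y\<close> also receives the carry from
        \<open>y^(q - 1)\<close>; at this power of \<open>x\<close> the carry would violate the pole
        order bound.\<close>
      have "coeff (ypow N (q - 1)) (d * (N div q)) = 0"
      proof (rule ccontr)
        assume "\<not> ?thesis"
        hence "d * (q - 1) \<le> 0" using ypow_coeff_bound[of "q - 1" N "d * (N div q)"] q2 N True by simp
        thus False using deg_pos q2 by simp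
      qed
      thus ?thesis using m True Suc by simp
    next
      case False
      thus ?thesis using m Suc by simp
    qed
  qed
qed simp

text \<open>Reduce modulo \<open>q\<close>: as \<open>d\<close> is prime to \<open>q\<close>, this
  determines \<open>j\<close>, and then \<open>i\<close> follows.\<close>

lemma weight_inj:
  assumes "q * i + d * j = q * i' + d * j'" "j < q" "j' < q"
  shows "i = i' \<and> j = j'"
proof -
  have "[d * j = d * j'] (mod q)"
    using arg_cong[OF assms(1), of "\<lambda>x. x mod q"] unfolding Cong.cong_def by simp
  hence "[j = j'] (mod q)" using cop by (simp add: cong_mult_lcancel_nat)
  hence "j = j'" using assms unfolding Cong.cong_def by simp
  thus ?thesis using assms q2 by simp
qed


section \<open>The auxiliary function of Stepanov's method\<close>

context
  fixes R S :: nat and a :: 'a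
  assumes S_def: "S = q * R" and R_large: "R > (d + 1) ^ 2"
begin

text \<open>A function \<open>u = \<Sum> c x^(i + i' S) y^(j + j' S)\<close> on the curve \<open>y^q = y + g(x)\<close> is written
  in the basis \<open>1, y, ..., y^(q - 1)\<close> with coefficients \<open>aux_poly c\<close>, and \<open>aux_power c\<close> are the
  coefficients of \<open>u^S\<close> after the reduction by \<open>x^(S^2) = x\<close> and \<open>y^(S^2) = y + a\<close>. The pole orders at
  infinity of the monomials, given by \<open>weight\<close>, are distinct, so \<open>u\<close> does not vanish
  identically; by counting, some \<open>c \<noteq> 0\<close> has \<open>aux_power c = 0\<close>.\<close>

definition exponents :: "quad set" where
  "exponents = {..<R - d} \<times> {..<q} \<times> {..<R + d + 1} \<times> {..<q}"

definition weight :: "quad \<Rightarrow> nat" where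
  "weight = (\<lambda>(i, j, i', j'). q * (i + i' * S) + d * (j + j' * S))"

definition aux_poly :: "(quad \<Rightarrow> 'a) \<Rightarrow> nat \<Rightarrow> 'a poly" where
  "aux_poly c J = (\<Sum>t\<in>exponents. case t of (i, j, i', j') \<Rightarrow>
     Polynomial.smult (c t) (monom 1 (i + i' * S) * ypow (j + j' * S) J))"

definition aux_power :: "(quad \<Rightarrow> 'a) \<Rightarrow> nat \<Rightarrow> 'a poly" where
  "aux_power c J = (\<Sum>t\<in>exponents. case t of (i, j, i', j') \<Rightarrow>
     Polynomial.smult (c t) (monom 1 (i * S + i') *
       (\<Sum>l\<le>j'. Polynomial.smult (of_nat (j' choose l) * a ^ (j' - l)) (ypow (j * S + l) J))))"

text \<open>The first bound makes \<open>R - d\<close> a genuine range, the second makes the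
  unknowns outnumber the equations in \<open>card_idx_gt\<close>, and the third keeps the degrees of
  \<open>aux_power\<close> below \<open>R * S\<close>.\<close>

lemma R_gt: "R > d" "R > d * d + d" "R > 2 * d + 1"
  using R_large by (simp_all add: power2_eq_square)

lemma S_pos: "S > 0" using R_gt q2 by (simp add: S_def)

lemma finite_exponents: "finite exponents" by (simp add: exponents_def)

text \<open>The cut-off \<open>R - d\<close> is chosen for this: giving up \<open>d\<close> values
  of \<open>i\<close> makes room for \<open>d * j\<close> with \<open>j < q\<close>, so the low part
  of a weight stays below \<open>S = q * R\<close>.\<close>

lemma low_weight_less:
  assumes "i < R - d" "j < q"
  shows "q * i + d * j + q + d \<le> S"
proof -
  have "q * (i + 1) \<le> q * (R - d)" using assms by (intro mult_le_mono) auto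
  moreover have "d * (j + 1) \<le> d * q" using assms by (intro mult_le_mono) auto
  moreover have "q * (R - d) + d * q = q * R"
    using R_gt(1) by (metis add.commute distrib_left le_add_diff_inverse less_imp_le mult.commute)
  ultimately show ?thesis by (simp add: S_def)
qed

lemma weight_split: "weight (i, j, i', j') = (q * i + d * j) + S * (q * i' + d * j')"
  by (simp add: weight_def algebra_simps)

text \<open>A weight is a number in base \<open>S\<close> whose low digit is
  \<open>q * i + d * j\<close>; once the two parts are separated, \<open>weight_inj\<close> decodes
  each of them.\<close>

lemma inj_weight: "inj_on weight exponents"
proof (rule inj_onI)
  fix s t assume st: "s \<in> exponents" "t \<in> exponents" "weight s = weight t"
  obtain i j i' j' where s: "s = (i, j, i', j')" by (metis prod_cases4)
  obtain k l k' l' where t: "t = (k, l, k', l')" by (metis prod_cases4)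
  have less: "q * i + d * j < S" "q * k + d * l < S"
    using low_weight_less[of i j] low_weight_less[of k l] st(1,2) q2 unfolding s t exponents_def by auto
  have e: "(q * i + d * j) + S * (q * i' + d * j') = (q * k + d * l) + S * (q * k' + d * l')"
    using st(3) unfolding s t weight_split .
  have "q * i + d * j = q * k + d * l"
    using arg_cong[OF e, of "\<lambda>x. x mod S"] less by simp
  moreover from this have "q * i' + d * j' = q * k' + d * l'"
    using e S_pos by simp
  ultimately show "s = t"
    using weight_inj[of i j k l] weight_inj[of i' j' k' l'] st(1,2) unfolding s t exponents_def by auto
qed

lemma monom_mult_coeff:
  fixes P :: "'a poly"
  shows "coeff (monom 1 m * P) e = (if e < m then 0 else coeff P (e - m))"
  by (simp add: coeff_monom_mult)

lemma aux_poly_term_coeff: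
  assumes "J < q" "coeff (monom 1 (i + i' * S) * ypow (j + j' * S) J) e \<noteq> 0"
  shows "q * e + d * J \<le> weight (i, j, i', j')"
proof -
  have e: "e \<ge> i + i' * S" "coeff (ypow (j + j' * S) J) (e - (i + i' * S)) \<noteq> 0"
    using assms(2) unfolding monom_mult_coeff by (auto split: if_splits)
  have "q * (e - (i + i' * S)) + d * J \<le> d * (j + j' * S)"
    by (rule ypow_coeff_bound[OF assms(1) e(2)])
  moreover have "q * e = q * (e - (i + i' * S)) + q * (i + i' * S)"
    using e(1) by (metis distrib_left le_add_diff_inverse2)
  ultimately show ?thesis by (simp add: weight_def)
qed

text \<open>Among the terms with nonzero coefficient, the one of largest weight is unique because
  \<open>weight\<close> is injective. No other term reaches its pole order, so its leading
  coefficient is not cancelled.\<close>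

lemma aux_poly_nonzero:
  assumes "t \<in> exponents" "c t \<noteq> 0"
  obtains J where "J < q" "aux_poly c J \<noteq> 0"
proof -
  define T where "T = {t \<in> exponents. c t \<noteq> 0}"
  have "t \<in> T" using assms by (simp add: T_def)
  hence "T \<noteq> {}" by blast
  moreover have "finite T" using finite_exponents by (auto simp: T_def)
  ultimately have T: "finite T" "T \<noteq> {}" by auto
  hence "Max (weight ` T) \<in> weight ` T" by (intro Max_in) auto
  then obtain s where s: "s \<in> T" "weight s = Max (weight ` T)" by auto
  have max: "weight t \<le> weight s" if "t \<in> T" for t using that T s(2) by simp
  obtain i j i' j' where s_eq: "s = (i, j, i', j')" by (metis prod_cases4)
  define N where "N = j + j' * S"
  define J where "J = N mod q"
  \<comment> \<open>The place at which \<open>ypow_coeff_lead\<close> finds the leading coefficient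
    of the chosen term.\<close>
  define e where "e = i + i' * S + d * (N div q)"
  have J: "J < q" using q2 by (simp add: J_def)
  have we: "q * e + d * J = weight s"
  proof -
    have "d * N = q * (d * (N div q)) + d * (N mod q)"
      by (metis distrib_left mult.left_commute mult_div_mod_eq)
    thus ?thesis unfolding s_eq weight_def e_def J_def N_def by (simp add: algebra_simps)
  qed
  define tm where "tm = (\<lambda>t. case t of (i, j, i', j') \<Rightarrow>
     Polynomial.smult (c t) (monom 1 (i + i' * S) * ypow (j + j' * S) J))"
  have zero: "coeff (tm t) e = 0" if "t \<in> exponents - {s}" for t
  proof (rule ccontr)
    assume nz: "coeff (tm t) e \<noteq> 0"
    obtain k l k' l' where t: "t = (k, l, k', l')" by (metis prod_cases4)
    have c: "c t \<noteq> 0" and nz': "coeff (monom 1 (k + k' * S) * ypow (l + l' * S) J) e \<noteq> 0"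
      using nz unfolding tm_def t by auto
    have "weight s \<le> weight t" using aux_poly_term_coeff[OF J nz'] we t by simp
    moreover have "t \<in> T" using c that by (simp add: T_def)
    ultimately have "weight s = weight t" using max by (simp add: le_antisym)
    thus False using inj_weight that s unfolding inj_on_def T_def by auto
  qed
  have "coeff (aux_poly c J) e = (\<Sum>t\<in>exponents. coeff (tm t) e)"
    unfolding aux_poly_def tm_def by (simp add: coeff_sum)
  also have "\<dots> = coeff (tm s) e"
    using sum.mono_neutral_right[OF finite_exponents, of "{s}" "\<lambda>t. coeff (tm t) e"] zero s
    by (simp add: T_def)
  also have "\<dots> = c s * coeff (ypow N J) (d * (N div q))"
    unfolding tm_def s_eq monom_mult_coeff prod.case coeff_smult e_def N_def by simp
  also have "\<dots> \<noteq> 0" using ypow_coeff_lead[of N] s by (simp add: J_def T_def)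
  finally show thesis using that J by fastforce
qed

lemma high_weight_less:
  assumes "i' < R + d + 1" "j' < q"
  shows "q * i' + d * j' + q + d \<le> S + q * (2 * d + 1)"
proof -
  have "q * (i' + 1) \<le> q * (R + d + 1)" using assms by (intro mult_le_mono) auto
  moreover have "d * (j' + 1) \<le> d * q" using assms by (intro mult_le_mono) auto
  ultimately show ?thesis by (simp add: S_def algebra_simps)
qed

text \<open>The degree bounds the number of zeros. Its main part \<open>S * S / q\<close> is the
  expected size of a trace fibre in a field of order \<open>S * S\<close>, and the excess is a
  multiple of \<open>S\<close>, the square root of that order.\<close>

lemma aux_poly_degree:
  assumes "J < q" 
  shows "q * degree (aux_poly c J) \<le> S * (S + q * (2 * d + 1))"
proof (cases "aux_poly c J = 0")
  case False
  hence "(\<Sum>t\<in>exponents. case t of (i, j, i', j') \<Rightarrow> coeff (Polynomial.smult (c t)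
      (monom 1 (i + i' * S) * ypow (j + j' * S) J)) (degree (aux_poly c J))) \<noteq> 0"
    using leading_coeff_neq_0[OF False] unfolding aux_poly_def by (simp add: coeff_sum case_prod_beta')
  then obtain t where t: "t \<in> exponents" "(case t of (i, j, i', j') \<Rightarrow> coeff (Polynomial.smult (c t)
      (monom 1 (i + i' * S) * ypow (j + j' * S) J)) (degree (aux_poly c J))) \<noteq> 0"
    using sum.not_neutral_contains_not_neutral by blast
  obtain i j i' j' where t_eq: "t = (i, j, i', j')" by (metis prod_cases4)
  have "q * degree (aux_poly c J) + d * J \<le> weight (i, j, i', j')"
    using t(2) unfolding t_eq by (intro aux_poly_term_coeff[OF assms]) auto
  also have "\<dots> \<le> S + S * (q * i' + d * j')"
    using low_weight_less[of i j] t(1) unfolding weight_split t_eq exponents_def by auto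
  also have "\<dots> = S * (q * i' + d * j' + 1)" by simp
  also have "\<dots> \<le> S * (S + q * (2 * d + 1))"
    using high_weight_less[of i' j'] t(1) q2 deg_pos unfolding t_eq exponents_def by (intro mult_le_mono) auto
  finally show ?thesis by simp
qed simp

text \<open>With \<open>J < q\<close> this leaves at most \<open>q * R * S\<close> linear conditions
  for the vanishing of all \<open>aux_power c J\<close>.\<close>

lemma aux_power_degree:
  assumes "J < q" "coeff (aux_power c J) e \<noteq> 0"
  shows "e < R * S"
proof -
  define f where "f = (\<lambda>(i, j, i', j'). monom 1 (i * S + i') *
       (\<Sum>l\<le>j'. Polynomial.smult (of_nat (j' choose l) * a ^ (j' - l)) (ypow (j * S + l) J)))"
  have "aux_power c J = (\<Sum>t\<in>exponents. Polynomial.smult (c t) (f t))"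
    unfolding aux_power_def f_def by (intro sum.cong) auto
  hence "(\<Sum>t\<in>exponents. c t * coeff (f t) e) \<noteq> 0"
    using assms(2) by (simp add: coeff_sum)
  then obtain t where "t \<in> exponents" "c t * coeff (f t) e \<noteq> 0"
    by (rule sum.not_neutral_contains_not_neutral)
  hence t: "t \<in> exponents" "coeff (f t) e \<noteq> 0" by auto
  obtain i j i' j' where t_eq: "t = (i, j, i', j')" by (metis prod_cases4)
  have e: "e \<ge> i * S + i'" and
    nz: "coeff (\<Sum>l\<le>j'. Polynomial.smult (of_nat (j' choose l) * a ^ (j' - l)) (ypow (j * S + l) J)) (e - (i * S + i')) \<noteq> 0"
    using t(2) unfolding t_eq f_def prod.case monom_mult_coeff by (auto split: if_splits)
  from nz have "(\<Sum>l\<le>j'. of_nat (j' choose l) * a ^ (j' - l) * coeff (ypow (j * S + l) J) (e - (i * S + i'))) \<noteq> 0"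
    by (simp add: coeff_sum)
  then obtain l where "l \<in> {..j'}"
      "of_nat (j' choose l) * a ^ (j' - l) * coeff (ypow (j * S + l) J) (e - (i * S + i')) \<noteq> 0"
    by (rule sum.not_neutral_contains_not_neutral)
  hence l: "l \<le> j'" "coeff (ypow (j * S + l) J) (e - (i * S + i')) \<noteq> 0" by auto
  have "q * (e - (i * S + i')) \<le> d * (j * S + l)"
    using ypow_coeff_bound[OF assms(1) l(2)] by simp
  also have "\<dots> \<le> d * (j * S + j')" using l(1) by (intro mult_le_mono) auto
  finally have "q * (e - (i * S + i')) \<le> d * (j * S + j')" .
  moreover have "q * e = q * (e - (i * S + i')) + q * (i * S + i')"
    using e by (metis distrib_left le_add_diff_inverse2)
  ultimately have "q * e \<le> S * (q * i + d * j) + (q * i' + d * j')"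
    by (simp add: algebra_simps)
  \<comment> \<open>\<open>low_weight_less\<close> leaves a margin \<open>q + d \<ge> 3\<close>. The
    high part adds at most \<open>2 * S\<close>, so a margin of three keeps the total strictly below
    \<open>S * S\<close>.\<close>
  also have "q * i + d * j \<le> S - 3"
    using low_weight_less[of i j] t(1) q2 deg_pos unfolding t_eq exponents_def by auto
  hence "S * (q * i + d * j) \<le> S * (S - 3)" by (rule mult_le_mono2)
  also have "q * i' + d * j' \<le> S + q * (2 * d + 1)"
    using high_weight_less[of i' j'] t(1) unfolding t_eq exponents_def by auto
  also have "q * (2 * d + 1) \<le> S" unfolding S_def using R_gt(3) by (intro mult_le_mono) auto
  finally have "q * e \<le> S * (S - 3) + (S + S)" by simp
  also have "S \<ge> 3"
  proof -
    have "2 * 3 \<le> q * R" using q2 R_gt(3) deg_pos by (intro mult_le_mono) auto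
    thus ?thesis by (simp add: S_def)
  qed
  then obtain k where "S = k + 3" by (metis add.commute le_Suc_ex)
  hence "S * (S - 3) + (S + S) + S = S * S" by (simp add: algebra_simps)
  hence "S * (S - 3) + (S + S) < S * S" using S_pos by linarith
  finally have "q * e < q * (R * S)" by (simp add: S_def mult_ac)
  thus ?thesis by simp
qed

lemma card_exponents: "card exponents = (R - d) * (q * ((R + d + 1) * q))"
  by (simp add: exponents_def card_cartesian_product)

text \<open>\<open>(R - d) * (R + d + 1)\<close> exceeds \<open>R * R\<close> by
  \<open>R - d * d - d\<close>: the \<open>d + 1\<close> extra values of \<open>i'\<close> outweigh
  the \<open>d\<close> values of \<open>i\<close> that were given up.\<close>

lemma card_idx_gt: "q * (R * S) < card exponents"
proof -
  obtain k where k: "R = d + k" using R_gt(1) by (metis less_imp_add_positive)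
  have "k > d * d" using R_gt(2) k by simp
  hence "R * R < (R - d) * (R + d + 1)" unfolding k by (simp add: algebra_simps)
  hence "q * q * (R * R) < q * q * ((R - d) * (R + d + 1))" using q2 by simp
  thus ?thesis unfolding card_exponents S_def by (simp only: mult_ac)
qed

lemma aux_power_diff: "aux_power (\<lambda>t. c t - c' t) J = aux_power c J - aux_power c' J"
  unfolding aux_power_def sum_subtractf[symmetric]
  by (intro sum.cong refl) (auto simp: smult_diff_left split: prod.splits)

text \<open>There are more families \<open>c\<close> than possible values of the coefficients of
  \<open>aux_power c\<close>, so two families agree there; as \<open>aux_power\<close> is additive
  in \<open>c\<close>, their difference is the desired one.\<close>

lemma exists_aux_power_zero:
  obtains c t where "t \<in> exponents" "c t \<noteq> 0" "\<And>J. J < q \<Longrightarrow> aux_power c J = 0"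
proof -
  define A where "A = exponents \<rightarrow>\<^sub>E (UNIV :: 'a set)"
  define B where "B = ({..<q} \<times> {..<R * S}) \<rightarrow>\<^sub>E (UNIV :: 'a set)"
  define f where "f = (\<lambda>c. restrict (\<lambda>(J, e). coeff (aux_power c J) e) ({..<q} \<times> {..<R * S}))"
  have "card B = q ^ (q * (R * S))"
    unfolding B_def q_def by (subst card_funcsetE) (auto simp: card_cartesian_product)
  also have "\<dots> < q ^ card exponents" using card_idx_gt q2 by (intro power_strict_increasing) auto
  also have "\<dots> = card A"
    unfolding A_def using card_funcsetE[OF finite_exponents, of "UNIV :: 'a set"] q_def by simp
  finally have "card B < card A" .
  moreover have "finite B" unfolding B_def by (intro finite_PiE) auto
  moreover have "f ` A \<subseteq> B" unfolding f_def B_def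
    by (intro image_subsetI restrict_PiE_iff[THEN iffD2] ballI UNIV_I)
  ultimately have "card (f ` A) < card A" by (meson card_mono le_less_trans)
  hence "\<not> inj_on f A" by (rule pigeonhole)
  then obtain c c' where c: "c \<in> A" "c' \<in> A" "f c = f c'" "c \<noteq> c'" unfolding inj_on_def by blast
  have "\<exists>t\<in>exponents. c t \<noteq> c' t"
  proof (rule ccontr)
    assume "\<not> ?thesis"
    hence "c = c'" using c(1,2) unfolding A_def by (intro PiE_ext) auto
    thus False using c by simp
  qed
  then obtain t where t: "t \<in> exponents" "c t \<noteq> c' t" by blast
  show thesis
  proof (rule that[of t "\<lambda>t. c t - c' t"])
    fix J assume J: "J < q"
    show "aux_power (\<lambda>t. c t - c' t) J = 0"
    proof (rule poly_eqI)
      fix e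
      show "coeff (aux_power (\<lambda>t. c t - c' t) J) e = coeff 0 e"
      proof (cases "e < R * S")
        case True
        have "f c (J, e) = f c' (J, e)" using c by simp
        thus ?thesis using J True by (simp add: f_def aux_power_diff)
      next
        case False
        thus ?thesis using aux_power_degree[OF J] by auto
      qed
    qed
  qed (use t in auto)
qed

end

text \<open>The relation telescopes under iterated Frobenius. For \<open>m = 2 * s\<close> the sum
  is the trace of \<open>g(x)\<close> when \<open>x\<close> lies in the extension of that
  degree.\<close>

lemma artin_schreier_frob:
  assumes "y ^ q = y + ev g x"
  shows "y ^ (q ^ m) = y + (\<Sum>i<m. ev g x ^ (q ^ i))"
proof (induction m)
  case (Suc m)
  have "y ^ (q ^ Suc m) = (y ^ q) ^ (q ^ m)" by (simp add: power_mult)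
  also have "\<dots> = y ^ (q ^ m) + ev g x ^ (q ^ m)" unfolding assms unfolding q_def by (rule frob_add)
  finally show ?case using Suc by simp
qed simp

text \<open>The points above \<open>x\<close> contain a coset of the base field: adding
  \<open>c\<close> with \<open>c^q = c\<close> to one solution gives another.\<close>

lemma card_artin_schreier_fiber:
  "\<exists>Y. card Y = q \<and> (\<forall>y\<in>Y. y ^ q = y + ev g x)"
proof -
  define P where "P = monom 1 q - monom 1 1 - [:ev g x:]"
  have "coeff P q = 1" using q2 by (simp add: P_def coeff_pCons split: nat.splits)
  hence "degree P \<ge> q" by (intro le_degree) auto
  then obtain y where "poly P y = 0" using alg_closed_imp_poly_has_root[of P] q2 by auto
  hence y: "y ^ q = y + ev g x" by (simp add: P_def poly_monom algebra_simps)
  define Y where "Y = range (\<lambda>c. y + to_ac c)"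
  have "card Y = q" unfolding Y_def q_def by (intro card_image inj_onI) auto
  moreover have "z ^ q = z + ev g x" if zY: "z \<in> Y" for z
  proof -
    obtain c where z: "z = y + to_ac c" using zY unfolding Y_def by blast
    show ?thesis unfolding z using frob_add[of y "to_ac c" 1] power_card_power_to_ac[of c 1] y
      by (simp add: q_def)
  qed
  ultimately show ?thesis by blast
qed

text \<open>At a point of the fibre the \<open>S\<close>-th power exchanges the two digits of each
  exponent, up to the shift by \<open>a\<close>. So \<open>u^S\<close> is a combination of the
  \<open>aux_power c J\<close> and vanishes. This holds at \<open>q\<close> values of
  \<open>y\<close> above \<open>x\<close>, while \<open>u\<close> has degree less than
  \<open>q\<close> in \<open>y\<close>; hence each of its coefficients vanishes at
  \<open>x\<close>.\<close>

lemma aux_poly_vanishes: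
  assumes "S = q * R" "R > (d + 1) ^ 2" "S = q ^ s"
    and aux_power: "\<And>J. J < q \<Longrightarrow> aux_power R S a c J = 0"
    and x: "x ^ (q ^ (2 * s)) = x" "(\<Sum>i<2 * s. ev g x ^ (q ^ i)) = to_ac a"
    and J: "J < q"
  shows "ev (aux_poly R S c J) x = 0"
proof -
  have SS: "q ^ (2 * s) = S * S" using assms(3) by (simp add: power_mult power2_eq_square mult.commute[of 2])
  have frS: "sum f A ^ S = (\<Sum>x\<in>A. f x ^ S)" for f :: "quad \<Rightarrow> 'a alg_closure" and A
    using frob_sum[of f A s] unfolding assms(3) q_def .
  define k where "k = (\<lambda>t. to_ac (c t))"
  define b where "b = (\<lambda>j' l. to_ac (of_nat (j' choose l) * a ^ (j' - l)))"
  have u: "(\<Sum>J<q. ev (aux_poly R S c J) x * y ^ J) = 0" (is "?u = 0") if y: "y ^ q = y + ev g x" for y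
  proof -
    have yQ: "y ^ (S * S) = y + to_ac a" using artin_schreier_frob[OF y, of "2 * s"] x SS by simp
    have xQ: "x ^ (S * S) = x" using x SS by simp
    define m where "m = (\<lambda>t :: quad. case t of (i, j, i', j') \<Rightarrow> k t * x ^ (i + i' * S))"
    define B where "B = (\<lambda>(t :: quad) J. case t of (i, j, i', j') \<Rightarrow> ev (ypow (j + j' * S) J) x)"
    have evU: "ev (aux_poly R S c J) x = (\<Sum>t\<in>exponents R. m t * B t J)" for J
      unfolding aux_poly_def[OF assms(1,2)] ev_sum
      by (intro sum.cong refl, clarify)
         (simp only: m_def B_def k_def prod.case ev_simps ev_sum to_ac_1 mult_1_left mult_ac)
    have "?u = (\<Sum>t\<in>exponents R. \<Sum>J<q. m t * B t J * y ^ J)"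
      unfolding evU sum_distrib_right by (rule sum.swap)
    also have "\<dots> = (\<Sum>t\<in>exponents R. m t * (\<Sum>J<q. B t J * y ^ J))"
      by (simp only: sum_distrib_left mult.assoc)
    also have "\<dots> = (\<Sum>t\<in>exponents R. case t of (i, j, i', j') \<Rightarrow>
       k t * x ^ (i + i' * S) * (\<Sum>J<q. ev (ypow (j + j' * S) J) x * y ^ J))"
      by (intro sum.cong refl, clarify) (simp only: m_def B_def prod.case)
    also have "\<dots> = (\<Sum>t\<in>exponents R. case t of (i, j, i', j') \<Rightarrow> k t * x ^ (i + i' * S) * y ^ (j + j' * S))"
      by (simp only: ypow_eval[OF y, symmetric])
    finally have eq: "?u =
      (\<Sum>t\<in>exponents R. case t of (i, j, i', j') \<Rightarrow> k t * x ^ (i + i' * S) * y ^ (j + j' * S))" .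
    have "?u ^ S =
      (\<Sum>t\<in>exponents R. (case t of (i, j, i', j') \<Rightarrow> k t * x ^ (i + i' * S) * y ^ (j + j' * S)) ^ S)"
      unfolding eq by (rule frS)
    also have "\<dots> = (\<Sum>t\<in>exponents R. case t of (i, j, i', j') \<Rightarrow> k t * x ^ (i * S + i') *
       (\<Sum>l\<le>j'. b j' l * y ^ (j * S + l)))"
    proof (intro sum.cong refl, clarify)
      fix i j i' j' assume "(i, j, i', j') \<in> exponents R"
      have "k t ^ S = k t" for t
        unfolding k_def assms(3) q_def by (rule power_card_power_to_ac)
      moreover have "(x ^ (i + i' * S)) ^ S = x ^ (i * S + i')"
      proof -
        have "(x ^ (i + i' * S)) ^ S = x ^ (i * S) * (x ^ (S * S)) ^ i'"
          by (simp add: power_add power_mult_distrib flip: power_mult) (simp add: mult_ac)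
        thus ?thesis by (simp add: xQ power_add)
      qed
      moreover have "(y ^ (j + j' * S)) ^ S = (\<Sum>l\<le>j'. b j' l * y ^ (j * S + l))"
      proof -
        have "(y ^ (j + j' * S)) ^ S = y ^ (j * S) * (y ^ (S * S)) ^ j'"
          by (simp add: power_add power_mult_distrib flip: power_mult) (simp add: mult_ac)
        also have "\<dots> = y ^ (j * S) * (\<Sum>l\<le>j'. of_nat (j' choose l) * y ^ l * to_ac a ^ (j' - l))"
          unfolding yQ by (simp add: binomial_ring)
        finally show ?thesis by (simp add: b_def sum_distrib_left power_add mult_ac)
      qed
      ultimately show "(k (i, j, i', j') * x ^ (i + i' * S) * y ^ (j + j' * S)) ^ S =
        k (i, j, i', j') * x ^ (i * S + i') *
         (\<Sum>l\<le>j'. b j' l * y ^ (j * S + l))"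
        by (simp add: power_mult_distrib)
    qed
    also have "\<dots> = (\<Sum>t\<in>exponents R. case t of (i, j, i', j') \<Rightarrow> k t * x ^ (i * S + i') *
       (\<Sum>l\<le>j'. b j' l * (\<Sum>J<q. ev (ypow (j * S + l) J) x * y ^ J)))"
      by (simp only: ypow_eval[OF y, symmetric])
    also have "\<dots> = (\<Sum>J<q. ev (aux_power R S a c J) x * y ^ J)"
    proof -
      define m where "m = (\<lambda>t :: quad. case t of (i, j, i', j') \<Rightarrow> k t * x ^ (i * S + i'))"
      define B where "B = (\<lambda>(t :: quad) J. case t of (i, j, i', j') \<Rightarrow> \<Sum>l\<le>j'. b j' l * ev (ypow (j * S + l) J) x)"
      have evV: "ev (aux_power R S a c J) x = (\<Sum>t\<in>exponents R. m t * B t J)" for J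
        unfolding aux_power_def[OF assms(1,2)] ev_sum
        by (intro sum.cong refl, clarify)
           (simp only: m_def B_def b_def k_def prod.case ev_simps ev_sum to_ac_1 mult_1_left mult_ac)
      have "(\<Sum>J<q. ev (aux_power R S a c J) x * y ^ J) = (\<Sum>t\<in>exponents R. \<Sum>J<q. m t * B t J * y ^ J)"
        unfolding evV sum_distrib_right by (rule sum.swap)
      also have "\<dots> = (\<Sum>t\<in>exponents R. m t * (\<Sum>J<q. B t J * y ^ J))"
        by (simp only: sum_distrib_left mult.assoc)
      also have "\<dots> = (\<Sum>t\<in>exponents R. case t of (i, j, i', j') \<Rightarrow> k t * x ^ (i * S + i') *
       (\<Sum>l\<le>j'. b j' l * (\<Sum>J<q. ev (ypow (j * S + l) J) x * y ^ J)))"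
      proof (intro sum.cong refl, clarify)
        fix i j i' j' assume "(i, j, i', j') \<in> exponents R"
        define w where "w = (\<lambda>l J. ev (ypow (j * S + l) J) x)"
        have "(\<Sum>J<q. (\<Sum>l\<le>j'. b j' l * w l J) * y ^ J) = (\<Sum>l\<le>j'. b j' l * (\<Sum>J<q. w l J * y ^ J))"
          unfolding sum_distrib_right sum_distrib_left by (subst sum.swap) (simp only: mult_ac)
        thus "m (i, j, i', j') * (\<Sum>J<q. B (i, j, i', j') J * y ^ J) =
          k (i, j, i', j') * x ^ (i * S + i') *
           (\<Sum>l\<le>j'. b j' l * (\<Sum>J<q. ev (ypow (j * S + l) J) x * y ^ J))"
          by (simp only: m_def B_def w_def prod.case)
      qed
      finally show ?thesis by simp
    qed
    also have "\<dots> = 0" using aux_power by simp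
    finally show ?thesis by simp
  qed
  define W where "W = (\<Sum>J<q. monom (ev (aux_poly R S c J) x) J)"
  have W: "poly W y = (\<Sum>J<q. ev (aux_poly R S c J) x * y ^ J)" for y
    by (simp add: W_def poly_sum poly_monom)
  obtain Y where Y: "card Y = q" "\<forall>y\<in>Y. y ^ q = y + ev g x" using card_artin_schreier_fiber by blast
  have "W = 0"
  proof (rule ccontr)
    assume "W \<noteq> 0"
    have "Y \<subseteq> {y. poly W y = 0}" using u Y(2) by (auto simp: W)
    hence "q \<le> card {y. poly W y = 0}" using Y(1) card_mono[OF poly_roots_finite[OF \<open>W \<noteq> 0\<close>]] by metis
    also have "\<dots> \<le> degree W" by (rule card_poly_roots_bound[OF \<open>W \<noteq> 0\<close>])
    also have "degree W \<le> q - 1" unfolding W_def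
      by (intro degree_sum_le) (auto intro: order.trans[OF degree_monom_le])
    finally show False using q2 by simp
  qed
  moreover have "coeff W J = ev (aux_poly R S c J) x"
    unfolding W_def coeff_sum coeff_monom using J by simp
  ultimately show ?thesis by simp
qed

text \<open>The fibre lies in the zero set of one nonzero \<open>aux_poly c J\<close>. The extension
  degree is even so that \<open>S = q^s\<close> satisfies \<open>x^(S * S) = x\<close> on the
  extension.\<close>

lemma card_trace_fiber_le:
  fixes a :: 'a
  assumes "q ^ (s - 1) > (d + 1) ^ 2" "s > 0"
  defines "Z \<equiv> {x. x ^ (q ^ (2 * s)) = x \<and> (\<Sum>i<2 * s. ev g x ^ (q ^ i)) = to_ac a}"
  shows "q * card Z \<le> q ^ (2 * s) + q * (2 * d + 1) * q ^ s"
proof -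
  define R where "R = q ^ (s - 1)"
  define S where "S = q ^ s"
  have S: "S = q * R" using assms(2) unfolding S_def R_def by (metis Suc_pred' power_Suc)
  have R: "R > (d + 1) ^ 2" using assms(1) by (simp add: R_def)
  obtain c t where c: "t \<in> exponents R" "c t \<noteq> 0" "\<And>J. J < q \<Longrightarrow> aux_power R S a c J = 0"
    by (rule exists_aux_power_zero[OF S R, where a=a]) (rule that)
  obtain J where J: "J < q" "aux_poly R S c J \<noteq> 0"
    by (rule aux_poly_nonzero[where c=c, OF S R c(1,2)]) (rule that)
  have "Z \<subseteq> {x. ev (aux_poly R S c J) x = 0}"
    using aux_poly_vanishes[OF S R S_def c(3) _ _ J(1)] unfolding Z_def by auto
  hence "card Z \<le> degree (aux_poly R S c J)"
    using finite_ev_roots[OF J(2)] by (meson card_mono le_trans)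
  hence "q * card Z \<le> q * degree (aux_poly R S c J)" by simp
  also have "\<dots> \<le> S * (S + q * (2 * d + 1))" by (rule aux_poly_degree[OF S R J(1)])
  finally show ?thesis unfolding S_def by (simp add: algebra_simps power_mult power2_eq_square)
qed

end

section \<open>Frobenius-stable polynomials\<close>

interpretation map_to_ac_div: map_poly_inj_idom_divide_hom "to_ac :: 'a::field \<Rightarrow> 'a alg_closure" ..

interpretation frob: inj_idom_hom "\<lambda>x :: 'a::{field,finite} alg_closure. x ^ CARD('a)"
  using frob_add[where 'a='a and m=1] by unfold_locales (auto simp: power_mult_distrib)
interpretation map_frob: map_poly_inj_idom_hom "\<lambda>x :: 'a::{field,finite} alg_closure. x ^ CARD('a)" ..

lemma prod_linear_nonzero: "(\<Prod>x\<in>#A. [:-x, 1:]) \<noteq> (0 :: 'b::idom poly)"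
  by (induction A) (simp_all del: mult_pCons_left)

lemma proots_prod_linear: "proots (\<Prod>x\<in>#A. [:-x, 1:]) = (A :: 'b::idom multiset)"
proof (induction A)
  case (add a A)
  thus ?case using prod_linear_nonzero[of A] by (simp add: proots_mult del: mult_pCons_left)
qed simp

lemma monic_eq_prod_proots:
  fixes P :: "'b::alg_closed_field poly"
  assumes "lead_coeff P = 1"
  shows "P = (\<Prod>x\<in>#proots P. [:-x, 1:])" "size (proots P) = degree P"
proof -
  have "P \<noteq> 0" using assms by auto
  then obtain A where A: "size A = degree P" "P = (\<Prod>x\<in>#A. [:-x, 1:])"
    using alg_closed_imp_factorization[of P] assms by auto
  moreover have "proots P = A" by (subst A(2)) (rule proots_prod_linear)
  ultimately show "P = (\<Prod>x\<in>#proots P. [:-x, 1:])" "size (proots P) = degree P" by auto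
qed

text \<open>\<open>X^q - X\<close> has at most \<open>q\<close> roots, and the base field already
  supplies \<open>q\<close> of them.\<close>

lemma frob_fixed_in_range:
  fixes x :: "'a::{field,finite} alg_closure"
  assumes "x ^ CARD('a) = x"
  shows "x \<in> range to_ac"
proof -
  define P :: "'a alg_closure poly" where "P = monom 1 CARD('a) - monom 1 1"
  have "coeff P CARD('a) = 1" using card_field_ge_2[where 'a='a] by (simp add: P_def)
  hence P0: "P \<noteq> 0" by auto
  have deg: "degree P \<le> CARD('a)" unfolding P_def
    using card_field_ge_2[where 'a='a] by (intro degree_diff_le degree_monom_le) (auto intro: order.trans[OF degree_monom_le])
  have root: "poly P y = 0 \<longleftrightarrow> y ^ CARD('a) = y" for y by (simp add: P_def poly_monom)
  have sub: "range (to_ac :: 'a \<Rightarrow> _) \<subseteq> {y. poly P y = 0}"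
    unfolding root using power_card_power_to_ac[where 'a='a and m=1] by auto
  have "card {y. poly P y = 0} \<le> CARD('a)" using card_poly_roots_bound[OF P0] deg by linarith
  also have "CARD('a) = card (range (to_ac :: 'a \<Rightarrow> _))" by (simp add: card_image inj_to_ac)
  finally have "range (to_ac :: 'a \<Rightarrow> _) = {y. poly P y = 0}"
    by (intro card_seteq[OF poly_roots_finite[OF P0] sub])
  thus ?thesis using assms root by blast
qed

lemma map_frob_map_to_ac:
  fixes f :: "'a::{field,finite} poly"
  shows "map_poly (\<lambda>x. x ^ CARD('a)) (map_poly to_ac f) = map_poly to_ac f"
  using power_card_power_to_ac[where 'a='a and m=1] by (intro poly_eqI) simp

lemma map_frob_fixed_descends:
  fixes P :: "'a::{field,finite} alg_closure poly"
  assumes "map_poly (\<lambda>x. x ^ CARD('a)) P = P"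
  obtains f :: "'a poly" where "map_poly to_ac f = P"
proof
  have "coeff P i ^ CARD('a) = coeff P i" for i
    using arg_cong[OF assms, of "\<lambda>P. coeff P i"] by simp
  hence "to_ac (of_ac (coeff P i)) = coeff P i" for i by (intro to_ac_of_ac frob_fixed_in_range)
  thus "map_poly to_ac (map_poly of_ac P) = P" by (intro poly_eqI) (simp add: coeff_map_poly)
qed

lemma map_frob_prod_linear:
  fixes A :: "'a::{field,finite} alg_closure multiset"
  shows "map_poly (\<lambda>x. x ^ CARD('a)) (\<Prod>x\<in>#A. [:-x, 1:]) = (\<Prod>x\<in>#image_mset (\<lambda>x. x ^ CARD('a)) A. [:-x, 1:])"
proof (induction A)
  case (add a A)
  have "map_poly (\<lambda>x. x ^ CARD('a)) [:-a, 1:] = [:-(a ^ CARD('a)), 1:]"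
    by (simp add: frob.hom_uminus)
  thus ?case using add by (simp add: map_frob.hom_mult del: mult_pCons_left)
qed simp

definition roots :: "'a::field poly \<Rightarrow> 'a alg_closure multiset" where
  "roots f = proots (map_poly to_ac f)"

lemma roots_mult: "f \<noteq> 0 \<Longrightarrow> h \<noteq> 0 \<Longrightarrow> roots (f * h) = roots f + roots h"
  by (simp add: roots_def map_to_ac.hom_mult proots_mult)

lemma map_to_ac_eq_prod_roots:
  assumes "lead_coeff f = 1"
  shows "map_poly to_ac f = (\<Prod>x\<in>#roots f. [:-x, 1:])" "size (roots f) = degree f"
  using monic_eq_prod_proots[of "map_poly to_ac f"] assms by (simp_all add: roots_def)

lemma frob_roots:
  fixes f :: "'a::{field,finite} poly"
  assumes "lead_coeff f = 1"
  shows "image_mset (\<lambda>x. x ^ CARD('a)) (roots f) = roots f"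
proof -
  have "(\<Prod>x\<in>#image_mset (\<lambda>x. x ^ CARD('a)) (roots f). [:-x, 1:]) = (\<Prod>x\<in>#roots f. [:-x, 1:])"
    using map_frob_prod_linear[of "roots f"] map_frob_map_to_ac[of f] map_to_ac_eq_prod_roots(1)[OF assms]
    by metis
  thus ?thesis by (metis proots_prod_linear)
qed

text \<open>The product of the linear factors has Frobenius-fixed coefficients. With
  \<open>frob_roots\<close> this identifies monic polynomials over the base field with
  Frobenius-stable multisets in the closure; products become sums and divisibility becomes
  inclusion.\<close>

lemma frob_stable_eq_roots:
  fixes A :: "'a::{field,finite} alg_closure multiset"
  assumes "image_mset (\<lambda>x. x ^ CARD('a)) A = A"
  obtains f :: "'a poly" where "lead_coeff f = 1" "roots f = A"
proof -
  define P where "P = (\<Prod>x\<in>#A. [:-x, 1:])"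
  have "map_poly (\<lambda>x. x ^ CARD('a)) P = P"
    unfolding P_def map_frob_prod_linear assms ..
  then obtain f where f: "map_poly to_ac f = P" using map_frob_fixed_descends by blast
  have "lead_coeff P = 1" unfolding P_def by (induction A) (auto simp: lead_coeff_mult simp del: mult_pCons_left)
  hence "to_ac (lead_coeff f) = 1" unfolding f[symmetric] by simp
  hence "lead_coeff f = 1" by simp
  moreover have "roots f = A" by (simp add: roots_def f P_def proots_prod_linear)
  ultimately show thesis using that by blast
qed

lemma dvd_iff_roots_subset:
  assumes "lead_coeff f = 1" "lead_coeff h = 1"
  shows "h dvd f \<longleftrightarrow> roots h \<subseteq># roots f"
proof
  assume "h dvd f"
  then obtain k where k: "f = h * k" by (rule dvdE)
  have "h \<noteq> 0" "k \<noteq> 0" using assms k by auto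
  thus "roots h \<subseteq># roots f" unfolding k by (simp add: roots_mult)
next
  assume "roots h \<subseteq># roots f"
  then obtain B where "roots f = roots h + B" by (metis subset_mset.le_iff_add)
  hence "map_poly to_ac h dvd map_poly to_ac f"
    unfolding map_to_ac_eq_prod_roots(1)[OF assms(1)] map_to_ac_eq_prod_roots(1)[OF assms(2)] by simp
  thus "h dvd f" by (simp add: map_to_ac_div.hom_dvd_iff)
qed

text \<open>For monic \<open>f\<close> this is the trace of multiplication by \<open>g(X)\<close> on
  the quotient ring modulo \<open>f\<close>, embedded in the closure.\<close>

definition rootsum :: "'a::field poly \<Rightarrow> 'a poly \<Rightarrow> 'a alg_closure" where
  "rootsum g f = (\<Sum>x\<in>#roots f. ev g x)"

lemma rootsum_mult: "f \<noteq> 0 \<Longrightarrow> h \<noteq> 0 \<Longrightarrow> rootsum g (f * h) = rootsum g f + rootsum g h"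
  by (simp add: rootsum_def roots_mult)

lemma frob_sum_mset:
  fixes f :: "'b \<Rightarrow> 'a::{field,finite} alg_closure"
  shows "(\<Sum>x\<in>#A. f x) ^ CARD('a) = (\<Sum>x\<in>#A. f x ^ CARD('a))"
  by (induction A) (auto simp: frob.hom_add)

lemma rootsum_in_range:
  fixes f :: "'a::{field,finite} poly"
  assumes "lead_coeff f = 1"
  shows "rootsum g f \<in> range to_ac"
proof (rule frob_fixed_in_range)
  have "rootsum g f ^ CARD('a) = (\<Sum>x\<in>#roots f. ev g (x ^ CARD('a)))"
    unfolding rootsum_def frob_sum_mset using ev_frob[of g _ 1] by simp
  also have "\<dots> = (\<Sum>x\<in>#image_mset (\<lambda>x. x ^ CARD('a)) (roots f). ev g x)"
    by (simp add: multiset.map_comp comp_def)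
  finally show "rootsum g f ^ CARD('a) = rootsum g f" by (simp add: frob_roots[OF assms] rootsum_def)
qed

section \<open>Frobenius orbits and their polynomials\<close>

definition frob_fix :: "nat \<Rightarrow> 'a::{field,finite} alg_closure set" where
  "frob_fix m = {x. x ^ (CARD('a) ^ m) = x}"

definition orbit_sum :: "'a::{field,finite} poly \<Rightarrow> nat \<Rightarrow> 'a alg_closure \<Rightarrow> 'a alg_closure" where
  "orbit_sum g m x = (\<Sum>i<m. ev g x ^ (CARD('a) ^ i))"

text \<open>A multiset, so that an orbit shorter than \<open>m\<close> is run through repeatedly.
  For \<open>x\<close> in the extension of degree \<open>m\<close> these are the roots of the
  characteristic polynomial of \<open>x\<close> over the base field.\<close>

definition orbit_mset :: "nat \<Rightarrow> 'a::{field,finite} alg_closure \<Rightarrow> 'a alg_closure multiset" where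
  "orbit_mset m x = image_mset (\<lambda>i. x ^ (CARD('a) ^ i)) (mset_set {..<m})"

lemma frob_orbit_mset:
  fixes x :: "'a::{field,finite} alg_closure"
  assumes "x \<in> frob_fix m"
  shows "image_mset (\<lambda>x. x ^ CARD('a)) (orbit_mset m x) = orbit_mset m x"
proof (cases m)
  case (Suc k)
  have "image_mset (\<lambda>x. x ^ CARD('a)) (orbit_mset m x) = image_mset (\<lambda>i. x ^ (CARD('a) ^ Suc i)) (mset_set {..<m})"
    unfolding orbit_mset_def by (simp add: multiset.map_comp comp_def flip: power_mult) (simp add: mult.commute)
  also have "\<dots> = image_mset (\<lambda>i. x ^ (CARD('a) ^ i)) (image_mset Suc (mset_set {..<m}))"
    by (simp add: multiset.map_comp comp_def)
  also have "image_mset Suc (mset_set {..<m}) = mset_set (Suc ` {..<m})"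
    by (rule image_mset_mset_set) auto
  also have "Suc ` {..<m} = insert m (Suc ` {..<k})"
    using Suc by (simp add: lessThan_Suc)
  also have "image_mset (\<lambda>i. x ^ (CARD('a) ^ i)) (mset_set (insert m (Suc ` {..<k}))) =
    image_mset (\<lambda>i. x ^ (CARD('a) ^ i)) (mset_set (insert 0 (Suc ` {..<k})))"
    using assms Suc by (subst (1 2) mset_set.insert) (auto simp: frob_fix_def)
  also have "insert 0 (Suc ` {..<k}) = {..<m}"
    using Suc by (simp add: lessThan_Suc_eq_insert_0)
  finally show ?thesis by (simp add: orbit_mset_def)
qed (simp add: orbit_mset_def)

definition orb_poly :: "nat \<Rightarrow> 'a::{field,finite} alg_closure \<Rightarrow> 'a poly" where
  "orb_poly m x = (SOME f. lead_coeff f = 1 \<and> roots f = orbit_mset m x)"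

lemma orb_poly:
  assumes "x \<in> frob_fix m"
  shows "lead_coeff (orb_poly m x) = 1" "roots (orb_poly m x) = orbit_mset m x" "degree (orb_poly m x) = m"
proof -
  obtain f where "lead_coeff f = 1 \<and> roots f = orbit_mset m x"
    using frob_stable_eq_roots[OF frob_orbit_mset[OF assms]] by blast
  hence *: "lead_coeff (orb_poly m x) = 1 \<and> roots (orb_poly m x) = orbit_mset m x"
    unfolding orb_poly_def by (rule someI)
  thus "lead_coeff (orb_poly m x) = 1" "roots (orb_poly m x) = orbit_mset m x" by auto
  have "size (orbit_mset m x) = m" by (simp add: orbit_mset_def)
  thus "degree (orb_poly m x) = m" using map_to_ac_eq_prod_roots(2)[of "orb_poly m x"] * by simp
qed

lemma rootsum_orb_poly:
  assumes "x \<in> frob_fix m"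
  shows "rootsum g (orb_poly m x) = orbit_sum g m x"
  by (simp add: rootsum_def orb_poly(2)[OF assms] orbit_mset_def multiset.map_comp comp_def
       orbit_sum_def ev_frob sum_unfold_sum_mset)

lemma card_enumerate_below:
  assumes "infinite (T :: nat set)"
  shows "card {l \<in> T. l < enumerate T i} = i"
proof -
  have "{l \<in> T. l < enumerate T i} = enumerate T ` {..<i}"
  proof (intro equalityI subsetI)
    fix l assume l: "l \<in> {l \<in> T. l < enumerate T i}"
    then obtain j where "enumerate T j = l" using enumerate_Ex[OF assms] by blast
    thus "l \<in> enumerate T ` {..<i}" using l assms by (auto simp: image_iff)
  qed (use assms in \<open>auto simp: enumerate_in_set\<close>)
  thus ?thesis using card_image[OF inj_on_subset[OF inj_enumerate[OF assms]], of "{..<i}"] by simp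
qed

lemma count_frob_stable:
  fixes A :: "'a::{field,finite} alg_closure multiset"
  assumes "image_mset (\<lambda>x. x ^ CARD('a)) A = A"
  shows "count A (x ^ (CARD('a) ^ l)) = count A x"
proof (induction l)
  case (Suc l)
  have "count A (y ^ CARD('a)) = count A y" for y
  proof -
    have "count (image_mset (\<lambda>x. x ^ CARD('a)) A) (y ^ CARD('a)) = count A y"
    proof -
      have "(\<lambda>x. x ^ CARD('a)) -` {y ^ CARD('a)} = {y}" by (auto simp: frob.eq_iff)
      thus ?thesis unfolding count_image_mset by (cases "y \<in># A") (auto simp: not_in_iff)
    qed
    thus ?thesis using assms by simp
  qed
  from this[of "x ^ (CARD('a) ^ l)"] show ?case using Suc
    by (simp add: mult.commute flip: power_mult)
qed simp

lemma count_orbit_mset: "count (orbit_mset m x) x = card {l. l < m \<and> x \<in> frob_fix l}"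
proof -
  have "{l. l < m \<and> x \<in> frob_fix l} = {..<m} \<inter> (\<lambda>l. x ^ (CARD('a) ^ l)) -` {x}" by (auto simp: frob_fix_def)
  thus ?thesis unfolding orbit_mset_def count_image_mset by (simp add: Int_commute)
qed

text \<open>The Frobenius iterates of \<open>x\<close> stay in the finite support of
  \<open>A\<close>, so two of them coincide; injectivity of the Frobenius map cancels the smaller
  number of iterations.\<close>

lemma frob_period_exists:
  fixes x :: "'a::{field,finite} alg_closure"
  assumes A: "image_mset (\<lambda>x. x ^ CARD('a)) A = A" and x: "x \<in># A"
  shows "\<exists>k>0. x \<in> frob_fix k"
proof -
  define f where "f = (\<lambda>l. x ^ (CARD('a) ^ l))"
  have "f l \<in># A" for l
    using count_frob_stable[OF A, of x l] x by (metis count_greater_zero_iff f_def)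
  hence "finite (range f)" by (meson finite_set_mset finite_subset image_subset_iff)
  hence "\<not> inj f" using finite_imageD by blast
  hence "\<exists>i j. i < j \<and> f i = f j" using linorder_injI[of f] by blast
  then obtain i j where ij: "i < j" "f i = f j" by blast
  have fr: "inj (\<lambda>y :: 'a alg_closure. y ^ (CARD('a) ^ i))"
  proof (induction i)
    case (Suc i)
    have "(\<lambda>y :: 'a alg_closure. y ^ (CARD('a) ^ Suc i)) = (\<lambda>y. (y ^ (CARD('a) ^ i)) ^ CARD('a))"
      by (simp add: mult.commute flip: power_mult)
    thus ?case using Suc by (auto simp: inj_def)
  qed (simp add: inj_def)
  have "f j = (x ^ (CARD('a) ^ (j - i))) ^ (CARD('a) ^ i)"
    using ij(1) by (simp add: f_def flip: power_mult power_add)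
  hence "x ^ (CARD('a) ^ (j - i)) = x" using fr ij(2) unfolding f_def inj_def by metis
  thus ?thesis using ij(1) by (intro exI[of _ "j - i"]) (simp add: frob_fix_def)
qed

text \<open>Each root \<open>x\<close> of \<open>f\<close> is counted with its multiplicity: the exponents \<open>m\<close> with
  \<open>x \<in> frob_fix m\<close> are the positive multiples of the length of the Frobenius orbit of \<open>x\<close>,
  and \<open>orb_poly m x\<close> is the corresponding power of the minimal polynomial.\<close>

lemma card_periods:
  fixes x :: "'a::{field,finite} alg_closure"
  assumes A: "image_mset (\<lambda>x. x ^ CARD('a)) A = A"
  shows "card {m. m > 0 \<and> x \<in> frob_fix m \<and> orbit_mset m x \<subseteq># A} = count A x"
proof (cases "x \<in># A")
  case False
  have mem: "x \<in># orbit_mset m x" if "m > 0" for m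
    unfolding orbit_mset_def set_image_mset using that by (intro image_eqI[of _ _ 0]) simp_all
  have notsub: "\<not> orbit_mset m x \<subseteq># A" if "m > 0" for m
    using mset_subset_eqD[OF _ mem[OF that], of A] False by fast
  have e: "{m. m > 0 \<and> x \<in> frob_fix m \<and> orbit_mset m x \<subseteq># A} = {}"
  proof (rule equals0I)
    fix m assume "m \<in> {m. m > 0 \<and> x \<in> frob_fix m \<and> orbit_mset m x \<subseteq># A}"
    thus False using notsub[of m] by simp
  qed
  show ?thesis unfolding e using False by (simp add: not_in_iff)
next
  case True
  define T where "T = {m. x \<in> frob_fix m}"
  have Tadd: "k + m \<in> T" if "k \<in> T" "m \<in> T" for k m
  proof -
    have "x ^ (CARD('a) ^ (k + m)) = (x ^ (CARD('a) ^ k)) ^ (CARD('a) ^ m)"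
      by (simp only: power_add power_mult)
    thus ?thesis using that unfolding T_def frob_fix_def by simp
  qed
  have "\<exists>k>0. k \<in> T" using frob_period_exists[OF A True] by (simp add: T_def)
  then obtain k where k: "k > 0" "k \<in> T" by blast
  have "i * k \<in> T" for i
  proof (induction i)
    case (Suc i)
    thus ?case using Tadd[OF k(2) Suc] by simp
  qed (simp add: T_def frob_fix_def)
  hence infT: "infinite T"
    using k(1) unfolding infinite_nat_iff_unbounded_le by (metis mult.commute mult_le_mono1 mult_1 Suc_leI One_nat_def)
  \<comment> \<open>\<open>frob_fix 0\<close> is the whole closure, so \<open>0\<close> belongs to
    \<open>T\<close> and comes first.\<close>
  have T0: "enumerate T 0 = 0" unfolding enumerate_0 by (rule Least_eq_0) (simp add: T_def frob_fix_def)
  \<comment> \<open>Both multisets have constant multiplicity along the Frobenius orbit, so a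
    comparison at \<open>x\<close> decides the inclusion. The multiplicity of \<open>x\<close> in
    \<open>orbit_mset m x\<close> is the number of periods below \<open>m\<close>, with
    \<open>0\<close> included.\<close>
  have sub: "orbit_mset m x \<subseteq># A \<longleftrightarrow> card {l \<in> T. l < m} \<le> count A x" if m: "m \<in> T" for m
  proof -
    have c: "count (orbit_mset m x) x = card {l \<in> T. l < m}"
      unfolding count_orbit_mset T_def by (rule arg_cong[of _ _ card]) auto
    have stable: "image_mset (\<lambda>x. x ^ CARD('a)) (orbit_mset m x) = orbit_mset m x"
      using m by (intro frob_orbit_mset) (simp add: T_def)
    show ?thesis
    proof
      assume "orbit_mset m x \<subseteq># A"
      thus "card {l \<in> T. l < m} \<le> count A x" using c by (metis mset_subset_eq_count)
    next
      assume le: "card {l \<in> T. l < m} \<le> count A x"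
      show "orbit_mset m x \<subseteq># A"
      proof (rule mset_subset_eqI)
        fix y show "count (orbit_mset m x) y \<le> count A y"
        proof (cases "y \<in># orbit_mset m x")
          case True
          then obtain l where y: "y = x ^ (CARD('a) ^ l)" by (auto simp: orbit_mset_def)
          show ?thesis unfolding y count_frob_stable[OF stable] count_frob_stable[OF A] using le c by simp
        qed (simp add: not_in_iff)
      qed
    qed
  qed
  \<comment> \<open>The admissible \<open>m\<close> are the first \<open>count A x\<close> periods
    after \<open>0\<close>, hence the range from 1.\<close>
  have "{m. m > 0 \<and> x \<in> frob_fix m \<and> orbit_mset m x \<subseteq># A} = enumerate T ` {1..count A x}"
  proof (intro equalityI subsetI)
    fix m assume m: "m \<in> {m. m > 0 \<and> x \<in> frob_fix m \<and> orbit_mset m x \<subseteq># A}"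
    hence mT: "m \<in> T" by (simp add: T_def)
    then obtain i where i: "enumerate T i = m" using enumerate_Ex[OF infT] by blast
    have "i \<noteq> 0" using m i T0 by (metis (mono_tags, lifting) less_irrefl mem_Collect_eq)
    moreover have "i \<le> count A x" using sub[OF mT] m card_enumerate_below[OF infT, of i] i by simp
    ultimately show "m \<in> enumerate T ` {1..count A x}" using i by (intro image_eqI[of _ _ i]) auto
  next
    fix m assume "m \<in> enumerate T ` {1..count A x}"
    then obtain i where i: "m = enumerate T i" "1 \<le> i" "i \<le> count A x" by auto
    have mT: "m \<in> T" using i enumerate_in_set[OF infT] by simp
    have "m > 0" using enumerate_mono[OF _ infT, of 0 i] i T0 by simp
    moreover have "orbit_mset m x \<subseteq># A" using sub[OF mT] i card_enumerate_below[OF infT, of i] by simp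
    ultimately show "m \<in> {m. m > 0 \<and> x \<in> frob_fix m \<and> orbit_mset m x \<subseteq># A}" using mT by (simp add: T_def)
  qed
  thus ?thesis using card_image[OF inj_on_subset[OF inj_enumerate[OF infT]], of "{1..count A x}"] by simp
qed

section \<open>Character sums and their L-function\<close>

lemma coeff_0_eq_0_iff_roots:
  assumes "f \<noteq> 0"
  shows "coeff f 0 = 0 \<longleftrightarrow> 0 \<in># roots f"
proof -
  have "map_poly to_ac f \<noteq> 0" using assms by simp
  thus ?thesis by (simp add: roots_def poly_0_coeff_0)
qed

lemma finite_monic_polys: "finite {f :: 'a::{field,finite} poly. degree f = j}"
proof -
  have "{f :: 'a poly. degree f = j} \<subseteq> insert 0 (Poly ` {cs. set cs \<subseteq> UNIV \<and> length cs = Suc j})"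
  proof
    fix f :: "'a poly" assume "f \<in> {f. degree f = j}"
    hence "f = Poly (coeffs f)" "f \<noteq> 0 \<Longrightarrow> length (coeffs f) = Suc j"
      by (auto simp: length_coeffs_degree)
    thus "f \<in> insert 0 (Poly ` {cs. set cs \<subseteq> UNIV \<and> length cs = Suc j})" by blast
  qed
  moreover have "finite {cs :: 'a list. set cs \<subseteq> UNIV \<and> length cs = Suc j}"
    by (rule finite_lists_length_eq) simp
  ultimately show ?thesis by (meson finite_imageI finite_insert finite_subset)
qed

text \<open>\<open>X^Q - X\<close> has derivative \<open>-1\<close> because the characteristic
  divides \<open>Q\<close>, so its \<open>Q\<close> roots are all simple.\<close>

lemma card_frob_fix:
  assumes "m > 0"
  shows "finite (frob_fix m :: 'a::{field,finite} alg_closure set)"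
    "card (frob_fix m :: 'a alg_closure set) = CARD('a) ^ m"
proof -
  define Q where "Q = CARD('a) ^ m"
  have "CARD('a) ^ 1 \<le> Q" unfolding Q_def using assms card_field_ge_2[where 'a='a] by (intro power_increasing) auto
  hence Q: "Q \<ge> 2" using card_field_ge_2[where 'a='a] by simp
  have Q0: "of_nat Q = (0 :: 'a alg_closure)"
  proof -
    obtain r where "CARD('a) = CHAR('a) ^ r" "r > 0" using finite_field_card_prime_power by blast
    thus ?thesis using assms unfolding of_nat_eq_0_iff_char_dvd Q_def
      by (simp add: dvd_power flip: power_mult)
  qed
  define P :: "'a alg_closure poly" where "P = monom 1 Q - monom 1 1"
  have cQ: "coeff P Q = 1" using Q by (simp add: P_def)
  have "degree P \<le> Q" unfolding P_def
    using Q by (intro degree_diff_le) (auto intro: order.trans[OF degree_monom_le])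
  hence deg: "degree P = Q" using le_degree[of P Q] cQ by simp
  have P0: "P \<noteq> 0" using cQ by auto
  have root: "poly P x = 0 \<longleftrightarrow> x \<in> frob_fix m" for x by (simp add: P_def poly_monom frob_fix_def Q_def)
  have deriv: "pderiv P = -1" unfolding P_def by (simp add: pderiv_diff pderiv_monom Q0 one_pCons monom_0)
  have le: "order x P \<le> 1" for x
  proof (rule ccontr)
    assume "\<not> order x P \<le> 1"
    hence "[:-x, 1:] ^ 2 dvd P" using P0 by (subst order_divides) auto
    then obtain r where "P = [:-x, 1:] ^ 2 * r" by (rule dvdE)
    hence "P = [:-x, 1:] * ([:-x, 1:] * r)" by (simp only: power2_eq_square mult.assoc)
    hence "poly (pderiv P) x = 0" by (simp add: pderiv_mult del: mult_pCons_left)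
    thus False by (simp add: deriv)
  qed
  have set: "set_mset (proots P) = frob_fix m" using P0 root by auto
  thus "finite (frob_fix m :: 'a alg_closure set)" by (metis finite_set_mset)
  have "size (proots P) = Q" using monic_eq_prod_proots(2)[of P] deg cQ by simp
  hence "Q = (\<Sum>x\<in>frob_fix m. order x P)" using set P0 by (simp add: size_multiset_overloaded_eq)
  also have "\<dots> = (\<Sum>x\<in>(frob_fix m :: 'a alg_closure set). 1)"
  proof (intro sum.cong refl)
    fix x :: "'a alg_closure" assume "x \<in> frob_fix m"
    hence "order x P > 0" using root P0 by (simp add: order_gt_0_iff)
    thus "order x P = 1" using le[of x] by simp
  qed
  finally show "card (frob_fix m :: 'a alg_closure set) = CARD('a) ^ m" by (simp add: Q_def)
qed

lemma of_ac_add: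
  "x \<in> range to_ac \<Longrightarrow> y \<in> range to_ac \<Longrightarrow> of_ac (x + y) = of_ac x + of_ac y"
  by (auto simp flip: to_ac_add)

lemma orbit_sum_in_range:
  assumes "x \<in> frob_fix m"
  shows "orbit_sum g m x \<in> range to_ac"
  using rootsum_in_range[of "orb_poly m x" g] orb_poly(1)[OF assms] rootsum_orb_poly[OF assms] by simp

text \<open>This is the logarithmic derivative of \<open>R\<close> cleared of its denominator:
  \<open>X R' = - R p\<close> with \<open>p\<close> the series of power sums, proved factor by
  factor. It covers every \<open>b\<close>, also beyond the size of \<open>A\<close>.\<close>

lemma newton_identity:
  fixes A :: "'b::field multiset"
  defines "R \<equiv> \<Prod>x\<in>#A. [:1, -x:]"
  shows "of_nat b * coeff R b = -(\<Sum>m=1..b. (\<Sum>x\<in>#A. x ^ m) * coeff R (b - m))"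
proof -
  define p where "p = (\<lambda>A :: 'b multiset. Abs_fps (\<lambda>m. if m = 0 then 0 else \<Sum>x\<in>#A. x ^ m))"
  define F where "F = (\<lambda>A :: 'b multiset. fps_of_poly (\<Prod>x\<in>#A. [:1, -x:]))"
  have "fps_X * fps_deriv (F A) = - (F A * p A)"
  proof (induction A)
    case empty
    have "p {#} = 0" by (intro fps_ext) (simp add: p_def)
    thus ?case by (simp add: F_def)
  next
    case (add a A)
    define G where "G = (1 - fps_const a * fps_X)"
    define s where "s = Abs_fps (\<lambda>m. if m = 0 then 0 else a ^ m)"
    have G: "fps_of_poly [:1, -a:] = G" by (simp add: G_def fps_of_poly_pCons fps_const_neg[symmetric] del: fps_const_neg)
    have F: "F (add_mset a A) = G * F A"
      by (simp add: F_def fps_of_poly_mult G del: mult_pCons_left)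
    have p: "p (add_mset a A) = p A + s" by (intro fps_ext) (simp add: p_def s_def)
    have "G * s = fps_const a * fps_X"
    proof (intro fps_ext)
      fix n show "fps_nth (G * s) n = fps_nth (fps_const a * fps_X) n"
        by (cases n) (auto simp: G_def s_def left_diff_distrib mult.assoc)
    qed
    hence Gs: "fps_X * fps_deriv G = - (G * s)" by (simp add: G_def)
    have "fps_X * fps_deriv (G * F A) = (fps_X * fps_deriv G) * F A + G * (fps_X * fps_deriv (F A))"
      by (simp add: algebra_simps)
    also have "\<dots> = - (G * F A * p (add_mset a A))" unfolding Gs add.IH p by (simp add: algebra_simps)
    finally show ?case unfolding F .
  qed
  hence "fps_nth (fps_X * fps_deriv (F A)) b = - fps_nth (p A * F A) b" by (simp add: mult.commute)
  also have "fps_nth (fps_X * fps_deriv (F A)) b = of_nat b * coeff R b"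
    by (cases b) (auto simp: F_def R_def)
  also have "fps_nth (p A * F A) b = (\<Sum>m=0..b. fps_nth (p A) m * coeff R (b - m))"
    by (simp add: fps_mult_nth F_def R_def)
  also have "\<dots> = (\<Sum>m=1..b. fps_nth (p A) m * coeff R (b - m))"
    by (subst sum.atLeast_Suc_atMost) (auto simp: p_def)
  also have "\<dots> = (\<Sum>m=1..b. (\<Sum>x\<in>#A. x ^ m) * coeff R (b - m))"
    by (intro sum.cong refl) (simp add: p_def)
  finally show ?thesis .
qed

lemma coeff_prod_linear_reflect:
  fixes A :: "'b::field multiset"
  shows "coeff (\<Prod>x\<in>#A. [:1, -x:]) b =
    (if b \<le> size A then coeff (\<Prod>x\<in>#A. [:-x, 1:]) (size A - b) else 0)"
proof -
  have r: "reflect_poly [:-x, 1:] = [:1, -x:]" for x :: 'b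
    by (simp add: reflect_poly_pCons' monom_Suc monom_0)
  have "reflect_poly (\<Prod>x\<in>#A. [:-x, 1:]) = (\<Prod>x\<in>#A. [:1, -x:])"
    by (induction A) (simp_all add: reflect_poly_mult r del: mult_pCons_left)
  moreover have "degree (\<Prod>x\<in>#A. [:-x, 1:]) = size A"
  proof (induction A)
    case (add a A)
    show ?case using add prod_linear_nonzero[of A] by (simp add: degree_mult_eq del: mult_pCons_left)
  qed simp
  ultimately show ?thesis by (metis coeff_reflect_poly not_le)
qed

text \<open>A polynomial that vanishes at every element of \<open>A\<close> except \<open>z\<close>
  combines a fixed number of consecutive power sums into a nonzero multiple of \<open>z^s\<close>.
  So \<open>|z|^s\<close> stays bounded, which rules out \<open>|z| > 1\<close>.\<close>

lemma bounded_power_sums: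
  fixes A :: "complex multiset"
  assumes bd: "\<And>s. s \<ge> s0 \<Longrightarrow> cmod (\<Sum>w\<in>#A. w ^ s) \<le> C" and z: "z \<in># A"
  shows "cmod z \<le> 1"
proof (rule ccontr)
  assume "\<not> cmod z \<le> 1"
  hence gt: "cmod z > 1" by simp
  define P where "P = (\<Prod>w\<in>set_mset A - {z}. [:-w, 1:])"
  have P0: "poly P w = 0 \<longleftrightarrow> w \<noteq> z" if "w \<in># A" for w
    using that by (auto simp: P_def poly_prod)
  define B where "B = (\<Sum>k\<le>degree P. cmod (coeff P k) * C)"
  define D where "D = cmod (of_nat (count A z) * poly P z)"
  have D: "D > 0" using z P0[OF z] by (simp add: D_def)
  have "D * cmod z ^ s \<le> B" if s: "s \<ge> s0" for s
  proof -
    have "(\<Sum>w\<in>#A. poly P w * w ^ s) = (\<Sum>w\<in>#A. if w = z then poly P z * z ^ s else 0)"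
      using P0 by (intro arg_cong[of _ _ sum_mset] image_mset_cong) auto
    hence "of_nat (count A z) * poly P z * z ^ s = (\<Sum>w\<in>#A. poly P w * w ^ s)"
      by (simp add: sum_mset_delta mult_ac)
    also have "\<dots> = (\<Sum>w\<in>#A. \<Sum>k\<le>degree P. coeff P k * w ^ (s + k))"
      by (simp add: poly_altdef sum_distrib_left power_add mult_ac)
    also have "\<dots> = (\<Sum>k\<le>degree P. \<Sum>w\<in>#A. coeff P k * w ^ (s + k))"
      by (induction A) (simp_all add: sum.distrib)
    also have "\<dots> = (\<Sum>k\<le>degree P. coeff P k * (\<Sum>w\<in>#A. w ^ (s + k)))"
      by (simp add: sum_mset_distrib_left multiset.map_comp comp_def)
    finally have "D * cmod z ^ s = cmod (\<Sum>k\<le>degree P. coeff P k * (\<Sum>w\<in>#A. w ^ (s + k)))"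
      unfolding D_def by (metis norm_mult norm_power)
    also have "\<dots> \<le> (\<Sum>k\<le>degree P. cmod (coeff P k * (\<Sum>w\<in>#A. w ^ (s + k))))" by (rule norm_sum)
    also have "\<dots> \<le> B" unfolding B_def norm_mult
      using s by (intro sum_mono mult_left_mono bd) auto
    finally show ?thesis .
  qed
  moreover obtain n where n: "B / D < cmod z ^ n" using real_arch_pow[OF gt] by blast
  have "cmod z ^ n \<le> cmod z ^ (s0 + n)" using gt by (intro power_increasing) auto
  hence "B < D * cmod z ^ (s0 + n)" using n D by (simp add: field_simps less_le_trans)
  ultimately show False by (meson le_add1 not_le)
qed

locale field_character =
  fixes \<psi> :: "'a::{field,finite} \<Rightarrow> complex"
  assumes char_add: "\<psi> (x + y) = \<psi> x * \<psi> y" and norm_char: "cmod (\<psi> x) = 1"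
    and char_nontrivial: "\<exists>x. \<psi> x \<noteq> 1"
begin

lemma char_0 [simp]: "\<psi> 0 = 1"
proof -
  have "\<psi> 0 * \<psi> 0 = \<psi> 0 * 1" using char_add[of 0 0] by simp
  moreover have "\<psi> 0 \<noteq> 0" using norm_char[of 0] by auto
  ultimately show ?thesis by (metis mult_left_cancel)
qed

lemma sum_char: "(\<Sum>x\<in>UNIV. \<psi> x) = 0"
proof -
  obtain y where y: "\<psi> y \<noteq> 1" using char_nontrivial by blast
  have "(\<Sum>x\<in>UNIV. \<psi> x) = (\<Sum>x\<in>UNIV. \<psi> (y + x))"
    by (rule sum.reindex_bij_witness[of _ "\<lambda>x. y + x" "\<lambda>x. x - y"]) auto
  also have "\<dots> = \<psi> y * (\<Sum>x\<in>UNIV. \<psi> x)" by (simp add: char_add sum_distrib_left)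
  finally have "(1 - \<psi> y) * (\<Sum>x\<in>UNIV. \<psi> x) = 0" by (simp add: algebra_simps)
  thus ?thesis using y by simp
qed

lemma sum_char_mult: "(\<Sum>l\<in>UNIV. \<psi> (l * x)) = (if x = 0 then of_nat CARD('a) else 0)"
proof (cases "x = 0")
  case False
  have "(\<Sum>l\<in>UNIV. \<psi> (l * x)) = (\<Sum>l\<in>UNIV. \<psi> l)"
    using False by (intro sum.reindex_bij_witness[of _ "\<lambda>l. l / x" "\<lambda>l. l * x"]) auto
  thus ?thesis using False sum_char by simp
qed simp

definition monics :: "nat \<Rightarrow> 'a poly set" where
  "monics j = {f. lead_coeff f = 1 \<and> degree f = j \<and> coeff f 0 \<noteq> 0}"

definition poly_char :: "'a poly \<Rightarrow> 'a poly \<Rightarrow> complex" where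
  "poly_char g f = \<psi> (of_ac (rootsum g f))"

definition L_coeff :: "'a poly \<Rightarrow> nat \<Rightarrow> complex" where
  "L_coeff g j = (\<Sum>f\<in>monics j. poly_char g f)"

text \<open>For \<open>m > 0\<close> a character sum over the extension of degree \<open>m\<close>,
  evaluated at the trace of \<open>g(x)\<close>. The point 0 is left out to match the nonzero
  constant terms in \<open>monics\<close>.\<close>

definition ext_sum :: "'a poly \<Rightarrow> nat \<Rightarrow> complex" where
  "ext_sum g m = (\<Sum>x\<in>frob_fix m - {0}. \<psi> (of_ac (orbit_sum g m x)))"

lemma finite_monics: "finite (monics j)"
  using finite_monic_polys[of j] by (rule finite_subset[rotated]) (auto simp: monics_def)

lemma poly_char_mult:
  assumes "lead_coeff f = 1" "lead_coeff h = 1"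
  shows "poly_char g (f * h) = poly_char g f * poly_char g h"
proof -
  have "f \<noteq> 0" "h \<noteq> 0" using assms by auto
  thus ?thesis unfolding poly_char_def
    by (simp add: rootsum_mult of_ac_add rootsum_in_range assms char_add)
qed

lemma L_coeff_0 [simp]: "L_coeff g 0 = 1"
proof -
  have "monics 0 = {1}" by (auto simp: monics_def elim!: degree_eq_zeroE)
  moreover have "rootsum g 1 = 0" by (simp add: rootsum_def roots_def)
  ultimately show ?thesis by (simp add: L_coeff_def poly_char_def)
qed

lemma orb_poly_monics:
  assumes "x \<in> frob_fix m - {0}"
  shows "orb_poly m x \<in> monics m"
proof -
  have "x \<in> frob_fix m" using assms by simp
  note n = orb_poly[OF this]
  have "0 \<notin># roots (orb_poly m x)" using assms unfolding n(2) by (auto simp: orbit_mset_def)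
  moreover have "orb_poly m x \<noteq> 0" using n(1) by auto
  ultimately show ?thesis using n by (simp add: monics_def coeff_0_eq_0_iff_roots)
qed

lemma mult_in_monics_iff:
  assumes "f \<in> monics m" "m \<le> j"
  shows "f * h \<in> monics j \<longleftrightarrow> h \<in> monics (j - m)"
proof (cases "h = 0")
  case False
  have f: "lead_coeff f = 1" "degree f = m" "coeff f 0 \<noteq> 0" "f \<noteq> 0" using assms by (auto simp: monics_def)
  have "lead_coeff (f * h) = lead_coeff h" using f by (simp add: lead_coeff_mult)
  moreover have "degree (f * h) = m + degree h" using f False by (simp add: degree_mult_eq)
  moreover have "coeff (f * h) 0 = coeff f 0 * coeff h 0" by (simp add: coeff_mult_0)
  ultimately show ?thesis unfolding monics_def mem_Collect_eq using f assms(2) by auto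
qed (auto simp: monics_def)

lemma sum_poly_char_multiples:
  assumes "x \<in> frob_fix m - {0}" "m \<le> j"
  shows "(\<Sum>f | f \<in> monics j \<and> orb_poly m x dvd f. poly_char g f) = \<psi> (of_ac (orbit_sum g m x)) * L_coeff g (j - m)"
proof -
  have x: "x \<in> frob_fix m" using assms by simp
  note n = orb_poly_monics[OF assms(1)]
  have n0: "orb_poly m x \<noteq> 0" using orb_poly(1)[OF x] by auto
  have "bij_betw (\<lambda>h. orb_poly m x * h) (monics (j - m)) {f. f \<in> monics j \<and> orb_poly m x dvd f}"
    unfolding bij_betw_def
  proof
    show "inj_on (\<lambda>h. orb_poly m x * h) (monics (j - m))" using n0 by (auto intro: inj_onI)
    show "(\<lambda>h. orb_poly m x * h) ` monics (j - m) = {f. f \<in> monics j \<and> orb_poly m x dvd f}"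
      using mult_in_monics_iff[OF n assms(2)] by (auto elim!: dvdE)
  qed
  hence "(\<Sum>f | f \<in> monics j \<and> orb_poly m x dvd f. poly_char g f) = (\<Sum>h\<in>monics (j - m). poly_char g (orb_poly m x * h))"
    by (rule sum.reindex_bij_betw[symmetric])
  also have "\<dots> = (\<Sum>h\<in>monics (j - m). poly_char g (orb_poly m x) * poly_char g h)"
    using orb_poly(1)[OF x] by (intro sum.cong poly_char_mult refl) (auto simp: monics_def)
  finally show ?thesis
    by (simp add: L_coeff_def sum_distrib_left poly_char_def rootsum_orb_poly[OF x])
qed

text \<open>Count by \<open>x\<close>: each distinct root contributes its multiplicity by
  \<open>card_periods\<close>, and the multiplicities add up to the degree. The integer analogue is
  \<open>log n\<close> as the sum of the von Mangoldt function over the divisors of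
  \<open>n\<close>.\<close>

lemma card_frobenius_divisors:
  assumes f: "f \<in> monics j"
  shows "card {(m, x). m \<in> {1..j} \<and> x \<in> frob_fix m - {0} \<and> orb_poly m x dvd f} = j"
proof -
  have f1: "lead_coeff f = 1" and dj: "degree f = j" and f0: "coeff f 0 \<noteq> 0" "f \<noteq> 0"
    using f by (auto simp: monics_def)
  define A where "A = roots f"
  have A: "image_mset (\<lambda>x. x ^ CARD('a)) A = A" unfolding A_def by (rule frob_roots[OF f1])
  have size: "size A = j" using map_to_ac_eq_prod_roots(2)[OF f1] dj by (simp add: A_def)
  define W where "W = (\<lambda>x. {m. m > 0 \<and> x \<in> frob_fix m \<and> orbit_mset m x \<subseteq># A})"
  define D where "D = {(m, x). m \<in> {1..j} \<and> x \<in> frob_fix m - {0} \<and> orb_poly m x dvd f}"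
  have mem: "x \<in># orbit_mset m x" if "m > 0" for m and x :: "'a alg_closure"
    unfolding orbit_mset_def set_image_mset using that by (intro image_eqI[of _ _ 0]) simp_all
  have D_iff: "(m, x) \<in> D \<longleftrightarrow> x \<in># A \<and> m \<in> W x" for m x
  proof
    assume "(m, x) \<in> D"
    hence m: "1 \<le> m" "m \<le> j" "x \<in> frob_fix m" "orb_poly m x dvd f" by (auto simp: D_def)
    hence sub: "orbit_mset m x \<subseteq># A"
      using dvd_iff_roots_subset[OF f1 orb_poly(1)[OF m(3)]] orb_poly(2)[OF m(3)] by (simp add: A_def)
    moreover have "x \<in># A" using mset_subset_eqD[OF sub mem] m(1) by simp
    ultimately show "x \<in># A \<and> m \<in> W x" using m by (simp add: W_def)
  next
    assume *: "x \<in># A \<and> m \<in> W x"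
    hence m: "m > 0" "x \<in> frob_fix m" "orbit_mset m x \<subseteq># A" by (auto simp: W_def)
    have "orb_poly m x dvd f"
      using dvd_iff_roots_subset[OF f1 orb_poly(1)[OF m(2)]] orb_poly(2)[OF m(2)] m(3) by (simp add: A_def)
    moreover have "x \<noteq> 0" using * f0 coeff_0_eq_0_iff_roots[of f] by (auto simp: A_def)
    moreover have "m \<le> j" using size_mset_mono[OF m(3)] size by (simp add: orbit_mset_def)
    ultimately show "(m, x) \<in> D" using m by (simp add: D_def)
  qed
  have cW: "card (W x) = count A x" for x unfolding W_def by (rule card_periods[OF A])
  have fin: "finite (W x)" if "x \<in># A" for x
    using cW[of x] that by (metis card.infinite count_eq_zero_iff)
  have "card D = card (Sigma (set_mset A) W)"
  proof (rule bij_betw_same_card)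
    show "bij_betw prod.swap D (Sigma (set_mset A) W)"
    proof (rule bij_betwI')
      show "\<exists>z\<in>D. y = prod.swap z" if "y \<in> Sigma (set_mset A) W" for y
        using that D_iff by (intro bexI[of _ "prod.swap y"]) auto
    qed (use D_iff in auto)
  qed
  also have "\<dots> = (\<Sum>x\<in>set_mset A. card (W x))" using fin by (intro card_SigmaI) auto
  also have "\<dots> = size A" by (simp add: cW size_multiset_overloaded_eq)
  finally show ?thesis using size by (simp add: D_def)
qed

text \<open>The logarithmic derivative of the L-function, in coefficients. The factor
  \<open>j\<close> becomes the \<open>j\<close> pairs of \<open>card_frobenius_divisors\<close>;
  after exchanging the sums, each pair \<open>(m, x)\<close> collects the multiples of
  \<open>orb_poly m x\<close>.\<close>

lemma L_coeff_recurrence: "of_nat j * L_coeff g j = (\<Sum>m=1..j. ext_sum g m * L_coeff g (j - m))"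
proof -
  have "of_nat j * L_coeff g j = (\<Sum>f\<in>monics j. \<Sum>(m, x)\<in>Sigma {1..j} (\<lambda>m. frob_fix m - {0}).
      if orb_poly m x dvd f then poly_char g f else 0)"
    unfolding L_coeff_def sum_distrib_left
  proof (intro sum.cong refl)
    fix f assume f: "f \<in> monics j"
    have "(\<Sum>(m, x)\<in>Sigma {1..j} (\<lambda>m. frob_fix m - {0}). if orb_poly m x dvd f then poly_char g f else 0)
      = (\<Sum>p\<in>Sigma {1..j} (\<lambda>m. frob_fix m - {0}). if (case p of (m, x) \<Rightarrow> orb_poly m x dvd f) then poly_char g f else 0)"
      by (intro sum.cong refl) auto
    also have "\<dots> = (\<Sum>p | p \<in> Sigma {1..j} (\<lambda>m. frob_fix m - {0}) \<and> (case p of (m, x) \<Rightarrow> orb_poly m x dvd f). poly_char g f)"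
      using card_frob_fix(1)[where 'a='a] by (intro sum.inter_filter[symmetric] finite_SigmaI) auto
    also have "{p. p \<in> Sigma {1..j} (\<lambda>m. frob_fix m - {0}) \<and> (case p of (m, x) \<Rightarrow> orb_poly m x dvd f)}
      = {(m, x). m \<in> {1..j} \<and> x \<in> frob_fix m - {0} \<and> orb_poly m x dvd f}" by auto
    finally show "of_nat j * poly_char g f = (\<Sum>(m, x)\<in>Sigma {1..j} (\<lambda>m. frob_fix m - {0}). if orb_poly m x dvd f then poly_char g f else 0)"
      using card_frobenius_divisors[OF f] by simp
  qed
  also have "\<dots> = (\<Sum>(m, x)\<in>Sigma {1..j} (\<lambda>m. frob_fix m - {0}). \<Sum>f\<in>monics j. if orb_poly m x dvd f then poly_char g f else 0)"
    by (subst sum.swap) (simp add: case_prod_beta')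
  also have "\<dots> = (\<Sum>m\<in>{1..j}. \<Sum>x\<in>frob_fix m - {0}. \<Sum>f\<in>monics j. if orb_poly m x dvd f then poly_char g f else 0)"
    using card_frob_fix(1)[where 'a='a] by (subst sum.Sigma) auto
  also have "\<dots> = (\<Sum>m\<in>{1..j}. \<Sum>x\<in>frob_fix m - {0}. \<psi> (of_ac (orbit_sum g m x)) * L_coeff g (j - m))"
    by (intro sum.cong refl) (auto simp: sum.inter_filter[OF finite_monics, symmetric] sum_poly_char_multiples)
  finally show ?thesis by (simp add: ext_sum_def sum_distrib_right)
qed

lemma rootsum_altdef:
  "rootsum g f = (\<Sum>i\<le>degree g. to_ac (coeff g i) * (\<Sum>x\<in>#roots f. x ^ i))"
proof -
  have "(\<Sum>x\<in>#A. ev g x) = (\<Sum>i\<le>degree g. to_ac (coeff g i) * (\<Sum>x\<in>#A. x ^ i))" for A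
    by (induction A) (simp_all add: ev_altdef sum.distrib distrib_left)
  thus ?thesis by (simp add: rootsum_def)
qed

text \<open>The monomial changes only the \<open>d\<close>-th of the elementary symmetric functions
  of the roots. By Newton's identities the power sums below \<open>d\<close> stay and the
  \<open>d\<close>-th moves by \<open>- d c\<close>; \<open>rootsum g\<close> involves none beyond
  \<open>d\<close>. The condition \<open>d < j\<close> protects the constant term.\<close>

lemma rootsum_shift:
  assumes f: "f \<in> monics j" and d: "d = degree g" "d > 0" "d < j"
  shows "rootsum g (f + monom c (j - d)) = rootsum g f - to_ac (lead_coeff g * of_nat d * c)"
    and "f + monom c (j - d) \<in> monics j"
proof -
  define h where "h = f + monom c (j - d)"
  have f1: "lead_coeff f = 1" "degree f = j" using f by (auto simp: monics_def)
  have "degree (monom c (j - d)) < degree f"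
    using d f1 by (intro le_less_trans[OF degree_monom_le]) auto
  hence dh: "degree h = j" unfolding h_def using f1 by (simp add: degree_add_eq_left)
  moreover have "coeff h j = 1" using f1 d by (simp add: h_def)
  moreover have "coeff h 0 = coeff f 0" using d by (simp add: h_def)
  ultimately show hm: "f + monom c (j - d) \<in> monics j" using f by (simp add: monics_def h_def)
  hence h1: "lead_coeff h = 1" unfolding h_def[symmetric] monics_def by blast
  define R where "R = (\<lambda>f :: 'a poly. \<Prod>x\<in>#roots f. [:1, -x:])"
  have R: "coeff (R f) b = (if b \<le> j then to_ac (coeff f (j - b)) else 0)"
    if "lead_coeff f = 1" "degree f = j" for f b
    unfolding R_def coeff_prod_linear_reflect map_to_ac_eq_prod_roots(1)[OF that(1), symmetric]
    using map_to_ac_eq_prod_roots(2)[OF that(1)] that(2) by simp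
  have Rf: "coeff (R h) b = coeff (R f) b + (if b = d then to_ac c else 0)" for b
    using R[OF f1, of b] R[OF h1 dh, of b] d by (auto simp: h_def)
  have R0: "coeff (R f) 0 = 1" "coeff (R h) 0 = 1" using R[OF f1, of 0] R[OF h1 dh, of 0] f1 h1 dh by auto
  define p where "p = (\<lambda>(f :: 'a poly) m. \<Sum>x\<in>#roots f. x ^ m)"
  have newton: "p f b = - of_nat b * coeff (R f) b - (\<Sum>m\<in>{1..<b}. p f m * coeff (R f) (b - m))"
    if "b > 0" "coeff (R f) 0 = 1" for f b
  proof -
    have "of_nat b * coeff (R f) b = -(\<Sum>m=1..b. p f m * coeff (R f) (b - m))"
      unfolding p_def R_def by (rule newton_identity)
    also have "{1..b} = insert b {1..<b}" using that by auto
    finally have e: "of_nat b * coeff (R f) b = - (p f b + (\<Sum>m\<in>{1..<b}. p f m * coeff (R f) (b - m)))"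
      using that by simp
    show ?thesis unfolding mult_minus_left e by simp
  qed
  have p: "p h b = p f b - (if b = d then of_nat d * to_ac c else 0)" if "b > 0" "b \<le> d" for b
    using that
  proof (induction b rule: less_induct)
    case (less b)
    have eq: "(\<Sum>m\<in>{1..<b}. p h m * coeff (R h) (b - m)) = (\<Sum>m\<in>{1..<b}. p f m * coeff (R f) (b - m))"
      using less by (intro sum.cong refl) (auto simp: Rf)
    show ?case unfolding newton[OF less.prems(1) R0(1)] newton[OF less.prems(1) R0(2)] eq
      by (simp add: Rf algebra_simps)
  qed
  have p0: "p h 0 = p f 0"
    using map_to_ac_eq_prod_roots(2)[OF h1] map_to_ac_eq_prod_roots(2)[OF f1(1)] f1 dh by (simp add: p_def)
  have rs: "rootsum g f = (\<Sum>i\<le>d. to_ac (coeff g i) * p f i)" for f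
    unfolding p_def d(1) by (rule rootsum_altdef)
  have "rootsum g h = (\<Sum>i\<le>d. to_ac (coeff g i) * (p f i - (if i = d then of_nat d * to_ac c else 0)))"
    unfolding rs
  proof (intro sum.cong refl)
    fix i assume "i \<in> {..d}"
    thus "to_ac (coeff g i) * p h i = to_ac (coeff g i) * (p f i - (if i = d then of_nat d * to_ac c else 0))"
      using p[of i] p0 d by (cases "i = 0") auto
  qed
  also have "\<dots> = rootsum g f - (\<Sum>i\<le>d. if i = d then to_ac (coeff g d) * (of_nat d * to_ac c) else 0)"
    unfolding rs right_diff_distrib sum_subtractf
    by (intro arg_cong2[of _ _ _ _ minus] sum.cong refl) auto
  finally show "rootsum g (f + monom c (j - d)) = rootsum g f - to_ac (lead_coeff g * of_nat d * c)"
    using d by (simp add: h_def mult_ac)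
qed

text \<open>Translating \<open>monics j\<close> by a suitable monomial permutes it and multiplies
  every summand by \<open>\<psi> x\<close> for an \<open>x\<close> with
  \<open>\<psi> x \<noteq> 1\<close>, so the sum equals \<open>\<psi> x\<close> times
  itself.\<close>

lemma L_coeff_eq_0:
  assumes "degree g > 0" "of_nat (degree g) \<noteq> (0 :: 'a)" "degree g < j"
  shows "L_coeff g j = 0"
proof -
  define d where "d = degree g"
  define e where "e = lead_coeff g * of_nat d"
  have e: "e \<noteq> 0" using assms by (auto simp: e_def d_def)
  obtain x where x: "\<psi> x \<noteq> 1" using char_nontrivial by blast
  define c where "c = - x / e"
  have c: "- (e * c) = x" using e by (simp add: c_def)
  have d: "d = degree g" "d > 0" "d < j" using assms by (auto simp: d_def)
  have "L_coeff g j = (\<Sum>f\<in>monics j. poly_char g (f + monom c (j - d)))"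
    unfolding L_coeff_def
    by (rule sum.reindex_bij_witness[of _ "\<lambda>f. f + monom c (j - d)" "\<lambda>f. f + monom (- c) (j - d)"])
       (auto simp: rootsum_shift(2)[OF _ d] add.assoc add_monom)
  also have "\<dots> = (\<Sum>f\<in>monics j. \<psi> x * poly_char g f)"
  proof (intro sum.cong refl)
    fix f assume f: "f \<in> monics j"
    have "of_ac (rootsum g (f + monom c (j - d))) = of_ac (rootsum g f + to_ac x)"
      using rootsum_shift(1)[OF f d, of c] c unfolding e_def[symmetric] by (metis add_uminus_conv_diff to_ac_minus)
    also have "\<dots> = of_ac (rootsum g f) + x"
      using of_ac_add[of "rootsum g f" "to_ac x"] rootsum_in_range[of f g] f unfolding monics_def by auto
    finally show "poly_char g (f + monom c (j - d)) = \<psi> x * poly_char g f" by (simp add: poly_char_def char_add mult.commute)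
  qed
  also have "\<dots> = \<psi> x * L_coeff g j" by (simp add: L_coeff_def sum_distrib_left)
  finally have "(1 - \<psi> x) * L_coeff g j = 0" by (simp add: algebra_simps)
  thus ?thesis using x by simp
qed

text \<open>The upper bounds for all fibres of the trace yield lower bounds, since the fibres
  partition the field.\<close>

lemma ext_sum_bound:
  assumes deg: "degree g > 0" and nz: "of_nat (degree g) \<noteq> (0 :: 'a)"
  obtains C s0 where "\<And>s. s \<ge> s0 \<Longrightarrow> cmod (ext_sum g (2 * s)) \<le> C * real CARD('a) ^ s"
proof -
  define q where "q = CARD('a)"
  define d where "d = degree g"
  have q2: "q \<ge> 2" unfolding q_def by (rule card_field_ge_2)
  have "coprime d q"
  proof -
    obtain r where r: "q = CHAR('a) ^ r" using finite_field_card_prime_power unfolding q_def by blast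
    have "\<not> CHAR('a) dvd d" using nz by (simp add: of_nat_eq_0_iff_char_dvd d_def)
    hence "coprime (CHAR('a)) d" using prime_CHAR_finite prime_imp_coprime by blast
    thus ?thesis unfolding r by (simp add: coprime_commute)
  qed
  then interpret artin_schreier g q d
    using deg by unfold_locales (auto simp: q_def d_def)
  define D where "D = real (2 * d + 1)"
  \<comment> \<open>The trace has \<open>q\<close> values, and each fibre deviates from the mean by
    at most \<open>q * D * q^s\<close>; the summand 1 pays for the omitted point 0.\<close>
  define C where "C = real q ^ 2 * D + 1"
  obtain s1 where s1: "real ((d + 1) ^ 2) < real q ^ s1" using real_arch_pow[of "real q"] q2 by fastforce
  have "cmod (ext_sum g (2 * s)) \<le> C * real q ^ s" if s: "s \<ge> s1 + 1" for s
  proof -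
    have "real ((d + 1) ^ 2) < real q ^ s1" by (rule s1)
    also have "\<dots> \<le> real q ^ (s - 1)" using s q2 by (intro power_increasing) auto
    finally have s_large: "(d + 1) ^ 2 < q ^ (s - 1)" by (metis of_nat_less_iff of_nat_power)
    have s0: "s > 0" using s by simp
    define F where "F = (frob_fix (2 * s) :: 'a alg_closure set)"
    have F: "finite F" "card F = q ^ (2 * s)" using card_frob_fix[where 'a='a, of "2 * s"] s0 by (auto simp: F_def q_def)
    define Q where "Q = real q ^ (2 * s)"
    define t where "t = (\<lambda>x. of_ac (orbit_sum g (2 * s) x))"
    define N where "N = (\<lambda>a. card {x \<in> F. t x = a})"
    have N_le: "real (N a) \<le> Q / q + D * real q ^ s" for a
    proof -
      have "{x \<in> F. t x = a} = {x. x ^ (q ^ (2 * s)) = x \<and> (\<Sum>i<2 * s. ev g x ^ (q ^ i)) = to_ac a}"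
        using to_ac_of_ac[OF orbit_sum_in_range[where 'a='a and g=g and m="2 * s"]]
        by (auto simp: F_def frob_fix_def t_def orbit_sum_def q_def)
      hence "q * N a \<le> q ^ (2 * s) + q * (2 * d + 1) * q ^ s"
        unfolding N_def using card_trace_fiber_le[OF s_large s0, of a] by simp
      hence "real (q * N a) \<le> real (q ^ (2 * s) + q * (2 * d + 1) * q ^ s)" by (rule of_nat_mono)
      hence "real q * real (N a) \<le> Q + real q * D * real q ^ s"
        unfolding Q_def D_def of_nat_add of_nat_mult of_nat_power .
      thus ?thesis using q2 by (simp add: field_simps)
    qed
    have N_sum: "(\<Sum>a\<in>UNIV. real (N a)) = Q"
    proof -
      have "(\<Sum>a\<in>UNIV. N a) = card F"
        unfolding N_def using F(1) by (subst card_UN_disjoint[symmetric]) (auto intro!: arg_cong[of _ _ card])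
      thus ?thesis unfolding Q_def F(2) by (metis of_nat_power of_nat_sum)
    qed
    have N_abs: "\<bar>real (N a) - Q / q\<bar> \<le> q * D * real q ^ s" for a
    proof -
      define B where "B = D * real q ^ s"
      have B0: "B \<ge> 0" by (simp add: B_def D_def)
      have "(\<Sum>a\<in>UNIV - {a}. real (N a)) \<le> (\<Sum>b\<in>UNIV - {a}. Q / q + B)"
        using N_le unfolding B_def by (intro sum_mono) auto
      also have "\<dots> = (real q - 1) * (Q / q + B)"
        using q2 by (simp add: card_Diff_singleton q_def of_nat_diff)
      also have "\<dots> = real q * (Q / q) - Q / q + (real q - 1) * B"
        by (simp only: distrib_left left_diff_distrib mult_1_left)
      also have "real q * (Q / q) = Q" using q2 by simp
      finally have "Q / q - (real q - 1) * B \<le> real (N a)"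
        using N_sum by (subst (asm) sum_diff1) auto
      moreover have "real (N a) \<le> Q / q + B" using N_le by (simp add: B_def)
      moreover have "B \<le> q * B" "(real q - 1) * B \<le> q * B" using B0 q2 by (auto intro!: mult_right_mono simp: mult_le_cancel_right1)
      ultimately show ?thesis unfolding B_def by (simp add: abs_le_iff mult.assoc)
    qed
    have "(\<Sum>x\<in>F. \<psi> (t x)) = (\<Sum>a\<in>UNIV. \<Sum>x | x \<in> F \<and> t x = a. \<psi> (t x))"
      using F(1) by (subst sum.group) auto
    also have "\<dots> = (\<Sum>a\<in>UNIV. of_nat (N a) * \<psi> a)" by (intro sum.cong refl) (simp add: N_def)
    \<comment> \<open>The mean fibre size \<open>Q / q\<close> splits off and drops out because
      \<open>\<psi>\<close> sums to zero.\<close>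
    also have "\<dots> = (\<Sum>a\<in>UNIV. of_real (real (N a) - Q / q) * \<psi> a) + of_real (Q / q) * (\<Sum>a\<in>UNIV. \<psi> a)"
      by (simp add: sum_distrib_left left_diff_distrib sum_subtractf)
    finally have eq: "(\<Sum>x\<in>F. \<psi> (t x)) = (\<Sum>a\<in>UNIV. of_real (real (N a) - Q / q) * \<psi> a)"
      using sum_char by simp
    have "cmod (\<Sum>x\<in>F. \<psi> (t x)) \<le> (\<Sum>a\<in>(UNIV :: 'a set). q * D * real q ^ s)"
      unfolding eq using N_abs by (intro sum_norm_le) (simp only: norm_mult norm_of_real norm_char mult_1_right)
    also have "\<dots> = real q ^ 2 * D * real q ^ s" by (simp add: q_def power2_eq_square)
    finally have le1: "cmod (\<Sum>x\<in>F. \<psi> (t x)) \<le> real q ^ 2 * D * real q ^ s" .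
    have "0 \<in> F" using q2 by (simp add: F_def frob_fix_def q_def zero_power)
    hence "ext_sum g (2 * s) = (\<Sum>x\<in>F. \<psi> (t x)) - \<psi> (t 0)"
      unfolding ext_sum_def F_def[symmetric] t_def using F(1) by (simp add: sum_diff1)
    hence "cmod (ext_sum g (2 * s)) \<le> cmod (\<Sum>x\<in>F. \<psi> (t x)) + 1"
      using norm_triangle_ineq4[of "\<Sum>x\<in>F. \<psi> (t x)" "\<psi> (t 0)"] by (simp add: norm_char)
    also have "\<dots> \<le> real q ^ 2 * D * real q ^ s + real q ^ s" using le1 q2 by (intro add_mono) auto
    finally show ?thesis by (simp add: C_def algebra_simps)
  qed
  thus thesis using that unfolding q_def by blast
qed

text \<open>\<open>A\<close> consists of the roots of the reversed polynomial, padded by zeros up to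
  size \<open>n\<close>. \<open>L_coeff_recurrence\<close> and Newton's identities are the same
  recursion, so the power sums of \<open>A\<close> are the negated \<open>ext_sum\<close>, whose
  growth bounds the roots.\<close>

lemma L_coeff_factorization:
  assumes deg: "degree g > 0" "degree g \<le> n" and nz: "of_nat (degree g) \<noteq> (0 :: 'a)"
  obtains A where "size A = n" "\<And>j. coeff (\<Prod>x\<in>#A. [:1, -x:]) j = L_coeff g j"
    "\<And>x. x \<in># A \<Longrightarrow> cmod x \<le> sqrt (real CARD('a))"
proof -
  define P where "P = (\<Sum>j\<le>n. monom (L_coeff g j) (n - j))"
  have cP: "coeff P i = (if i \<le> n then L_coeff g (n - i) else 0)" for i
  proof -
    have "coeff P i = (\<Sum>j\<le>n. if j = n - i \<and> i \<le> n then L_coeff g j else 0)"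
      unfolding P_def coeff_sum by (intro sum.cong refl) auto
    thus ?thesis by (cases "i \<le> n") auto
  qed
  have "degree P \<le> n" by (rule degree_le) (simp add: cP)
  moreover have "coeff P n = 1" by (simp add: cP)
  ultimately have dP: "degree P = n" "lead_coeff P = 1" using le_degree[of P n] by auto
  define A where "A = proots P"
  have A: "P = (\<Prod>x\<in>#A. [:-x, 1:])" "size A = n" using monic_eq_prod_proots[OF dP(2)] dP(1) by (auto simp: A_def)
  have coeff: "coeff (\<Prod>x\<in>#A. [:1, -x:]) j = L_coeff g j" for j
  proof -
    have "coeff (\<Prod>x\<in>#A. [:1, -x:]) j = (if j \<le> n then L_coeff g j else 0)"
      unfolding coeff_prod_linear_reflect A(1)[symmetric] A(2) by (simp add: cP)
    thus ?thesis using L_coeff_eq_0[OF deg(1) nz, of j] deg by auto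
  qed
  have power_sum: "ext_sum g b = - (\<Sum>x\<in>#A. x ^ b)" if "b > 0" for b
    using that
  proof (induction b rule: less_induct)
    case (less b)
    have i: "{1..b} = insert b {1..<b}" using less.prems by auto
    have "of_nat b * L_coeff g b = ext_sum g b + (\<Sum>m\<in>{1..<b}. ext_sum g m * L_coeff g (b - m))"
      unfolding L_coeff_recurrence i by simp
    moreover have "of_nat b * L_coeff g b = - ((\<Sum>x\<in>#A. x ^ b) + (\<Sum>m\<in>{1..<b}. (\<Sum>x\<in>#A. x ^ m) * L_coeff g (b - m)))"
      using newton_identity[of b A] unfolding coeff i by simp
    moreover have "(\<Sum>m\<in>{1..<b}. ext_sum g m * L_coeff g (b - m)) = - (\<Sum>m\<in>{1..<b}. (\<Sum>x\<in>#A. x ^ m) * L_coeff g (b - m))"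
      unfolding sum_negf[symmetric] using less.IH by (intro sum.cong refl) auto
    ultimately show ?case by (simp add: algebra_simps)
  qed
  define q where "q = real CARD('a)"
  have q: "q > 0" unfolding q_def by simp
  obtain C s0 where C: "\<And>s. s \<ge> s0 \<Longrightarrow> cmod (ext_sum g (2 * s)) \<le> C * q ^ s"
    using ext_sum_bound[OF deg(1) nz] unfolding q_def by blast
  have "cmod x \<le> sqrt q" if x: "x \<in># A" for x
  proof -
    \<comment> \<open>Only even extension degrees are estimated, hence the squares; dividing by
      \<open>q\<close> turns the bound \<open>C * q^s\<close> into a constant.\<close>
    define B where "B = image_mset (\<lambda>x. x ^ 2 / of_real q) A"
    have "cmod (\<Sum>w\<in>#B. w ^ s) \<le> C" if s: "s \<ge> s0 + 1" for s
    proof -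
      have "(\<Sum>w\<in>#B. w ^ s) = (\<Sum>x\<in>#A. x ^ (2 * s)) / of_real q ^ s"
        unfolding B_def by (induction A) (simp_all add: add_divide_distrib power_divide power_mult)
      also have "\<dots> = - ext_sum g (2 * s) / of_real q ^ s" using s by (simp add: power_sum)
      finally have "cmod (\<Sum>w\<in>#B. w ^ s) = cmod (ext_sum g (2 * s)) / q ^ s"
        using q by (simp add: norm_divide norm_power)
      also have "\<dots> \<le> C * q ^ s / q ^ s" using C[of s] s q by (intro divide_right_mono) auto
      finally show ?thesis using q by simp
    qed
    moreover have "x ^ 2 / of_real q \<in># B" using x by (auto simp: B_def)
    ultimately have "cmod (x ^ 2 / of_real q) \<le> 1" by (rule bounded_power_sums)
    hence "cmod x ^ 2 \<le> q" using q by (simp add: norm_divide norm_power)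
    thus ?thesis by (rule real_le_rsqrt)
  qed
  thus thesis using that[OF A(2) coeff] by (simp add: q_def)
qed

end

section \<open>Matrices: traces and companion matrices\<close>

hide_const (open) Determinants.det Finite_Cartesian_Product.mat Finite_Cartesian_Product.row
  Finite_Cartesian_Product.vec
hide_type (open) Finite_Cartesian_Product.vec
unbundle no vec_syntax
no_notation fps_nth (infixl "$" 75)

definition mtrace :: "'b::comm_ring_1 mat \<Rightarrow> 'b" where
  "mtrace A = (\<Sum>i<dim_row A. A $$ (i, i))"

text \<open>The size is a value, so that block decompositions and a recursion on \<open>n\<close>
  can be stated; \<open>matpow_bridge\<close> leads back to matrices indexed by a finite
  type.\<close>

definition GL :: "nat \<Rightarrow> 'b::field mat set" where
  "GL n = {M \<in> carrier_mat n n. det M \<noteq> 0}"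

lemma mtrace_comm:
  assumes "A \<in> carrier_mat n m" "B \<in> carrier_mat m n"
  shows "mtrace (A * B) = mtrace (B * A)"
proof -
  have "mtrace (A * B) = (\<Sum>i<n. \<Sum>k<m. A $$ (i, k) * B $$ (k, i))"
    using assms by (simp add: mtrace_def scalar_prod_def lessThan_atLeast0)
  also have "\<dots> = (\<Sum>k<m. \<Sum>i<n. B $$ (k, i) * A $$ (i, k))"
    by (subst sum.swap) (simp add: mult.commute)
  also have "\<dots> = mtrace (B * A)"
    using assms by (simp add: mtrace_def scalar_prod_def lessThan_atLeast0)
  finally show ?thesis .
qed

lemma GL_inverse:
  assumes "P \<in> GL n"
  obtains Q where "Q \<in> GL n" "P * Q = 1\<^sub>m n" "Q * P = 1\<^sub>m n"
proof -
  have P: "P \<in> carrier_mat n n" "det P \<noteq> 0" using assms by (auto simp: GL_def)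
  obtain Q where Q: "Q \<in> carrier_mat n n" "Q * P = 1\<^sub>m n" "P * Q = 1\<^sub>m n"
    using det_non_zero_imp_unit[OF P, of "()"] unfolding Units_def ring_mat_def by auto
  have "det P * det Q = 1" using det_mult[OF P(1) Q(1)] Q(3) by simp
  hence "det Q \<noteq> 0" by auto
  thus thesis using that Q by (simp add: GL_def)
qed

lemma GL_mult: "P \<in> GL n \<Longrightarrow> Q \<in> GL n \<Longrightarrow> P * Q \<in> GL n"
  by (auto simp: GL_def det_mult)

lemma GL_one: "1\<^sub>m n \<in> GL n"
  by (simp add: GL_def)

lemma pow_mat_intertwine:
  assumes "A \<in> carrier_mat n n" "B \<in> carrier_mat n n" "P \<in> carrier_mat n n" "A * P = P * B"
  shows "A ^\<^sub>m k * P = P * B ^\<^sub>m k"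
proof (induction k)
  case (Suc k)
  have "A ^\<^sub>m Suc k * P = A ^\<^sub>m k * (P * B)"
    using assms by (simp add: assoc_mult_mat[of _ n n _ n _ n])
  also have "\<dots> = (A ^\<^sub>m k * P) * B"
    using assms by (simp add: assoc_mult_mat[of _ n n _ n _ n])
  also have "\<dots> = P * (B ^\<^sub>m k * B)"
    unfolding Suc using assms by (simp add: assoc_mult_mat[of _ n n _ n _ n])
  finally show ?case by simp
qed (use assms in simp)

lemma mtrace_pow_similar:
  assumes "A \<in> carrier_mat n n" "B \<in> carrier_mat n n" "P \<in> GL n" "A * P = P * B"
  shows "mtrace (A ^\<^sub>m k) = mtrace (B ^\<^sub>m k)"
proof -
  obtain Q where Q: "Q \<in> GL n" "P * Q = 1\<^sub>m n" "Q * P = 1\<^sub>m n" using GL_inverse[OF assms(3)] .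
  have c: "P \<in> carrier_mat n n" "Q \<in> carrier_mat n n" using Q assms by (auto simp: GL_def)
  have "mtrace (A ^\<^sub>m k) = mtrace (A ^\<^sub>m k * (P * Q))" using assms Q by simp
  also have "\<dots> = mtrace (P * B ^\<^sub>m k * Q)"
    using c assms by (simp add: pow_mat_intertwine[OF assms(1,2) c(1) assms(4), symmetric] assoc_mult_mat[of _ n n _ n _ n])
  also have "\<dots> = mtrace (Q * (P * B ^\<^sub>m k))" using c assms by (intro mtrace_comm) auto
  also have "\<dots> = mtrace (B ^\<^sub>m k)" using c assms Q by (simp add: assoc_mult_mat[of _ n n _ n _ n, symmetric])
  finally show ?thesis .
qed

lemma mtrace_four_block:
  assumes "A \<in> carrier_mat n n" "D \<in> carrier_mat m m"
  shows "mtrace (four_block_mat A B C D) = mtrace A + mtrace D"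
proof -
  have "mtrace (four_block_mat A B C D) = (\<Sum>i<n+m. if i < n then A $$ (i,i) else D $$ (i - n, i - n))"
    unfolding mtrace_def using assms by (intro sum.cong) auto
  also have "{..<n+m} = {..<n} \<union> {n..<n+m}" by auto
  also have "(\<Sum>i\<in>{..<n} \<union> {n..<n+m}. if i < n then A $$ (i,i) else D $$ (i - n, i - n))
     = (\<Sum>i<n. A $$ (i,i)) + (\<Sum>i\<in>{n..<n+m}. D $$ (i - n, i - n))"
    by (subst sum.union_disjoint) auto
  also have "(\<Sum>i\<in>{n..<n+m}. D $$ (i - n, i - n)) = (\<Sum>i<m. D $$ (i, i))"
    by (rule sum.reindex_bij_witness[of _ "\<lambda>i. i + n" "\<lambda>i. i - n"]) auto
  finally show ?thesis using assms by (simp add: mtrace_def)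
qed

lemma mtrace_pow_upper_block:
  assumes "A \<in> carrier_mat n n" "B \<in> carrier_mat n m" "D \<in> carrier_mat m m"
  shows "mtrace (four_block_mat A B (0\<^sub>m m n) D ^\<^sub>m k) = mtrace (A ^\<^sub>m k) + mtrace (D ^\<^sub>m k)"
    (is "mtrace (?N ^\<^sub>m k) = _")
proof -
  have "\<exists>B' \<in> carrier_mat n m. ?N ^\<^sub>m k = four_block_mat (A ^\<^sub>m k) B' (0\<^sub>m m n) (D ^\<^sub>m k)"
  proof (induction k)
    case 0
    show ?case using assms by (intro bexI[of _ "0\<^sub>m n m"]) auto
  next
    case (Suc k)
    then obtain B' where B': "B' \<in> carrier_mat n m"
      "?N ^\<^sub>m k = four_block_mat (A ^\<^sub>m k) B' (0\<^sub>m m n) (D ^\<^sub>m k)" by blast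
    have c: "A ^\<^sub>m k * A \<in> carrier_mat n n" "D ^\<^sub>m k * D \<in> carrier_mat m m"
      using assms mult_carrier_mat[of "A ^\<^sub>m k" n n A n] mult_carrier_mat[of "D ^\<^sub>m k" m m D m] by auto
    show ?case
    proof (intro bexI[of _ "A ^\<^sub>m k * B + B' * D"])
      show "?N ^\<^sub>m Suc k =
        four_block_mat (A ^\<^sub>m Suc k) (A ^\<^sub>m k * B + B' * D) (0\<^sub>m m n) (D ^\<^sub>m Suc k)"
        using assms B' c by (simp add: mult_four_block_mat[of _ n n _ m _ m _ _ n _ m])
    qed (use assms B' in auto)
  qed
  then obtain B' where "?N ^\<^sub>m k = four_block_mat (A ^\<^sub>m k) B' (0\<^sub>m m n) (D ^\<^sub>m k)" by blast
  thus ?thesis using assms by (simp add: mtrace_four_block[of _ n _ m])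
qed

lemma mtrace_pow_lower_block:
  assumes "A \<in> carrier_mat n n" "C \<in> carrier_mat m n" "D \<in> carrier_mat m m"
  shows "mtrace (four_block_mat A (0\<^sub>m n m) C D ^\<^sub>m k) = mtrace (A ^\<^sub>m k) + mtrace (D ^\<^sub>m k)"
    (is "mtrace (?N ^\<^sub>m k) = _")
proof -
  have "\<exists>C' \<in> carrier_mat m n. ?N ^\<^sub>m k = four_block_mat (A ^\<^sub>m k) (0\<^sub>m n m) C' (D ^\<^sub>m k)"
  proof (induction k)
    case 0
    show ?case using assms by (intro bexI[of _ "0\<^sub>m m n"]) auto
  next
    case (Suc k)
    then obtain C' where C': "C' \<in> carrier_mat m n"
      "?N ^\<^sub>m k = four_block_mat (A ^\<^sub>m k) (0\<^sub>m n m) C' (D ^\<^sub>m k)" by blast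
    have c: "A ^\<^sub>m k * A \<in> carrier_mat n n" "D ^\<^sub>m k * D \<in> carrier_mat m m"
      using assms mult_carrier_mat[of "A ^\<^sub>m k" n n A n] mult_carrier_mat[of "D ^\<^sub>m k" m m D m] by auto
    show ?case
    proof (intro bexI[of _ "C' * A + D ^\<^sub>m k * C"])
      show "?N ^\<^sub>m Suc k =
        four_block_mat (A ^\<^sub>m Suc k) (0\<^sub>m n m) (C' * A + D ^\<^sub>m k * C) (D ^\<^sub>m Suc k)"
        using assms C' c by (simp add: mult_four_block_mat[of _ n n _ m _ m _ _ n _ m])
    qed (use assms C' in auto)
  qed
  then obtain C' where "?N ^\<^sub>m k = four_block_mat (A ^\<^sub>m k) (0\<^sub>m n m) C' (D ^\<^sub>m k)" by blast
  thus ?thesis using assms by (simp add: mtrace_four_block[of _ n _ m])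
qed

definition companion :: "'b::comm_ring_1 poly \<Rightarrow> 'b mat" where
  "companion f = mat (degree f) (degree f)
     (\<lambda>(r, c). if Suc c = degree f then - coeff f r else if r = Suc c then 1 else 0)"

lemma companion_carrier: "companion f \<in> carrier_mat (degree f) (degree f)"
  by (simp add: companion_def)

text \<open>In the basis \<open>1, X - a, X (X - a), X^2 (X - a), ...\<close> of the quotient ring modulo
  \<open>(X - a) g\<close>, multiplication by \<open>X\<close> is block triangular with blocks \<open>a\<close> and
  \<open>companion g\<close>.\<close>

lemma companion_linear_factor:
  fixes g :: "'b::field poly" and a :: 'b
  assumes g: "lead_coeff g = 1"
  defines "f \<equiv> [:-a, 1:] * g" and "n \<equiv> degree g"
  obtains P E where "P \<in> GL (Suc n)" "E \<in> carrier_mat n 1"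
    "companion f * P = P * four_block_mat (mat 1 1 (\<lambda>_. a)) (0\<^sub>m 1 n) E (companion g)"
proof -
  have g0: "g \<noteq> 0" using g by auto
  have df: "degree f = Suc n" unfolding f_def n_def using g0 by (subst degree_mult_eq) auto
  have cf: "coeff f i = (if i = 0 then 0 else coeff g (i - 1)) - a * coeff g i" for i
    by (cases i) (auto simp: f_def)
  have gn: "coeff g n = 1" "coeff g (Suc n) = 0" using g by (auto simp: n_def coeff_eq_0)
  define C where "C = companion f"
  define P where "P = mat (Suc n) (Suc n) (\<lambda>(r, c). if r = c then 1 else if c = Suc r then -a else 0)"
  \<comment> \<open>From \<open>X * 1 = a * 1 + (X - a)\<close>: the image of the first basis vector
    has coordinate 1 at the first vector of the second block.\<close>
  define E where "E = mat n 1 (\<lambda>(r, c). if r = 0 then 1 else (0 :: 'b))"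
  define G where "G = four_block_mat (mat 1 1 (\<lambda>_. a)) (0\<^sub>m 1 n) E (companion g)"
  have C: "C \<in> carrier_mat (Suc n) (Suc n)" using companion_carrier[of f] by (simp add: C_def df)
  have P: "P \<in> carrier_mat (Suc n) (Suc n)" by (simp add: P_def)
  have G: "G \<in> carrier_mat (Suc n) (Suc n)"
    unfolding G_def using four_block_carrier_mat[of "mat 1 1 (\<lambda>_. a)" 1 1 "companion g" n n] companion_carrier[of g]
    by (simp add: n_def)
  have "det P = prod_list (diag_mat P)"
    by (rule det_upper_triangular[OF _ P]) (auto simp: P_def)
  also have "\<dots> = 1" by (rule prod_list_neutral) (auto simp: diag_mat_def P_def)
  finally have PGL: "P \<in> GL (Suc n)" using P by (simp add: GL_def)
  have CP: "(C * P) $$ (r, c) = C $$ (r, c) + (if c = 0 then 0 else - a * C $$ (r, c - 1))"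
    if rc: "r < Suc n" "c < Suc n" for r c
  proof -
    have "(C * P) $$ (r, c) = (\<Sum>k\<in>{0..<Suc n}. C $$ (r, k) * P $$ (k, c))"
      using rc C P by (simp add: scalar_prod_def)
    also have "\<dots> = (\<Sum>k\<in>{0..<Suc n}. (if k = c then C $$ (r, c) else 0) + (if c \<noteq> 0 \<and> k = c - 1 then - a * C $$ (r, c - 1) else 0))"
      using rc by (intro sum.cong refl) (auto simp: P_def)
    also have "\<dots> = C $$ (r, c) + (if c = 0 then 0 else - a * C $$ (r, c - 1))"
      unfolding sum.distrib using rc by (cases "c = 0") auto
    finally show ?thesis .
  qed
  have PG: "(P * G) $$ (r, c) = G $$ (r, c) + (if r = n then 0 else - a * G $$ (Suc r, c))"
    if rc: "r < Suc n" "c < Suc n" for r c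
  proof -
    have "(P * G) $$ (r, c) = (\<Sum>k\<in>{0..<Suc n}. P $$ (r, k) * G $$ (k, c))"
      using rc G P by (simp add: scalar_prod_def)
    also have "\<dots> = (\<Sum>k\<in>{0..<Suc n}. (if k = r then G $$ (r, c) else 0) + (if r \<noteq> n \<and> k = Suc r then - a * G $$ (Suc r, c) else 0))"
      using rc by (intro sum.cong refl) (auto simp: P_def)
    also have "\<dots> = G $$ (r, c) + (if r = n then 0 else - a * G $$ (Suc r, c))"
      unfolding sum.distrib using rc by (cases "r = n") auto
    finally show ?thesis .
  qed
  have Ci: "C $$ (r, c) = (if c = n then - coeff f r else if r = Suc c then 1 else 0)"
    if "r < Suc n" "c < Suc n" for r c
    using that by (auto simp: C_def companion_def df)
  have Gi: "G $$ (r, c) = (if r = 0 then if c = 0 then a else 0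
      else if c = 0 then if r = 1 then 1 else 0
      else if c = n then - coeff g (r - 1) else if r = Suc c then 1 else 0)"
    if "r < Suc n" "c < Suc n" for r c
    using that by (auto simp: G_def companion_def n_def E_def)
  have "C * P = P * G"
  proof (rule eq_matI)
    fix r c assume "r < dim_row (P * G)" "c < dim_col (P * G)"
    hence rc: "r < Suc n" "c < Suc n" using P G by auto
    show "(C * P) $$ (r, c) = (P * G) $$ (r, c)"
      unfolding CP[OF rc] PG[OF rc] using rc gn
      by (cases "c = 0"; cases "c = n"; cases "r = n"; cases "r = 0")
         (auto simp: Ci Gi cf algebra_simps split: if_splits)
  qed (use C P G in auto)
  moreover have "E \<in> carrier_mat n 1" by (simp add: E_def)
  ultimately show thesis using that[of P E] PGL by (simp add: C_def G_def)
qed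

text \<open>Splitting off one root at a time makes the matrix block triangular up to similarity, so
  repeated roots are treated like simple ones.\<close>

lemma companion_prod_linear:
  fixes A :: "'b::field multiset"
  defines "f \<equiv> \<Prod>x\<in>#A. [:-x, 1:]"
  shows "mtrace (companion f ^\<^sub>m k) = (\<Sum>x\<in>#A. x ^ k)" and "det (companion f) = (\<Prod>x\<in>#A. x)"
  unfolding f_def
proof (induction A)
  case empty
  have c: "companion (1 :: 'b poly) \<in> carrier_mat 0 0" using companion_carrier[of "1 :: 'b poly"] by simp
  case 1
  show ?case using c by (simp add: mtrace_def)
  case 2
  show ?case using c by simp
next
  case (add a A)
  define g where "g = (\<Prod>x\<in>#A. [:-x, 1:])"
  define n where "n = degree g"
  have g: "lead_coeff g = 1" unfolding g_def by (induction A) (auto simp: lead_coeff_mult simp del: mult_pCons_left)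
  hence g0: "g \<noteq> 0" by auto
  define f where "f = [:-a, 1:] * g"
  have f: "(\<Prod>x\<in>#add_mset a A. [:-x, 1:]) = f" by (simp add: f_def g_def del: mult_pCons_left)
  have df: "degree f = Suc n" unfolding f_def n_def using g0 by (subst degree_mult_eq) auto
  define M where "M = (mat 1 1 (\<lambda>_. a) :: 'b mat)"
  obtain P E where PE: "P \<in> GL (Suc n)" "E \<in> carrier_mat n 1"
    "companion f * P = P * four_block_mat M (0\<^sub>m 1 n) E (companion g)"
    using companion_linear_factor[OF g, of a] unfolding f_def n_def M_def by blast
  have M: "M \<in> carrier_mat 1 1" by (simp add: M_def)
  have cg: "companion g \<in> carrier_mat n n" using companion_carrier[of g] by (simp add: n_def)
  have cf: "companion f \<in> carrier_mat (Suc n) (Suc n)" using companion_carrier[of f] by (simp add: df)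
  define G where "G = four_block_mat M (0\<^sub>m 1 n) E (companion g)"
  have G: "G \<in> carrier_mat (Suc n) (Suc n)"
    unfolding G_def using four_block_carrier_mat[OF M cg] by simp
  have PG: "companion f * P = P * G" using PE by (simp add: G_def)
  have Mk: "M ^\<^sub>m k = mat 1 1 (\<lambda>_. a ^ k)" for k
  proof (induction k)
    case (Suc k)
    show ?case using Suc by (simp add: M_def) (rule eq_matI, auto simp: scalar_prod_def)
  qed (use M in \<open>auto intro!: eq_matI\<close>)
  case 1
  have "mtrace (companion f ^\<^sub>m k) = mtrace (G ^\<^sub>m k)" by (rule mtrace_pow_similar[OF cf G PE(1) PG])
  also have "\<dots> = mtrace (M ^\<^sub>m k) + mtrace (companion g ^\<^sub>m k)"
    unfolding G_def by (rule mtrace_pow_lower_block[OF M PE(2) cg])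
  also have "mtrace (M ^\<^sub>m k) = a ^ k" unfolding Mk by (simp add: mtrace_def)
  finally show ?case using add(1) unfolding f by (simp add: g_def)
  case 2
  have P: "P \<in> carrier_mat (Suc n) (Suc n)" using PE(1) by (simp add: GL_def)
  have "det (companion f) * det P = det P * det G"
    using arg_cong[OF PG, of det] unfolding det_mult[OF cf P] det_mult[OF P G] .
  hence "det (companion f) = det G" using PE(1) by (simp add: GL_def)
  also have "\<dots> = det M * det (companion g)"
    unfolding G_def by (rule det_four_block_mat_upper_right_zero[OF M refl PE(2) cg])
  also have "det M = a" by (simp add: det_single M_def)
  finally show ?case using add(2) unfolding f by (simp add: g_def)
qed

section \<open>Finite sets of matrices and block triangular form\<close>

lemma carrier_mat_eq_image:
  "carrier_mat n m = mat n m ` (({..<n} \<times> {..<m}) \<rightarrow>\<^sub>E (UNIV :: 'b set))"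
proof (intro equalityI subsetI)
  fix A :: "'b mat" assume A: "A \<in> carrier_mat n m"
  have "A = mat n m (restrict (\<lambda>ij. A $$ ij) ({..<n} \<times> {..<m}))"
    using A by (intro eq_matI) auto
  thus "A \<in> mat n m ` (({..<n} \<times> {..<m}) \<rightarrow>\<^sub>E UNIV)"
    by (intro image_eqI[of _ _ "restrict (\<lambda>ij. A $$ ij) ({..<n} \<times> {..<m})"]) auto
qed auto

lemma card_carrier_mat:
  "finite (carrier_mat n m :: 'b::finite mat set)" "card (carrier_mat n m :: 'b::finite mat set) = CARD('b) ^ (n * m)"
proof -
  show "finite (carrier_mat n m :: 'b mat set)"
    unfolding carrier_mat_eq_image by (intro finite_imageI finite_PiE) auto
  have "inj_on (mat n m) (({..<n} \<times> {..<m}) \<rightarrow>\<^sub>E (UNIV :: 'b set))"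
  proof (rule inj_onI, rule PiE_ext)
    fix f h :: "nat \<times> nat \<Rightarrow> 'b" and ij assume "mat n m f = mat n m h" "ij \<in> {..<n} \<times> {..<m}"
    thus "f ij = h ij" by (cases ij) (metis SigmaE2 index_mat(1) lessThan_iff)
  qed auto
  hence "card (carrier_mat n m :: 'b mat set) = card (({..<n} \<times> {..<m}) \<rightarrow>\<^sub>E (UNIV :: 'b set))"
    unfolding carrier_mat_eq_image by (rule card_image)
  thus "card (carrier_mat n m :: 'b mat set) = CARD('b) ^ (n * m)"
    by (simp add: card_funcsetE card_cartesian_product)
qed

lemma card_carrier_vec:
  "finite (carrier_vec n :: 'b::finite Matrix.vec set)" "card (carrier_vec n :: 'b::finite Matrix.vec set) = CARD('b) ^ n"
proof -
  have bij: "bij_betw (\<lambda>A. col A 0) (carrier_mat n 1) (carrier_vec n :: 'b Matrix.vec set)"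
  proof (rule bij_betwI[of _ _ _ "\<lambda>v. mat n 1 (\<lambda>(i, _). v $ i)"])
    show "mat n 1 (\<lambda>(i, _). col A 0 $ i) = A" if "A \<in> carrier_mat n 1" for A :: "'b mat"
      using that by (intro eq_matI) auto
  qed (auto intro!: eq_vecI)
  thus "finite (carrier_vec n :: 'b Matrix.vec set)" "card (carrier_vec n :: 'b Matrix.vec set) = CARD('b) ^ n"
    using bij_betw_finite[OF bij] bij_betw_same_card[OF bij] card_carrier_mat[of n 1, where 'b='b] by auto
qed

lemma finite_GL: "finite (GL n :: 'b::{field,finite} mat set)"
  using card_carrier_mat(1)[of n n] by (rule finite_subset[rotated]) (auto simp: GL_def)

lemma card_GL_pos: "card (GL n :: 'b::{field,finite} mat set) > 0"
proof -
  have "1\<^sub>m n \<in> (GL n :: 'b mat set)" by (rule GL_one)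
  thus ?thesis using finite_GL[of n, where 'b='b] by (auto simp: card_gt_0_iff)
qed

lemma four_block_upper_GL_iff:
  fixes A :: "'b::field mat"
  assumes "A \<in> carrier_mat j j" "B \<in> carrier_mat j m" "D \<in> carrier_mat m m"
  shows "four_block_mat A B (0\<^sub>m m j) D \<in> GL (j + m) \<longleftrightarrow> A \<in> GL j \<and> D \<in> GL m"
  using det_four_block_mat_lower_left_zero[OF assms(1,2) refl assms(3)] assms
  by (simp add: GL_def four_block_carrier_mat)

text \<open>For \<open>AA\<close> inside \<open>GL j\<close> these are the invertible matrices that
  stabilize the span of the first \<open>j\<close> basis vectors and act on it by a member of
  \<open>AA\<close>.\<close>

definition block_mats :: "nat \<Rightarrow> nat \<Rightarrow> 'b::field mat set \<Rightarrow> 'b mat set" where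
  "block_mats j m AA = (\<lambda>(A, B, D). four_block_mat A B (0\<^sub>m m j) D) ` (AA \<times> carrier_mat j m \<times> GL m)"

lemma inj_block_mats:
  assumes "AA \<subseteq> carrier_mat j j"
  shows "inj_on (\<lambda>(A, B, D). four_block_mat A B (0\<^sub>m m j) D) (AA \<times> carrier_mat j m \<times> (GL m :: 'b::field mat set))"
proof (rule inj_onI)
  fix x y :: "'b mat \<times> 'b mat \<times> 'b mat"
  assume xy: "x \<in> AA \<times> carrier_mat j m \<times> GL m" "y \<in> AA \<times> carrier_mat j m \<times> GL m"
    "(\<lambda>(A, B, D). four_block_mat A B (0\<^sub>m m j) D) x = (\<lambda>(A, B, D). four_block_mat A B (0\<^sub>m m j) D) y"
  obtain A B D where x: "x = (A, B, D)" by (cases x)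
  obtain A' B' D' where y: "y = (A', B', D')" by (cases y)
  have in_AA: "A \<in> AA" "A' \<in> AA" and B: "B \<in> carrier_mat j m" "B' \<in> carrier_mat j m"
    and D: "D \<in> GL m" "D' \<in> GL m"
    and eq: "four_block_mat A B (0\<^sub>m m j) D = four_block_mat A' B' (0\<^sub>m m j) D'"
    using xy by (auto simp: x y)
  have c: "A \<in> carrier_mat j j" "A' \<in> carrier_mat j j" "D \<in> carrier_mat m m" "D' \<in> carrier_mat m m"
    using in_AA D assms by (auto simp: GL_def)
  have e: "four_block_mat A B (0\<^sub>m m j) D $$ (r, s) = four_block_mat A' B' (0\<^sub>m m j) D' $$ (r, s)" for r s
    using eq by simp
  have "A = A'"
  proof (rule eq_matI)
    fix r s assume "r < dim_row A'" "s < dim_col A'"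
    thus "A $$ (r, s) = A' $$ (r, s)" using e[of r s] c by auto
  qed (use c in auto)
  moreover have "B = B'"
  proof (rule eq_matI)
    fix r s assume "r < dim_row B'" "s < dim_col B'"
    thus "B $$ (r, s) = B' $$ (r, s)" using e[of r "s + j"] c B by auto
  qed (use B in auto)
  moreover have "D = D'"
  proof (rule eq_matI)
    fix r s assume "r < dim_row D'" "s < dim_col D'"
    thus "D $$ (r, s) = D' $$ (r, s)" using e[of "r + j" "s + j"] c by auto
  qed (use c in auto)
  ultimately show "x = y" by (simp add: x y)
qed

lemma card_block_mats:
  fixes AA :: "'b::{field,finite} mat set"
  assumes "AA \<subseteq> carrier_mat j j"
  shows "card (block_mats j m AA) = card AA * CARD('b) ^ (j * m) * card (GL m :: 'b mat set)"
  unfolding block_mats_def card_image[OF inj_block_mats[OF assms]]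
  by (simp add: card_cartesian_product card_carrier_mat)

lemma in_block_mats_iff:
  fixes N :: "'b::field mat"
  assumes N: "N \<in> carrier_mat (j + m) (j + m)" and AA: "AA \<subseteq> GL j"
  shows "N \<in> block_mats j m AA \<longleftrightarrow> N \<in> GL (j + m) \<and> mat j j (\<lambda>ij. N $$ ij) \<in> AA
    \<and> (\<forall>i c. j \<le> i \<and> i < j + m \<and> c < j \<longrightarrow> N $$ (i, c) = 0)"
proof
  assume "N \<in> block_mats j m AA"
  then obtain A B D where NB: "N = four_block_mat A B (0\<^sub>m m j) D" and A: "A \<in> AA"
    and B: "B \<in> carrier_mat j m" and D: "D \<in> GL m" by (auto simp: block_mats_def)
  have c: "A \<in> carrier_mat j j" "D \<in> carrier_mat m m" using A D AA by (auto simp: GL_def)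
  have "mat j j (\<lambda>ij. N $$ ij) = A" using c by (intro eq_matI) (auto simp: NB)
  moreover have "N \<in> GL (j + m)"
    unfolding NB four_block_upper_GL_iff[OF c(1) B c(2)] using A AA D by auto
  moreover have "N $$ (i, r) = 0" if "j \<le> i" "i < j + m" "r < j" for i r
    using that c by (simp add: NB)
  ultimately show "N \<in> GL (j + m) \<and> mat j j (\<lambda>ij. N $$ ij) \<in> AA
    \<and> (\<forall>i c. j \<le> i \<and> i < j + m \<and> c < j \<longrightarrow> N $$ (i, c) = 0)" using A by simp
next
  assume *: "N \<in> GL (j + m) \<and> mat j j (\<lambda>ij. N $$ ij) \<in> AA
    \<and> (\<forall>i c. j \<le> i \<and> i < j + m \<and> c < j \<longrightarrow> N $$ (i, c) = 0)"
  define A where "A = mat j j (\<lambda>ij. N $$ ij)"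
  define B where "B = mat j m (\<lambda>(r, s). N $$ (r, s + j))"
  define D where "D = mat m m (\<lambda>(r, s). N $$ (r + j, s + j))"
  have NB: "N = four_block_mat A B (0\<^sub>m m j) D"
    using N * by (intro eq_matI) (auto simp: A_def B_def D_def)
  have c: "A \<in> carrier_mat j j" "B \<in> carrier_mat j m" "D \<in> carrier_mat m m" by (auto simp: A_def B_def D_def)
  have "D \<in> GL m" using four_block_upper_GL_iff[OF c] * NB by auto
  thus "N \<in> block_mats j m AA" unfolding block_mats_def NB using * c by (intro image_eqI[of _ _ "(A, B, D)"]) (auto simp: A_def)
qed

text \<open>The matrices of an invertible map \<open>M\<close> in a basis beginning with
  \<open>v, M v, ..., M^(j - 1) v\<close>, where these vectors span the cyclic subspace of
  \<open>v\<close>: the first \<open>j - 1\<close> columns are the shift, and column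
  \<open>j - 1\<close> stays in the span. For \<open>j = 0\<close> there is no such column, hence
  the guard.\<close>

definition krylov_mats :: "nat \<Rightarrow> nat \<Rightarrow> 'b::field mat set" where
  "krylov_mats j n = {N \<in> GL n. (\<forall>l. Suc l < j \<longrightarrow> col N l = unit_vec n (Suc l)) \<and>
     (j > 0 \<longrightarrow> (\<forall>i. j \<le> i \<and> i < n \<longrightarrow> N $$ (i, j - 1) = 0))}"

text \<open>The pointwise stabilizer of the first \<open>j\<close> basis vectors; for
  \<open>j \<le> n\<close> its order is the number of ways to complete \<open>j\<close> independent
  vectors to a basis.\<close>

definition fixing :: "nat \<Rightarrow> nat \<Rightarrow> 'b::field mat set" where
  "fixing j n = {h \<in> GL n. \<forall>l<j. col h l = unit_vec n l}"

lemma fixing_eq_block_mats: "fixing j (j + m) = block_mats j m {1\<^sub>m j :: 'b::field mat}"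
proof (rule Set.set_eqI)
  fix h :: "'b mat"
  show "h \<in> fixing j (j + m) \<longleftrightarrow> h \<in> block_mats j m {1\<^sub>m j}"
  proof (cases "h \<in> GL (j + m)")
    case True
    hence h: "h \<in> carrier_mat (j + m) (j + m)" by (simp add: GL_def)
    have "(\<forall>l<j. col h l = unit_vec (j + m) l) \<longleftrightarrow> mat j j (\<lambda>ij. h $$ ij) = 1\<^sub>m j \<and>
      (\<forall>i c. j \<le> i \<and> i < j + m \<and> c < j \<longrightarrow> h $$ (i, c) = 0)" (is "?L \<longleftrightarrow> ?R1 \<and> ?R2")
    proof
      assume L: ?L
      have e: "h $$ (i, c) = (if i = c then 1 else 0)" if "i < j + m" "c < j" for i c
      proof -
        have "h $$ (i, c) = col h c $ i" using h that by simp
        also have "\<dots> = unit_vec (j + m) c $ i" using L that by simp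
        finally show ?thesis using that by simp
      qed
      show "?R1 \<and> ?R2" using e by (auto intro!: eq_matI)
    next
      assume R: "?R1 \<and> ?R2"
      have e: "h $$ (i, c) = (if i = c then 1 else 0)" if "i < j" "c < j" for i c
      proof -
        have "mat j j (\<lambda>ij. h $$ ij) $$ (i, c) = 1\<^sub>m j $$ (i, c)" using R by simp
        thus ?thesis using that by simp
      qed
      show ?L using R h e by (auto intro!: eq_vecI) (metis linorder_not_less)
    qed
    moreover have "{1\<^sub>m j} \<subseteq> (GL j :: 'b mat set)" by (simp add: GL_one)
    ultimately show ?thesis using in_block_mats_iff[OF h, of "{1\<^sub>m j}"] True by (simp add: fixing_def)
  next
    case False
    have "h \<notin> block_mats j m {1\<^sub>m j}"
      using False four_block_upper_GL_iff[of "1\<^sub>m j" j _ m] GL_one[of j]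
      by (auto simp: block_mats_def GL_def)
    thus ?thesis using False by (simp add: fixing_def)
  qed
qed

lemma map_mat_companion:
  "map_mat to_ac (companion f) = companion (map_poly to_ac f :: 'b::field alg_closure poly)"
  by (intro eq_matI) (auto simp: companion_def)

lemma companion_GL_iff:
  fixes f :: "'b::field poly"
  assumes "lead_coeff f = 1"
  shows "companion f \<in> GL (degree f) \<longleftrightarrow> coeff f 0 \<noteq> 0"
proof -
  have "to_ac (det (companion f)) = det (companion (map_poly to_ac f))"
    by (simp add: map_mat_companion[symmetric] to_ac.hom_det)
  also have "\<dots> = (\<Prod>x\<in>#roots f. x)"
    unfolding map_to_ac_eq_prod_roots(1)[OF assms] by (rule companion_prod_linear(2))
  finally have "to_ac (det (companion f)) = prod_mset (roots f)" by simp
  hence "det (companion f) = 0 \<longleftrightarrow> prod_mset (roots f) = 0" by (metis to_ac_eq_0_iff(1))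
  also have "\<dots> \<longleftrightarrow> 0 \<in># roots f" by (rule prod_mset_zero_iff)
  also have "\<dots> \<longleftrightarrow> coeff f 0 = 0" using assms by (subst coeff_0_eq_0_iff_roots) auto
  finally show ?thesis by (simp add: GL_def companion_carrier)
qed

lemma mtrace_companion_pow:
  fixes f :: "'b::field poly"
  assumes "lead_coeff f = 1"
  shows "to_ac (mtrace (companion f ^\<^sub>m k)) = (\<Sum>x\<in>#roots f. x ^ k)"
proof -
  have "to_ac (mtrace (companion f ^\<^sub>m k)) = mtrace (map_mat to_ac (companion f ^\<^sub>m k))"
    using carrier_matD[OF pow_carrier_mat[OF companion_carrier[of f], of k]]
      carrier_matD[OF companion_carrier[of f]] by (simp add: mtrace_def to_ac_sum)
  also have "\<dots> = mtrace (companion (map_poly to_ac f) ^\<^sub>m k)"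
    by (simp add: to_ac.mat_hom_pow[OF companion_carrier] map_mat_companion)
  also have "\<dots> = (\<Sum>x\<in>#roots f. x ^ k)"
    unfolding map_to_ac_eq_prod_roots(1)[OF assms] by (rule companion_prod_linear(1))
  finally show ?thesis .
qed

lemma companion_recognize:
  fixes A :: "'b::field mat"
  assumes A: "A \<in> carrier_mat j j"
    and sub: "\<And>r c. r < j \<Longrightarrow> Suc c < j \<Longrightarrow> A $$ (r, c) = (if r = Suc c then 1 else 0)"
  obtains f where "lead_coeff f = 1" "degree f = j" "A = companion f"
proof -
  define f where "f = monom 1 j - (\<Sum>i<j. monom (A $$ (i, j - 1)) i)"
  have cf: "coeff f i = (if i < j then - A $$ (i, j - 1) else if i = j then 1 else 0)" for i
    by (auto simp: f_def coeff_sum)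
  have "degree f \<le> j" by (rule degree_le) (simp add: cf)
  moreover have "coeff f j = 1" by (simp add: cf)
  ultimately have d: "degree f = j" "lead_coeff f = 1" using le_degree[of f j] by auto
  have "A = companion f"
  proof (rule eq_matI)
    fix r c assume "r < dim_row (companion f)" "c < dim_col (companion f)"
    hence rc: "r < j" "c < j" using companion_carrier[of f] d by auto
    show "A $$ (r, c) = companion f $$ (r, c)"
      using rc sub[of r c] by (auto simp: companion_def d cf)
  qed (use A companion_carrier[of f] d in auto)
  thus thesis using that d by blast
qed

lemma inj_companion: "inj_on companion {f :: 'b::field poly. lead_coeff f = 1 \<and> degree f = j}"
proof (rule inj_onI)
  fix f h :: "'b poly"
  assume f: "f \<in> {f. lead_coeff f = 1 \<and> degree f = j}" and h: "h \<in> {f. lead_coeff f = 1 \<and> degree f = j}"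
    and eq: "companion f = companion h"
  show "f = h"
  proof (rule poly_eqI)
    fix i
    consider "i < j" | "i = j" | "i > j" by linarith
    thus "coeff f i = coeff h i"
    proof cases
      case 1
      have "companion f $$ (i, j - 1) = companion h $$ (i, j - 1)" using eq by simp
      thus ?thesis using 1 f h by (auto simp: companion_def)
    next
      case 3
      thus ?thesis using f h by (simp add: coeff_eq_0)
    qed (use f h in auto)
  qed
qed

context field_character
begin

lemma companion_monics_GL: "companion ` monics j \<subseteq> GL j"
  using companion_GL_iff by (auto simp: monics_def)

text \<open>The shift columns make the leading block a companion matrix, and its invertibility is
  the nonzero constant term demanded by \<open>monics\<close>.\<close>

lemma krylov_mats_eq_block_mats: "krylov_mats j (j + m) = block_mats j m (companion ` monics j)"
proof (rule Set.set_eqI)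
  fix N :: "'a mat"
  show "N \<in> krylov_mats j (j + m) \<longleftrightarrow> N \<in> block_mats j m (companion ` monics j)"
  proof (cases "N \<in> GL (j + m)")
    case True
    hence N: "N \<in> carrier_mat (j + m) (j + m)" by (simp add: GL_def)
    define A where "A = mat j j (\<lambda>ij. N $$ ij)"
    show ?thesis
    proof
      assume K: "N \<in> krylov_mats j (j + m)"
      have e: "N $$ (i, c) = (if i = Suc c then 1 else 0)" if "i < j + m" "Suc c < j" for i c
      proof -
        have "N $$ (i, c) = col N c $ i" using N that by simp
        also have "\<dots> = unit_vec (j + m) (Suc c) $ i" using K that by (simp add: krylov_mats_def)
        finally show ?thesis using that by simp
      qed
      have z: "N $$ (i, c) = 0" if "j \<le> i" "i < j + m" "c < j" for i c
      proof (cases "Suc c < j")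
        case False
        hence "c = j - 1" "j > 0" using that by auto
        thus ?thesis using K that by (simp add: krylov_mats_def)
      qed (use e[of i c] that in auto)
      have A: "A \<in> carrier_mat j j" by (simp add: A_def)
      obtain f where f: "lead_coeff f = 1" "degree f = j" "A = companion f"
        by (rule companion_recognize[OF A]) (auto simp: A_def e)
      define B where "B = mat j m (\<lambda>(r, s). N $$ (r, s + j))"
      define D where "D = mat m m (\<lambda>(r, s). N $$ (r + j, s + j))"
      have "N = four_block_mat A B (0\<^sub>m m j) D"
        using N z by (intro eq_matI) (auto simp: A_def B_def D_def)
      hence "A \<in> GL j"
        using True four_block_upper_GL_iff[OF A, of B m D] by (auto simp: B_def D_def)
      hence "f \<in> monics j" using f companion_GL_iff[OF f(1)] by (simp add: monics_def)
      thus "N \<in> block_mats j m (companion ` monics j)"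
        unfolding in_block_mats_iff[OF N companion_monics_GL] using True z f(3) by (auto simp: A_def)
    next
      assume "N \<in> block_mats j m (companion ` monics j)"
      then obtain f where f: "f \<in> monics j" "A = companion f"
        and z: "\<And>i c. j \<le> i \<Longrightarrow> i < j + m \<Longrightarrow> c < j \<Longrightarrow> N $$ (i, c) = 0"
        unfolding in_block_mats_iff[OF N companion_monics_GL] A_def by auto
      have d: "degree f = j" using f by (simp add: monics_def)
      have e: "N $$ (i, c) = (if i = Suc c then 1 else 0)" if "i < j + m" "Suc c < j" for i c
      proof (cases "i < j")
        case True
        hence "N $$ (i, c) = A $$ (i, c)" using that by (simp add: A_def)
        thus ?thesis using that True by (simp add: f companion_def d)
      qed (use z that in auto)
      have "col N l = unit_vec (j + m) (Suc l)" if "Suc l < j" for l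
        using N that e by (intro eq_vecI) auto
      thus "N \<in> krylov_mats j (j + m)" using True z by (auto simp: krylov_mats_def)
    qed
  next
    case False
    have "N \<notin> block_mats j m (companion ` monics j)"
    proof
      assume "N \<in> block_mats j m (companion ` monics j)"
      then obtain A B D where *: "N = four_block_mat A B (0\<^sub>m m j) D" "A \<in> companion ` monics j"
        "B \<in> carrier_mat j m" "D \<in> GL m" by (auto simp: block_mats_def)
      have "A \<in> GL j" using * companion_monics_GL by auto
      thus False using False four_block_upper_GL_iff[of A j B m D] * by (simp add: GL_def)
    qed
    thus ?thesis using False by (simp add: krylov_mats_def)
  qed
qed

text \<open>This is \<open>\<psi> (tr g(M))\<close>, expanded by linearity of the trace.\<close>

definition mat_char :: "'a poly \<Rightarrow> 'a mat \<Rightarrow> complex" where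
  "mat_char g M = \<psi> (\<Sum>i\<le>degree g. coeff g i * mtrace (M ^\<^sub>m i))"

definition GL_sum :: "'a poly \<Rightarrow> nat \<Rightarrow> complex" where
  "GL_sum g n = (\<Sum>M\<in>GL n. mat_char g M)"

lemma mat_char_similar:
  assumes "A \<in> carrier_mat n n" "B \<in> carrier_mat n n" "P \<in> GL n" "A * P = P * B"
  shows "mat_char g A = mat_char g B"
  unfolding mat_char_def mtrace_pow_similar[OF assms] ..

lemma mat_char_four_block:
  assumes "A \<in> carrier_mat n n" "B \<in> carrier_mat n m" "D \<in> carrier_mat m m"
  shows "mat_char g (four_block_mat A B (0\<^sub>m m n) D) = mat_char g A * mat_char g D"
  unfolding mat_char_def mtrace_pow_upper_block[OF assms] by (simp add: distrib_left sum.distrib char_add)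

text \<open>The traces of the powers of a companion matrix are the power sums of the roots; through
  this the sums \<open>L_coeff\<close> enter the matrix count.\<close>

lemma mat_char_companion:
  assumes "lead_coeff f = 1"
  shows "mat_char g (companion f) = poly_char g f"
proof -
  have "rootsum g f = to_ac (\<Sum>i\<le>degree g. coeff g i * mtrace (companion f ^\<^sub>m i))"
    by (simp add: rootsum_altdef to_ac_sum mtrace_companion_pow[OF assms])
  thus ?thesis by (simp add: mat_char_def poly_char_def)
qed

lemma sum_mat_char_block_mats:
  assumes "AA \<subseteq> carrier_mat j j"
  shows "(\<Sum>N\<in>block_mats j m AA. mat_char g N) = (\<Sum>A\<in>AA. mat_char g A) * of_nat (CARD('a) ^ (j * m)) * GL_sum g m"
proof -
  have "(\<Sum>N\<in>block_mats j m AA. mat_char g N) = (\<Sum>(A, B, D)\<in>AA \<times> (carrier_mat j m :: 'a mat set) \<times> GL m. mat_char g A * mat_char g D)"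
    unfolding block_mats_def sum.reindex[OF inj_block_mats[OF assms]]
    using assms by (intro sum.cong refl) (auto simp: GL_def intro!: mat_char_four_block)
  also have "\<dots> = (\<Sum>A\<in>AA. \<Sum>B\<in>(carrier_mat j m :: 'a mat set). \<Sum>D\<in>GL m. mat_char g A * mat_char g D)"
    by (simp only: sum.cartesian_product)
  also have "\<dots> = (\<Sum>A\<in>AA. mat_char g A) * of_nat (CARD('a) ^ (j * m)) * GL_sum g m"
    by (simp add: card_carrier_mat GL_sum_def sum_distrib_left sum_distrib_right mult_ac)
  finally show ?thesis .
qed

lemma sum_mat_char_krylov_mats:
  "(\<Sum>N\<in>krylov_mats j (j + m). mat_char g N) = L_coeff g j * of_nat (CARD('a) ^ (j * m)) * GL_sum g m"
proof -
  have "companion ` monics j \<subseteq> carrier_mat j j" using companion_monics_GL[of j] by (auto simp: GL_def)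
  hence "(\<Sum>N\<in>krylov_mats j (j + m). mat_char g N) = (\<Sum>A\<in>companion ` monics j. mat_char g A) * of_nat (CARD('a) ^ (j * m)) * GL_sum g m"
    unfolding krylov_mats_eq_block_mats by (rule sum_mat_char_block_mats)
  also have "(\<Sum>A\<in>companion ` monics j. mat_char g A) = L_coeff g j"
    unfolding L_coeff_def
    by (subst sum.reindex[OF inj_on_subset[OF inj_companion[of j]]])
       (auto simp: monics_def mat_char_companion intro!: sum.cong)
  finally show ?thesis .
qed

lemma card_fixing:
  "card (fixing j (j + m) :: 'a mat set) = CARD('a) ^ (j * m) * card (GL m :: 'a mat set)"
  using card_block_mats[of "{1\<^sub>m j} :: 'a mat set" j m] by (simp add: fixing_eq_block_mats)

end

section \<open>Counting cyclic subspaces\<close>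

abbreviation krylov_vec :: "'b::field mat \<Rightarrow> 'b Matrix.vec \<Rightarrow> nat \<Rightarrow> 'b Matrix.vec" where
  "krylov_vec M v l \<equiv> ((\<lambda>x. M *\<^sub>v x) ^^ l) v"

definition supp_below :: "nat \<Rightarrow> nat \<Rightarrow> 'b::field Matrix.vec set" where
  "supp_below j n = {y \<in> carrier_vec n. \<forall>i. j \<le> i \<and> i < n \<longrightarrow> y $ i = 0}"

text \<open>An invertible matrix is read as a basis; those in \<open>krylov n j M v\<close> extend the basis
  \<open>v, M v, ...\<close> of the cyclic subspace generated by \<open>v\<close>, which has dimension \<open>j\<close>.\<close>

definition krylov :: "nat \<Rightarrow> nat \<Rightarrow> 'b::field mat \<Rightarrow> 'b Matrix.vec \<Rightarrow> 'b mat set" where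
  "krylov n j M v = {P \<in> GL n. (\<forall>l<j. col P l = krylov_vec M v l) \<and> (\<exists>y\<in>supp_below j n. P *\<^sub>v y = krylov_vec M v j)}"

lemma GL_carrier: "P \<in> GL n \<Longrightarrow> P \<in> carrier_mat n n"
  by (simp add: GL_def)

lemma GL_mult_vec_cancel:
  assumes "P \<in> GL n" "x \<in> carrier_vec n" "y \<in> carrier_vec n" "P *\<^sub>v x = P *\<^sub>v y"
  shows "x = y"
proof -
  obtain Q where Q: "Q \<in> GL n" "Q * P = 1\<^sub>m n" using GL_inverse[OF assms(1)] by metis
  have c: "P \<in> carrier_mat n n" "Q \<in> carrier_mat n n" using assms Q by (auto simp: GL_def)
  have "(Q * P) *\<^sub>v x = (Q * P) *\<^sub>v y"
    using c assms by (simp add: assoc_mult_mat_vec[of _ n n _ n])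
  thus ?thesis using assms Q by simp
qed

lemma mult_unit_vec:
  fixes P :: "'b::field mat"
  assumes "P \<in> carrier_mat n n" "l < n"
  shows "P *\<^sub>v unit_vec n l = col P l"
  using assms by (intro eq_vecI) auto

lemma mult_vec_cong_supp:
  fixes P P' :: "'b::field mat"
  assumes "P \<in> carrier_mat n n" "P' \<in> carrier_mat n n" "y \<in> supp_below j n"
    and "\<And>l. l < j \<Longrightarrow> l < n \<Longrightarrow> col P l = col P' l"
  shows "P *\<^sub>v y = P' *\<^sub>v y"
proof (rule eq_vecI)
  fix i assume "i < dim_vec (P' *\<^sub>v y)"
  hence i: "i < n" using assms by simp
  have "P $$ (i, k) * y $ k = P' $$ (i, k) * y $ k" if k: "k < n" for k
  proof (cases "k < j")
    case True
    have "col P k $ i = col P' k $ i" using assms(4)[OF True k] by simp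
    thus ?thesis using i k assms(1,2) by simp
  next
    case False
    thus ?thesis using assms(3) k by (simp add: supp_below_def)
  qed
  thus "(P *\<^sub>v y) $ i = (P' *\<^sub>v y) $ i"
    using assms i by (auto simp: scalar_prod_def supp_below_def intro!: sum.cong)
qed (use assms in auto)

lemma krylov_vec_carrier: "M \<in> carrier_mat n n \<Longrightarrow> v \<in> carrier_vec n \<Longrightarrow> krylov_vec M v l \<in> carrier_vec n"
  by (induction l) auto

text \<open>In the basis \<open>P\<close> the vector \<open>M^l v\<close> has coordinates
  \<open>unit_vec n l\<close> for \<open>l < j\<close>, and \<open>M^j v\<close> has the coordinates
  \<open>y\<close> supplied by \<open>krylov\<close>. Applying \<open>M\<close> reads off the
  columns of \<open>N\<close>.\<close>

lemma krylov_imp_krylov_mats: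
  assumes "j \<le> n" and P: "P \<in> krylov n j M v" and N: "N \<in> GL n" and M: "M \<in> carrier_mat n n" "M * P = P * N"
  shows "N \<in> krylov_mats j n"
proof -
  have PG: "P \<in> GL n" and cP: "\<And>l. l < j \<Longrightarrow> col P l = krylov_vec M v l" using P by (auto simp: krylov_def)
  obtain y where y: "y \<in> supp_below j n" "P *\<^sub>v y = krylov_vec M v j" using P by (auto simp: krylov_def)
  have yc: "y \<in> carrier_vec n" using y by (simp add: supp_below_def)
  note c = GL_carrier[OF PG] GL_carrier[OF N] M(1)
  have step: "P *\<^sub>v col N l = krylov_vec M v (Suc l)" if "l < j" for l
  proof -
    have l: "l < n" using that assms(1) by simp
    have "P *\<^sub>v col N l = col (P * N) l" by (rule col_mult2[OF c(1,2) l, symmetric])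
    also have "\<dots> = M *\<^sub>v col P l" unfolding M(2)[symmetric] by (rule col_mult2[OF c(3,1) l])
    finally show ?thesis using cP[OF that] by simp
  qed
  have "col N l = unit_vec n (Suc l)" if l: "Suc l < j" for l
  proof (rule GL_mult_vec_cancel[OF PG])
    show "P *\<^sub>v col N l = P *\<^sub>v unit_vec n (Suc l)"
      using step[of l] l cP[OF l] assms(1) c by (simp add: mult_unit_vec[OF c(1)])
  qed (use c l assms(1) in auto)
  moreover have "N $$ (i, j - 1) = 0" if i: "j > 0" "j \<le> i" "i < n" for i
  proof -
    have "col N (j - 1) = y"
    proof (rule GL_mult_vec_cancel[OF PG])
      show "P *\<^sub>v col N (j - 1) = P *\<^sub>v y" using step[of "j - 1"] i y by simp
    qed (use c i assms(1) yc in auto)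
    moreover have "N $$ (i, j - 1) = col N (j - 1) $ i" using c i by simp
    ultimately show ?thesis using y i by (simp add: supp_below_def)
  qed
  ultimately show ?thesis using N by (simp add: krylov_mats_def)
qed

text \<open>The vector is the first column of \<open>P\<close>, or 0 when \<open>j = 0\<close> and
  the cyclic subspace is trivial.\<close>

lemma krylov_mats_imp_krylov:
  assumes "j \<le> n" and N: "N \<in> krylov_mats j n" and PG: "P \<in> GL n" and M: "M \<in> carrier_mat n n" "M * P = P * N"
  shows "\<exists>v\<in>carrier_vec n. P \<in> krylov n j M v"
proof (cases "j = 0")
  case True
  have "P *\<^sub>v 0\<^sub>v n = 0\<^sub>v n" using GL_carrier[OF PG] by auto
  moreover have "0\<^sub>v n \<in> supp_below 0 n" by (simp add: supp_below_def)
  ultimately have "P \<in> krylov n j M (0\<^sub>v n)" using PG True by (auto simp: krylov_def)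
  thus ?thesis by (intro bexI[of _ "0\<^sub>v n"]) auto
next
  case False
  have NG: "N \<in> GL n" using N by (simp add: krylov_mats_def)
  note c = GL_carrier[OF PG] GL_carrier[OF NG] M(1)
  define v where "v = col P 0"
  have step: "P *\<^sub>v col N l = M *\<^sub>v col P l" if "l < n" for l
  proof -
    have "P *\<^sub>v col N l = col (P * N) l" by (rule col_mult2[OF c(1,2) that, symmetric])
    also have "\<dots> = M *\<^sub>v col P l" unfolding M(2)[symmetric] by (rule col_mult2[OF c(3,1) that])
    finally show ?thesis .
  qed
  have cP: "col P l = krylov_vec M v l" if "l < j" for l
    using that
  proof (induction l)
    case (Suc l)
    have "col P (Suc l) = P *\<^sub>v unit_vec n (Suc l)" using c Suc.prems assms(1) by (simp add: mult_unit_vec)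
    also have "unit_vec n (Suc l) = col N l" using N Suc.prems by (simp add: krylov_mats_def)
    also have "P *\<^sub>v col N l = M *\<^sub>v col P l" using step[of l] Suc.prems assms(1) by simp
    finally show ?case using Suc by simp
  qed (simp add: v_def)
  have "col N (j - 1) \<in> supp_below j n" using N c False assms(1) by (auto simp: supp_below_def krylov_mats_def)
  moreover have "P *\<^sub>v col N (j - 1) = krylov_vec M v j"
    using step[of "j - 1"] cP[of "j - 1"] False assms(1) by (cases j) auto
  ultimately have "P \<in> krylov n j M v" using PG cP by (auto simp: krylov_def)
  moreover have "v \<in> carrier_vec n" using c by (auto simp: v_def)
  ultimately show ?thesis by blast
qed

lemma krylov_vec_unique:
  assumes "P \<in> krylov n j M v" "P \<in> krylov n j M v'"
  shows "v = v'"
proof (cases "j = 0")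
  case True
  have z: "y = 0\<^sub>v n" if "y \<in> supp_below 0 n" for y :: "'a Matrix.vec"
    using that by (intro eq_vecI) (auto simp: supp_below_def)
  show ?thesis using assms z True by (auto simp: krylov_def)
next
  case False
  thus ?thesis using assms by (auto simp: krylov_def)
qed

text \<open>Right multiplication by \<open>fixing j n\<close> acts simply transitively on the bases
  with the same first \<open>j\<close> columns, and the condition on \<open>M^j v\<close> depends on
  these columns only.\<close>

lemma card_krylov:
  fixes M :: "'b::field mat"
  assumes "P0 \<in> krylov n j M v" "j \<le> n"
  shows "card (krylov n j M v) = card (fixing j n :: 'b mat set)"
proof -
  have PG: "P0 \<in> GL n" and cP: "\<And>l. l < j \<Longrightarrow> col P0 l = krylov_vec M v l" using assms by (auto simp: krylov_def)
  obtain y where y: "y \<in> supp_below j n" "P0 *\<^sub>v y = krylov_vec M v j" using assms by (auto simp: krylov_def)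
  have yc: "y \<in> carrier_vec n" using y by (simp add: supp_below_def)
  obtain Q where Q: "Q \<in> GL n" "P0 * Q = 1\<^sub>m n" "Q * P0 = 1\<^sub>m n" using GL_inverse[OF PG] .
  note c = GL_carrier[OF PG] GL_carrier[OF Q(1)]
  have "bij_betw (\<lambda>h. P0 * h) (fixing j n) (krylov n j M v)"
  proof (rule bij_betwI[of _ _ _ "\<lambda>P. Q * P"])
    show "(\<lambda>h. P0 * h) \<in> fixing j n \<rightarrow> krylov n j M v"
    proof
      fix h :: "'b mat" assume h: "h \<in> fixing j n"
      hence hG: "h \<in> GL n" and hc: "\<And>l. l < j \<Longrightarrow> col h l = unit_vec n l" by (auto simp: fixing_def)
      note ch = GL_carrier[OF hG]
      have "col (P0 * h) l = krylov_vec M v l" if "l < j" for l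
      proof -
        have "col (P0 * h) l = P0 *\<^sub>v col h l"
          by (rule col_mult2[OF c(1) ch]) (use that assms(2) in simp)
        thus ?thesis using hc[OF that] c that assms(2) cP[OF that] by (simp add: mult_unit_vec)
      qed
      moreover have "(P0 * h) *\<^sub>v y = krylov_vec M v j"
      proof -
        have "h *\<^sub>v y = 1\<^sub>m n *\<^sub>v y"
          by (rule mult_vec_cong_supp[OF ch _ y(1)]) (auto simp: hc)
        thus ?thesis using c ch yc y(2) by (simp add: assoc_mult_mat_vec[of _ n n _ n])
      qed
      ultimately show "P0 * h \<in> krylov n j M v"
        using GL_mult[OF PG hG] y(1) by (auto simp: krylov_def)
    qed
    show "(\<lambda>P. Q * P) \<in> krylov n j M v \<rightarrow> fixing j n"
    proof
      fix P assume P: "P \<in> krylov n j M v"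
      hence PG': "P \<in> GL n" and cP': "\<And>l. l < j \<Longrightarrow> col P l = krylov_vec M v l" by (auto simp: krylov_def)
      note ch = GL_carrier[OF PG']
      have "col (Q * P) l = unit_vec n l" if "l < j" for l
      proof -
        have l: "l < n" using that assms(2) by simp
        have "col (Q * P) l = Q *\<^sub>v col P l" by (rule col_mult2[OF c(2) ch l])
        also have "col P l = col P0 l" using cP cP' that by simp
        also have "Q *\<^sub>v col P0 l = col (Q * P0) l" by (rule col_mult2[OF c(2,1) l, symmetric])
        finally show ?thesis using Q(3) l by simp
      qed
      thus "Q * P \<in> fixing j n" using GL_mult[OF Q(1) PG'] by (simp add: fixing_def)
    qed
    show "Q * (P0 * h) = h" if "h \<in> fixing j n" for h :: "'b mat"
    proof -
      have ch: "h \<in> carrier_mat n n" using that by (simp add: fixing_def GL_def)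
      show ?thesis using assoc_mult_mat[OF c(2,1) ch] Q(3) left_mult_one_mat[OF ch] by simp
    qed
    show "P0 * (Q * P) = P" if "P \<in> krylov n j M v" for P
    proof -
      have ch: "P \<in> carrier_mat n n" using that by (simp add: krylov_def GL_def)
      show ?thesis using assoc_mult_mat[OF c(1,2) ch] Q(2) left_mult_one_mat[OF ch] by simp
    qed
  qed
  thus ?thesis by (rule bij_betw_same_card[symmetric])
qed

text \<open>\<open>P\<close> puts \<open>M^j v\<close> into the span of the preceding iterates,
  whereas in \<open>P'\<close> it is a further basis vector.\<close>

lemma krylov_index_unique:
  assumes P: "P \<in> krylov n j M v" and P': "P' \<in> krylov n j' M v" and j: "j < j'" "j' \<le> n"
  shows False
proof -
  have PG: "P \<in> GL n" "P' \<in> GL n" and cP: "\<And>l. l < j \<Longrightarrow> col P l = krylov_vec M v l"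
    and cP': "\<And>l. l < j' \<Longrightarrow> col P' l = krylov_vec M v l" using P P' by (auto simp: krylov_def)
  obtain y where y: "y \<in> supp_below j n" "P *\<^sub>v y = krylov_vec M v j" using P by (auto simp: krylov_def)
  have yc: "y \<in> carrier_vec n" using y by (simp add: supp_below_def)
  note c = GL_carrier[OF PG(1)] GL_carrier[OF PG(2)]
  have "P' *\<^sub>v y = P *\<^sub>v y"
    using j by (intro mult_vec_cong_supp[OF c(2,1) y(1)]) (auto simp: cP cP')
  also have "\<dots> = P' *\<^sub>v unit_vec n j"
    using y cP'[OF j(1)] j c by (simp add: mult_unit_vec)
  finally have "y = unit_vec n j"
    using j by (intro GL_mult_vec_cancel[OF PG(2) yc]) auto
  moreover have "y $ j = 0" using y j by (simp add: supp_below_def)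
  ultimately show False using j by simp
qed

lemma extend_GL:
  fixes y :: "'b::field Matrix.vec"
  assumes y: "y \<in> carrier_vec n" and i: "j \<le> i" "i < n" "y $ i \<noteq> 0"
  obtains Q where "Q \<in> GL n" "\<And>l. l < j \<Longrightarrow> col Q l = unit_vec n l" "col Q j = y"
proof -
  \<comment> \<open>An exchange: column \<open>j\<close> becomes \<open>y\<close>, and for
    \<open>i \<noteq> j\<close> the displaced \<open>unit_vec n j\<close> moves to column
    \<open>i\<close>, where \<open>y\<close> has its nonzero coordinate.\<close>
  define Q where "Q = mat n n (\<lambda>(r, c). if c = j then y $ r else if c = i then (if r = j then 1 else 0)
     else if r = c then 1 else 0)"
  have Q: "Q \<in> carrier_mat n n" by (simp add: Q_def)
  have "det Q \<noteq> 0"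
  proof
    assume "det Q = 0"
    then obtain x where x: "x \<in> carrier_vec n" "x \<noteq> 0\<^sub>v n" "Q *\<^sub>v x = 0\<^sub>v n"
      using det_0_iff_vec_prod_zero_field[OF Q] by blast
    have row: "(\<Sum>c\<in>{0..<n}. Q $$ (r, c) * x $ c) = 0" if "r < n" for r
    proof -
      have "row Q r \<bullet> x = (Q *\<^sub>v x) $ r" using Q that by simp
      also have "\<dots> = 0" unfolding x(3) using that by simp
      finally show ?thesis using Q x(1) that by (simp add: scalar_prod_def)
    qed
    have "(\<Sum>c\<in>{0..<n}. Q $$ (i, c) * x $ c) = (\<Sum>c\<in>{0..<n}. if c = j then y $ i * x $ j else 0)"
      using i by (intro sum.cong refl) (auto simp: Q_def)
    hence xj: "x $ j = 0" using row[of i] i by simp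
    have "x $ r = 0" if r: "r < n" for r
    proof (cases "r = i")
      case True
      have "(\<Sum>c\<in>{0..<n}. Q $$ (j, c) * x $ c) = (\<Sum>c\<in>{0..<n}. if c = i then x $ i else 0)"
        using i xj by (intro sum.cong refl) (auto simp: Q_def)
      thus ?thesis using row[of j] i True by simp
    next
      case False
      show ?thesis
      proof (cases "r = j")
        case rj: False
        have "(\<Sum>c\<in>{0..<n}. Q $$ (r, c) * x $ c) = (\<Sum>c\<in>{0..<n}. if c = r then x $ r else 0)"
          using r i xj False rj by (intro sum.cong refl) (auto simp: Q_def)
        thus ?thesis using row[of r] r by simp
      qed (use xj in simp)
    qed
    hence "x = 0\<^sub>v n" using x(1) by (intro eq_vecI) auto
    thus False using x(2) by simp
  qed
  moreover have "col Q l = unit_vec n l" if "l < j" for l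
    using that i by (intro eq_vecI) (auto simp: Q_def)
  moreover have "col Q j = y" using y i by (intro eq_vecI) (auto simp: Q_def)
  ultimately show thesis using that Q by (simp add: GL_def)
qed

text \<open>Take the largest \<open>j\<close> for which the iterates below \<open>j\<close> extend
  to a basis. If the next iterate left their span, \<open>extend_GL\<close> would allow
  \<open>j + 1\<close>.\<close>

lemma krylov_nonempty:
  fixes M :: "'b::field mat"
  assumes M: "M \<in> carrier_mat n n" and v: "v \<in> carrier_vec n"
  shows "\<exists>j\<le>n. krylov n j M v \<noteq> {}"
proof -
  define good where "good = (\<lambda>j. j \<le> n \<and> (\<exists>P\<in>GL n. \<forall>l<j. col P l = krylov_vec M v l))"
  have "good 0" using GL_one by (auto simp: good_def)
  moreover have bound: "\<forall>j. good j \<longrightarrow> j \<le> n" by (simp add: good_def)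
  ultimately have "good (Greatest good)" and max: "\<And>k. good k \<Longrightarrow> k \<le> Greatest good"
    using GreatestI_nat[of good 0 n] Greatest_le_nat[of good _ n] by auto
  define j where "j = Greatest good"
  have j: "j \<le> n" using \<open>good (Greatest good)\<close> by (simp add: j_def good_def)
  obtain P where P: "P \<in> GL n" "\<And>l. l < j \<Longrightarrow> col P l = krylov_vec M v l"
    using \<open>good (Greatest good)\<close> unfolding j_def good_def by blast
  obtain Q where Q: "Q \<in> GL n" "P * Q = 1\<^sub>m n" "Q * P = 1\<^sub>m n" using GL_inverse[OF P(1)] .
  note c = GL_carrier[OF P(1)] GL_carrier[OF Q(1)]
  define y where "y = Q *\<^sub>v krylov_vec M v j"
  have yc: "y \<in> carrier_vec n" using c krylov_vec_carrier[OF M v] by (simp add: y_def mult_mat_vec_carrier[of _ n n])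
  have Py: "P *\<^sub>v y = krylov_vec M v j"
    using c Q(2) krylov_vec_carrier[OF M v, of j] by (simp add: y_def assoc_mult_mat_vec[of _ n n _ n, symmetric])
  have "y \<in> supp_below j n"
  proof (rule ccontr)
    assume "y \<notin> supp_below j n"
    then obtain i where i: "j \<le> i" "i < n" "y $ i \<noteq> 0" using yc by (auto simp: supp_below_def)
    obtain E where E: "E \<in> GL n" "\<And>l. l < j \<Longrightarrow> col E l = unit_vec n l" "col E j = y"
      using extend_GL[OF yc i] by blast
    have "col (P * E) l = krylov_vec M v l" if l: "l < Suc j" for l
    proof -
      have ln: "l < n" using l i by simp
      have "col (P * E) l = P *\<^sub>v col E l" by (rule col_mult2[OF c(1) GL_carrier[OF E(1)] ln])
      thus ?thesis
        using E(2)[of l] E(3) Py P(2)[of l] l ln c by (cases "l = j") (auto simp: mult_unit_vec)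
    qed
    hence "good (Suc j)" unfolding good_def using GL_mult[OF P(1) E(1)] i by (intro conjI bexI[of _ "P * E"]) auto
    thus False using max[of "Suc j"] by (simp add: j_def)
  qed
  hence "P \<in> krylov n j M v" using P Py by (auto simp: krylov_def)
  thus ?thesis using j by blast
qed

lemma finite_krylov: "finite (krylov n j M (v :: 'b::{field,finite} Matrix.vec))"
  using finite_GL by (rule finite_subset[rotated]) (auto simp: krylov_def)

text \<open>One \<open>j\<close> contributes, the dimension of the cyclic subspace, and its quotient
  is 1. Inserted as a factor, this sum sorts the pairs \<open>(M, v)\<close> by that dimension while
  averaging over all adapted bases.\<close>

lemma sum_card_krylov_index:
  fixes M :: "'b::{field,finite} mat"
  assumes M: "M \<in> carrier_mat n n" and v: "v \<in> carrier_vec n"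
  shows "(\<Sum>j\<le>n. real (card (krylov n j M v)) / real (card (fixing j n :: 'b mat set))) = 1"
proof -
  obtain k P where k: "k \<le> n" "P \<in> krylov n k M v" using krylov_nonempty[OF M v] by blast
  have "krylov n j M v = {}" if "j \<le> n" "j \<noteq> k" for j
    using krylov_index_unique[OF k(2), of _ j] krylov_index_unique[of _ n j M v, OF _ k(2)] that k(1)
    by (metis equals0I linorder_neqE_nat)
  hence "(\<Sum>j\<le>n. real (card (krylov n j M v)) / real (card (fixing j n :: 'b mat set)))
    = (\<Sum>j\<in>{k}. real (card (krylov n j M v)) / real (card (fixing j n :: 'b mat set)))"
    using k(1) by (intro sum.mono_neutral_right) auto
  moreover have "card (krylov n k M v) > 0" using finite_krylov k(2) by (auto simp: card_gt_0_iff)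
  ultimately show ?thesis using card_krylov[OF k(2,1)] by simp
qed

context field_character
begin

text \<open>Count triples \<open>(M, v, P)\<close>. The matrices \<open>M\<close> and
  \<open>P\<close> determine \<open>v\<close>; for fixed \<open>P\<close>, conjugation carries the
  admissible \<open>M\<close> onto \<open>krylov_mats j n\<close> and preserves the
  character.\<close>

lemma sum_mat_char_krylov:
  assumes j: "j \<le> n"
  shows "(\<Sum>M\<in>GL n. \<Sum>v\<in>carrier_vec n. mat_char g M * of_nat (card (krylov n j M v))) =
    of_nat (card (GL n :: 'a mat set)) * (\<Sum>N\<in>krylov_mats j n. mat_char g N)"
proof -
  define R where "R = (\<lambda>M P :: 'a mat. \<exists>v\<in>carrier_vec n. P \<in> krylov n j M v)"
  have c1: "(\<Sum>v\<in>carrier_vec n. of_nat (card (krylov n j M v))) = (\<Sum>P\<in>GL n. if R M P then 1 else (0 :: complex))"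
    for M :: "'a mat"
  proof -
    have "(\<Sum>v\<in>carrier_vec n. card (krylov n j M v)) = card (\<Union>v\<in>carrier_vec n. krylov n j M v)"
      using krylov_vec_unique[of _ n j M] card_carrier_vec(1)[where 'b='a] finite_krylov
      by (intro card_UN_disjoint[symmetric]) auto
    also have "(\<Union>v\<in>carrier_vec n. krylov n j M v) = {P \<in> GL n. R M P}"
      by (auto simp: R_def krylov_def)
    finally have "(\<Sum>v\<in>carrier_vec n. of_nat (card (krylov n j M v))) = (of_nat (card {P \<in> GL n. R M P}) :: complex)"
      by (metis of_nat_sum)
    thus ?thesis using finite_GL[of n, where 'b='a] by (simp add: sum.inter_filter[symmetric])
  qed
  have c2: "(\<Sum>M\<in>GL n. if R M P then mat_char g M else 0) = (\<Sum>N\<in>krylov_mats j n. mat_char g N)" if P: "P \<in> GL n" for P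
  proof -
    obtain Q where Q: "Q \<in> GL n" "P * Q = 1\<^sub>m n" "Q * P = 1\<^sub>m n" using GL_inverse[OF P] .
    note c = GL_carrier[OF P] GL_carrier[OF Q(1)]
    have NG: "N \<in> GL n" if "N \<in> krylov_mats j n" for N :: "'a mat" using that by (simp add: krylov_mats_def)
    have PNQ: "P * N * Q * P = P * N" if N: "N \<in> carrier_mat n n" for N
    proof -
      have PN: "P * N \<in> carrier_mat n n" using c N by simp
      show ?thesis using assoc_mult_mat[OF PN c(2,1)] Q(3) right_mult_one_mat[OF PN] by simp
    qed
    have PQM: "P * (Q * M * P) = M * P" if M: "M \<in> carrier_mat n n" for M
    proof -
      have MP: "M * P \<in> carrier_mat n n" using c M by simp
      have "P * (Q * M * P) = P * Q * (M * P)"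
        unfolding assoc_mult_mat[OF c(2) M c(1)] assoc_mult_mat[OF c(1,2) MP] ..
      thus ?thesis using Q(2) left_mult_one_mat[OF MP] by simp
    qed
    have "(\<Sum>M\<in>GL n. if R M P then mat_char g M else 0) = (\<Sum>M | M \<in> GL n \<and> R M P. mat_char g M)"
      using finite_GL[of n, where 'b='a] by (simp add: sum.inter_filter[symmetric])
    also have "\<dots> = (\<Sum>N\<in>krylov_mats j n. mat_char g N)"
    proof (rule sum.reindex_bij_witness[of _ "\<lambda>N. P * N * Q" "\<lambda>M. Q * M * P"])
      fix M assume "M \<in> {M. M \<in> GL n \<and> R M P}"
      hence M: "M \<in> GL n" "R M P" by auto
      note cM = GL_carrier[OF M(1)]
      show "P * (Q * M * P) * Q = M"
        unfolding PQM[OF cM] assoc_mult_mat[OF cM c] Q(2) by (rule right_mult_one_mat[OF cM])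
      show "mat_char g (Q * M * P) = mat_char g M"
        using c cM by (intro mat_char_similar[OF cM _ P PQM[OF cM, symmetric], symmetric]) auto
      obtain v where "P \<in> krylov n j M v" using M(2) by (auto simp: R_def)
      thus "Q * M * P \<in> krylov_mats j n"
        by (rule krylov_imp_krylov_mats[OF j _ _ cM PQM[OF cM, symmetric]]) (intro GL_mult Q(1) M(1) P)
    next
      fix N :: "'a mat" assume N: "N \<in> krylov_mats j n"
      note cN = GL_carrier[OF NG[OF N]]
      show "Q * (P * N * Q) * P = N"
      proof -
        have PNQc: "P * N * Q \<in> carrier_mat n n" using c cN by simp
        have "Q * (P * N * Q) * P = Q * P * N"
          unfolding assoc_mult_mat[OF c(2) PNQc c(1)] PNQ[OF cN] assoc_mult_mat[OF c(2,1) cN] ..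
        thus ?thesis using Q(3) left_mult_one_mat[OF cN] by simp
      qed
      have "P * N * Q \<in> GL n" by (intro GL_mult P Q(1) NG N)
      moreover from this have "R (P * N * Q) P"
        unfolding R_def by (intro krylov_mats_imp_krylov[OF j N P _ PNQ[OF cN]]) (rule GL_carrier)
      ultimately show "P * N * Q \<in> {M. M \<in> GL n \<and> R M P}" by simp
    qed
    finally show ?thesis .
  qed
  have "(\<Sum>M\<in>GL n. \<Sum>v\<in>carrier_vec n. mat_char g M * of_nat (card (krylov n j M v))) =
    (\<Sum>M\<in>GL n. \<Sum>P\<in>GL n. if R M P then mat_char g M else 0)"
    by (intro sum.cong refl) (simp add: sum_distrib_left[symmetric] c1 if_distrib[of "(*) _"] sum_distrib_left cong: if_cong)
  also have "\<dots> = (\<Sum>P\<in>GL n. \<Sum>M\<in>GL n. if R M P then mat_char g M else 0)" by (rule sum.swap)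
  also have "\<dots> = of_nat (card (GL n :: 'a mat set)) * (\<Sum>N\<in>krylov_mats j n. mat_char g N)" by (simp add: c2)
  finally show ?thesis .
qed

definition GL_mean :: "'a poly \<Rightarrow> nat \<Rightarrow> complex" where
  "GL_mean g n = GL_sum g n / of_nat (card (GL n :: 'a mat set))"

text \<open>The number of adapted bases is \<open>q^(j(n-j)) |GL(n-j)|\<close>. Dividing by it, the
  first factor cancels the free block in \<open>sum_mat_char_krylov_mats\<close> and the second
  turns \<open>GL_sum\<close> into \<open>GL_mean\<close>.\<close>

lemma GL_mean_recurrence: "of_nat CARD('a) ^ n * GL_mean g n = (\<Sum>j\<le>n. L_coeff g j * GL_mean g (n - j))"
proof -
  define G where "G = (\<lambda>n. of_nat (card (GL n :: 'a mat set)) :: complex)"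
  define s where "s = (\<lambda>j. of_nat (card (fixing j n :: 'a mat set)) :: complex)"
  have Gm: "of_nat (card (GL m :: 'a mat set)) = G m" for m by (simp add: G_def)
  have G0: "G m \<noteq> 0" for m using card_GL_pos[of m, where 'b='a] by (simp add: G_def)
  have s: "s j = of_nat (CARD('a) ^ (j * (n - j))) * G (n - j)" if "j \<le> n" for j
    using card_fixing[of j "n - j"] that by (simp add: s_def G_def)
  have one: "(\<Sum>j\<le>n. of_nat (card (krylov n j M v)) / s j) = 1"
    if "M \<in> GL n" "v \<in> carrier_vec n" for M :: "'a mat" and v
  proof -
    have "(\<Sum>j\<le>n. of_nat (card (krylov n j M v)) / s j) =
      complex_of_real (\<Sum>j\<le>n. real (card (krylov n j M v)) / real (card (fixing j n :: 'a mat set)))"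
      by (simp add: s_def)
    thus ?thesis using sum_card_krylov_index[OF GL_carrier[OF that(1)] that(2)] by simp
  qed
  define f where "f = (\<lambda>j (M :: 'a mat) v. mat_char g M * of_nat (card (krylov n j M v)))"
  have "of_nat CARD('a) ^ n * GL_sum g n = (\<Sum>M\<in>GL n. \<Sum>v\<in>(carrier_vec n :: 'a Matrix.vec set). mat_char g M)"
    by (simp add: card_carrier_vec GL_sum_def sum_distrib_left)
  also have "\<dots> = (\<Sum>M\<in>GL n. \<Sum>v\<in>carrier_vec n. \<Sum>j\<le>n. f j M v / s j)"
    using one unfolding f_def by (intro sum.cong refl) (simp add: sum_distrib_left[symmetric] times_divide_eq_right[symmetric] del: times_divide_eq_right)
  also have "\<dots> = (\<Sum>M\<in>GL n. \<Sum>j\<le>n. \<Sum>v\<in>carrier_vec n. f j M v / s j)"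
    by (intro sum.cong refl sum.swap)
  also have "\<dots> = (\<Sum>j\<le>n. \<Sum>M\<in>GL n. \<Sum>v\<in>carrier_vec n. f j M v / s j)"
    by (rule sum.swap)
  also have "\<dots> = (\<Sum>j\<le>n. (\<Sum>M\<in>GL n. \<Sum>v\<in>carrier_vec n. f j M v) / s j)"
    by (simp only: sum_divide_distrib)
  also have "\<dots> = (\<Sum>j\<le>n. G n * (L_coeff g j * GL_mean g (n - j)))"
  proof (intro sum.cong refl)
    fix j assume "j \<in> {..n}"
    hence j: "j \<le> n" by simp
    have "(\<Sum>N\<in>krylov_mats j n. mat_char g N) = L_coeff g j * of_nat (CARD('a) ^ (j * (n - j))) * GL_sum g (n - j)"
      using sum_mat_char_krylov_mats[of g j "n - j"] j by simp
    moreover have "(of_nat (CARD('a) ^ (j * (n - j))) :: complex) \<noteq> 0" by simp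
    ultimately show "(\<Sum>M\<in>GL n. \<Sum>v\<in>carrier_vec n. f j M v) / s j = G n * (L_coeff g j * GL_mean g (n - j))"
      unfolding f_def sum_mat_char_krylov[OF j] s[OF j] GL_mean_def Gm using G0 by (simp add: field_simps)
  qed
  also have "\<dots> = G n * (\<Sum>j\<le>n. L_coeff g j * GL_mean g (n - j))" by (simp add: sum_distrib_left)
  finally have "of_nat CARD('a) ^ n * GL_sum g n = G n * (\<Sum>j\<le>n. L_coeff g j * GL_mean g (n - j))" .
  thus ?thesis using G0[of n] unfolding GL_mean_def Gm by (simp add: field_simps)
qed

end

section \<open>The size of the means\<close>

context
  fixes q :: real
  assumes q_gt_1: "q > 1"
begin

text \<open>Euler's coefficient: that of \<open>u^m\<close> in the product of the
  \<open>1 - \<gamma> u / q^i\<close> over all \<open>i \<ge> 1\<close>.\<close>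

definition e_coeff :: "complex \<Rightarrow> nat \<Rightarrow> complex" where
  "e_coeff \<gamma> m = (-\<gamma>) ^ m / (\<Prod>i=1..m. of_real (q ^ i - 1))"

lemma e_coeff_0: "e_coeff \<gamma> 0 = 1"
  by (simp add: e_coeff_def)

lemma e_coeff_Suc: "of_real (q ^ Suc m - 1) * e_coeff \<gamma> (Suc m) = - \<gamma> * e_coeff \<gamma> m"
proof -
  have "q ^ Suc m > 1" using q_gt_1 by (intro one_less_power) auto
  hence "of_real (q ^ Suc m - 1) \<noteq> (0 :: complex)" by (subst of_real_eq_0_iff) simp
  thus ?thesis unfolding e_coeff_def prod.cl_ivl_Suc by simp
qed

definition dilation :: "complex fps \<Rightarrow> complex fps" where
  "dilation f = Abs_fps (\<lambda>n. of_real q ^ n * fps_nth f n)"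

lemma dilation_mult: "dilation (f * g) = dilation f * dilation g"
proof (rule fps_ext)
  fix n
  have "of_real q ^ n * (\<Sum>i=0..n. fps_nth f i * fps_nth g (n - i)) =
    (\<Sum>i=0..n. (of_real q ^ i * fps_nth f i) * (of_real q ^ (n - i) * fps_nth g (n - i)))"
    unfolding sum_distrib_left
  proof (intro sum.cong refl)
    fix i assume "i \<in> {0..n}"
    hence "of_real q ^ n = (of_real q ^ i * of_real q ^ (n - i) :: complex)" by (simp flip: power_add)
    thus "of_real q ^ n * (fps_nth f i * fps_nth g (n - i)) =
      of_real q ^ i * fps_nth f i * (of_real q ^ (n - i) * fps_nth g (n - i))" by (simp add: mult_ac)
  qed
  thus "fps_nth (dilation (f * g)) n = fps_nth (dilation f * dilation g) n" by (simp add: dilation_def fps_mult_nth)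
qed

text \<open>The functional equation \<open>f(q u) = (1 - \<gamma> u) f(u)\<close>, which is an index
  shift in the infinite product and represents that product here.\<close>

lemma dilation_e_coeff:
  "dilation (Abs_fps (e_coeff \<gamma>)) = fps_of_poly [:1, -\<gamma>:] * Abs_fps (e_coeff \<gamma>)"
proof (rule fps_ext)
  fix n
  have p: "fps_of_poly [:1, -\<gamma>:] = 1 - fps_const \<gamma> * fps_X"
    by (simp add: fps_of_poly_pCons fps_const_neg[symmetric] del: fps_const_neg)
  show "fps_nth (dilation (Abs_fps (e_coeff \<gamma>))) n = fps_nth (fps_of_poly [:1, -\<gamma>:] * Abs_fps (e_coeff \<gamma>)) n"
  proof (cases n)
    case (Suc m)
    have "of_real q ^ Suc m * e_coeff \<gamma> (Suc m) = e_coeff \<gamma> (Suc m) - \<gamma> * e_coeff \<gamma> m"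
      using e_coeff_Suc[of m \<gamma>] by (simp add: left_diff_distrib algebra_simps)
    thus ?thesis unfolding p by (simp add: dilation_def Suc left_diff_distrib mult.assoc)
  qed (simp add: dilation_def p left_diff_distrib)
qed

definition e_prod :: "complex multiset \<Rightarrow> complex fps" where
  "e_prod A = (\<Prod>\<gamma>\<in>#A. Abs_fps (e_coeff \<gamma>))"

lemma dilation_e_prod: "dilation (e_prod A) = fps_of_poly (\<Prod>\<gamma>\<in>#A. [:1, -\<gamma>:]) * e_prod A"
proof (induction A)
  case empty
  have "dilation 1 = 1" by (rule fps_ext) (simp add: dilation_def)
  thus ?case by (simp add: e_prod_def)
next
  case (add x A)
  thus ?case by (simp add: e_prod_def dilation_mult dilation_e_coeff fps_of_poly_mult mult_ac del: mult_pCons_left)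
qed

lemma e_prod_0: "fps_nth (e_prod A) 0 = 1"
  by (induction A) (simp_all add: e_prod_def e_coeff_0)

text \<open>The term \<open>j = 0\<close> is \<open>c n\<close> itself, so the earlier values
  determine \<open>(q^n - 1) c n\<close>, and \<open>q^n \<noteq> 1\<close> for
  \<open>n > 0\<close>.\<close>

lemma q_recurrence_unique:
  fixes c c' L :: "nat \<Rightarrow> complex"
  assumes "c 0 = c' 0" "L 0 = 1"
    and "\<And>n. of_real q ^ n * c n = (\<Sum>j\<le>n. L j * c (n - j))"
    and "\<And>n. of_real q ^ n * c' n = (\<Sum>j\<le>n. L j * c' (n - j))"
  shows "c n = c' n"
proof (induction n rule: less_induct)
  case (less n)
  show ?case
  proof (cases n)
    case (Suc m)
    have split: "(\<Sum>j\<le>n. L j * f (n - j)) = f n + (\<Sum>j\<in>{1..n}. L j * f (n - j))" for f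
      using assms(2) by (simp add: atMost_atLeast0 sum.atLeast_Suc_atMost)
    have "(of_real q ^ n - 1) * c n = (\<Sum>j\<in>{1..n}. L j * c (n - j))"
      using assms(3)[of n] split[of c] by (simp add: algebra_simps)
    also have "\<dots> = (\<Sum>j\<in>{1..n}. L j * c' (n - j))" using less by (intro sum.cong refl) auto
    also have "\<dots> = (of_real q ^ n - 1) * c' n"
      using assms(4)[of n] split[of c'] by (simp add: algebra_simps)
    finally have "(of_real q ^ n - 1) * c n = (of_real q ^ n - 1) * c' n" .
    moreover have "q ^ n > 1" using q_gt_1 Suc by (intro one_less_power) auto
    hence "(of_real q ^ n - 1 :: complex) \<noteq> 0"
      by (metis eq_iff_diff_eq_0 of_real_1 of_real_eq_iff of_real_power less_irrefl)
    ultimately show ?thesis by simp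
  qed (use assms in simp)
qed

text \<open>The base \<open>1 + 1 / (q - 1) = q / (q - 1)\<close> bounds every
  \<open>q^i / (q^i - 1)\<close>. Apart from that, the step from \<open>m\<close> to
  \<open>m + 1\<close> costs \<open>sqrt q / q^(m + 1)\<close>, which is the passage from
  \<open>m^2 / 2\<close> to \<open>(m + 1)^2 / 2\<close> in the exponent.\<close>

lemma norm_e_coeff_le:
  assumes "cmod \<gamma> \<le> sqrt q"
  shows "cmod (e_coeff \<gamma> m) \<le> (1 + 1 / (q - 1)) ^ m * q powr (- (real m ^ 2) / 2)"
    (is "_ \<le> _ * ?p m")
proof (induction m)
  case (Suc m)
  define K where "K = 1 + 1 / (q - 1)"
  have K: "K = q / (q - 1)" using q_gt_1 by (simp add: K_def field_simps)
  have K0: "K > 0" using q_gt_1 by (simp add: K)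
  have qm: "q ^ Suc m - 1 > 0" using one_less_power[OF q_gt_1, of "Suc m"] by simp
  have "cmod (of_real (q ^ Suc m - 1) * e_coeff \<gamma> (Suc m)) = cmod (- \<gamma> * e_coeff \<gamma> m)"
    unfolding e_coeff_Suc ..
  hence "(q ^ Suc m - 1) * cmod (e_coeff \<gamma> (Suc m)) = cmod \<gamma> * cmod (e_coeff \<gamma> m)"
    using qm by (simp only: norm_mult norm_of_real norm_minus_cancel abs_of_pos)
  also have "\<dots> \<le> sqrt q * (K ^ m * ?p m)"
    using assms Suc K0 q_gt_1 by (intro mult_mono) (auto simp: K_def)
  also have "\<dots> = K ^ m * (q powr (1 / 2) * ?p m)"
    using q_gt_1 by (simp add: powr_half_sqrt)
  also have "q powr (1 / 2) * ?p m = q powr (real (Suc m)) * ?p (Suc m)"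
    unfolding powr_add[symmetric] by (rule arg_cong[of _ _ "\<lambda>x. q powr x"]) (simp add: power2_eq_square field_simps)
  also have "q powr (real (Suc m)) = q ^ Suc m" using q_gt_1 by (simp only: powr_realpow)
  also have "K ^ m * (q ^ Suc m * ?p (Suc m))
    \<le> K ^ m * ((K * (q ^ Suc m - 1)) * ?p (Suc m))"
  proof -
    have "(q - 1) * q ^ Suc m \<le> q * (q ^ Suc m - 1)" using one_le_power[of q "Suc m"] q_gt_1
      by (simp add: algebra_simps)
    hence "q ^ Suc m \<le> K * (q ^ Suc m - 1)" unfolding K using q_gt_1 by (simp add: field_simps)
    thus ?thesis using K0 by (intro mult_left_mono mult_right_mono) auto
  qed
  also have "\<dots> = (q ^ Suc m - 1) * (K ^ Suc m * ?p (Suc m))" by simp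
  finally show ?case using qm by (simp only: mult_le_cancel_left_pos K_def)
qed (use q_gt_1 in \<open>simp add: e_coeff_0\<close>)

text \<open>The difference of the two sides is \<open>(d m - k)^2 / (2 d (d + 1))\<close>. In the
  application \<open>m\<close> is the degree taken by a new factor and \<open>k\<close> the degree
  taken by \<open>d\<close> others.\<close>

lemma square_split_ineq:
  fixes m k :: real
  assumes "d > 0"
  shows "(m + k) ^ 2 / (2 * (d + 1)) \<le> m ^ 2 / 2 + k ^ 2 / (2 * d)"
proof -
  have "m ^ 2 / 2 + k ^ 2 / (2 * d) - (m + k) ^ 2 / (2 * (d + 1)) = (d * m - k) ^ 2 / (2 * d * (d + 1))"
    using assms by (simp add: divide_simps) (simp add: power2_eq_square algebra_simps)
  also have "\<dots> \<ge> 0" using assms by simp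
  finally show ?thesis by simp
qed

text \<open>One more factor convolves the coefficients. By \<open>square_split_ineq\<close> all
  terms share one exponent, and the binomials add up by the hockey-stick identity.\<close>

lemma norm_e_prod_le:
  assumes "A \<noteq> {#}" "\<And>\<gamma>. \<gamma> \<in># A \<Longrightarrow> cmod \<gamma> \<le> sqrt q"
  shows "cmod (fps_nth (e_prod A) n) \<le>
    (1 + 1 / (q - 1)) ^ n * real ((n + size A - 1) choose n) * q powr (- (real n ^ 2) / (2 * real (size A)))"
  using assms
proof (induction A arbitrary: n)
  case (add x A)
  define K where "K = 1 + 1 / (q - 1)"
  have K0: "K > 0" using q_gt_1 by (simp add: K_def add_pos_pos)
  have ex: "cmod (e_coeff x m) \<le> K ^ m * q powr (- (real m ^ 2) / 2)" for m
    unfolding K_def using add.prems by (intro norm_e_coeff_le) auto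
  show ?case
  proof (cases "A = {#}")
    case True
    thus ?thesis using ex[of n] by (simp add: e_prod_def K_def)
  next
    case False
    define d where "d = size A"
    have d: "d > 0" using False by (simp add: d_def nonempty_has_size)
    define E where "E = q powr (- (real n ^ 2) / (2 * real (Suc d)))"
    have "fps_nth (e_prod (add_mset x A)) n = (\<Sum>i=0..n. e_coeff x (n - i) * fps_nth (e_prod A) i)"
    proof -
      have "e_prod (add_mset x A) = e_prod A * Abs_fps (e_coeff x)" by (simp add: e_prod_def mult.commute)
      thus ?thesis by (simp only: fps_mult_nth fps_nth_Abs_fps) (rule sum.cong[OF refl mult.commute])
    qed
    also have "cmod \<dots> \<le> (\<Sum>i=0..n. K ^ n * E * real ((i + d - 1) choose i))"
    proof (intro sum_norm_le)
      fix i assume "i \<in> {0..n}"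
      hence i: "i \<le> n" by simp
      have "cmod (e_coeff x (n - i) * fps_nth (e_prod A) i) \<le>
        (K ^ (n - i) * q powr (- (real (n - i) ^ 2) / 2)) *
        (K ^ i * real ((i + d - 1) choose i) * q powr (- (real i ^ 2) / (2 * real d)))"
        unfolding norm_mult K_def d_def
        using add.IH[OF False, of i] add.prems ex[of "n - i"] q_gt_1 unfolding K_def
        by (intro mult_mono) auto
      also have "\<dots> = K ^ n * real ((i + d - 1) choose i) *
        q powr (- (real (n - i) ^ 2) / 2 + - (real i ^ 2) / (2 * real d))"
        unfolding powr_add using i by (simp add: power_add[symmetric])
      also have "\<dots> \<le> K ^ n * real ((i + d - 1) choose i) * E"
        unfolding E_def
      proof (intro mult_left_mono powr_mono)
        show "- ((real (n - i))\<^sup>2) / 2 + - ((real i)\<^sup>2) / (2 * real d) \<le> - ((real n)\<^sup>2) / (2 * real (Suc d))"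
          using square_split_ineq[of "real d" "real (n - i)" "real i"] d i by (simp add: of_nat_diff add.commute)
      qed (use q_gt_1 K0 in simp_all)
      finally show "cmod (e_coeff x (n - i) * fps_nth (e_prod A) i) \<le> K ^ n * E * real ((i + d - 1) choose i)"
        by (simp only: mult_ac)
    qed
    also have "\<dots> = K ^ n * E * real (\<Sum>i\<le>n. ((d - 1) + i) choose i)"
      using d by (simp add: sum_distrib_left atMost_atLeast0 add.commute)
    also have "(\<Sum>i\<le>n. ((d - 1) + i) choose i) = (n + d) choose n"
      using sum_choose_lower[of "d - 1" n] d by (simp add: add.commute)
    finally show ?thesis unfolding E_def K_def d_def by (simp add: mult_ac)
  qed
qed simp

end

context field_character
begin

lemma GL_mean_0: "GL_mean g 0 = 1"
proof -
  have "(GL 0 :: 'a mat set) = {1\<^sub>m 0}" by (auto simp: GL_def)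
  moreover have "mtrace (1\<^sub>m 0 ^\<^sub>m i :: 'a mat) = 0" for i by (simp add: mtrace_def)
  ultimately show ?thesis by (simp add: GL_mean_def GL_sum_def mat_char_def)
qed

text \<open>The means and the coefficients of \<open>e_prod\<close> obey the same recurrence with
  the same start. Letting \<open>A\<close> have size \<open>d\<close> gives one bound for all
  \<open>g\<close> of degree at most \<open>d\<close>.\<close>

lemma norm_GL_mean_le:
  assumes deg: "degree g > 0" "degree g \<le> d" and nz: "of_nat (degree g) \<noteq> (0 :: 'a)"
  defines "q \<equiv> real CARD('a)"
  shows "cmod (GL_mean g n) \<le>
    (1 + 1 / (q - 1)) ^ n * real ((n + d - 1) choose n) * q powr (- (real n ^ 2) / (2 * real d))"
proof -
  have q: "q > 1" using card_field_ge_2[where 'a='a] by (simp add: q_def)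
  obtain A where A: "size A = d" "\<And>j. coeff (\<Prod>x\<in>#A. [:1, -x:]) j = L_coeff g j"
    "\<And>x. x \<in># A \<Longrightarrow> cmod x \<le> sqrt q"
    using L_coeff_factorization[OF deg nz] unfolding q_def by blast
  have "A \<noteq> {#}" using A(1) deg by auto
  have "GL_mean g n = fps_nth (e_prod q A) n"
  proof (rule q_recurrence_unique[OF q, where L="L_coeff g"])
    show "of_real q ^ n * GL_mean g n = (\<Sum>j\<le>n. L_coeff g j * GL_mean g (n - j))" for n
      using GL_mean_recurrence[of n g] by (simp add: q_def)
    show "of_real q ^ n * fps_nth (e_prod q A) n = (\<Sum>j\<le>n. L_coeff g j * fps_nth (e_prod q A) (n - j))" for n
      using arg_cong[OF dilation_e_prod[OF q, of A], of "\<lambda>f. fps_nth f n"]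
      by (simp add: dilation_def[OF q] fps_mult_nth A(2) atMost_atLeast0)
  qed (simp_all add: GL_mean_0 e_prod_0[OF q])
  thus ?thesis using norm_e_prod_le[OF q \<open>A \<noteq> {#}\<close> A(3), of n] A(1) by simp
qed

end

section \<open>Equidistribution of the traces\<close>

context field_character
begin

definition freq_poly :: "(nat \<Rightarrow> nat) \<Rightarrow> nat \<Rightarrow> (nat \<Rightarrow> 'a) \<Rightarrow> 'a poly" where
  "freq_poly b k l = (\<Sum>i\<in>{1..k}. monom (l i) (b i))"

lemma mat_char_freq_poly: "mat_char (freq_poly b k l) M = \<psi> (\<Sum>i\<in>{1..k}. l i * mtrace (M ^\<^sub>m b i))"
proof -
  define g where "g = freq_poly b k l"
  define t where "t = (\<lambda>i. mtrace (M ^\<^sub>m i))"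
  \<comment> \<open>A common upper limit that reaches both \<open>degree g\<close> and every
    \<open>b i\<close>.\<close>
  define N where "N = degree g + (\<Sum>i\<in>{1..k}. b i)"
  have bN: "b i \<le> N" if "i \<in> {1..k}" for i
    using member_le_sum[OF that, of b] by (simp add: N_def)
  have "(\<Sum>i\<le>degree g. coeff g i * t i) = (\<Sum>i\<le>N. coeff g i * t i)"
    by (intro sum.mono_neutral_left) (auto simp: N_def coeff_eq_0)
  also have "\<dots> = (\<Sum>i\<le>N. \<Sum>j\<in>{1..k}. if b j = i then l j * t i else 0)"
    unfolding g_def freq_poly_def coeff_sum sum_distrib_right by (intro sum.cong refl) auto
  also have "\<dots> = (\<Sum>j\<in>{1..k}. \<Sum>i\<le>N. if b j = i then l j * t i else 0)" by (rule sum.swap)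
  also have "\<dots> = (\<Sum>j\<in>{1..k}. l j * t (b j))"
    using bN by (intro sum.cong refl) auto
  finally show ?thesis unfolding mat_char_def g_def t_def by simp
qed

context
  fixes b :: "nat \<Rightarrow> nat" and a :: "nat \<Rightarrow> 'a" and k n :: nat
  assumes k: "k \<ge> 1"
    and mono: "\<And>i j. 1 \<le> i \<Longrightarrow> i < j \<Longrightarrow> j \<le> k \<Longrightarrow> b i < b j"
    and pos: "\<And>i. 1 \<le> i \<Longrightarrow> i \<le> k \<Longrightarrow> b i > 0"
    and cop: "\<And>i. 1 \<le> i \<Longrightarrow> i \<le> k \<Longrightarrow> coprime (b i) CHAR('a)"
begin

lemma b_nonzero_in_field:
  assumes "1 \<le> i" "i \<le> k"
  shows "of_nat (b i) \<noteq> (0 :: 'a)"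
proof
  assume "of_nat (b i) = (0 :: 'a)"
  hence "CHAR('a) dvd b i" by (simp add: of_nat_eq_0_iff_char_dvd)
  hence "CHAR('a) dvd 1" using cop[OF assms] by (metis coprime_common_divisor dvd_refl)
  thus False using prime_CHAR_finite[where 'a='a] by (simp add: prime_nat_iff)
qed

text \<open>The exponents are distinct, so no monomials merge and the largest index with
  \<open>l i \<noteq> 0\<close> sets the degree. Being one of the \<open>b i\<close>, the degree is
  prime to the characteristic, as \<open>norm_GL_mean_le\<close> requires.\<close>

lemma degree_freq_poly:
  assumes l: "\<exists>i\<in>{1..k}. l i \<noteq> 0"
  obtains i where "1 \<le> i" "i \<le> k" "degree (freq_poly b k l) = b i"
proof -
  define Z where "Z = {i \<in> {1..k}. l i \<noteq> 0}"
  have Z: "finite Z" "Z \<noteq> {}" using l by (auto simp: Z_def)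
  define m where "m = Max Z"
  have m: "m \<in> {1..k}" "l m \<noteq> 0" using Max_in[OF Z] by (auto simp: m_def Z_def)
  have above: "l i = 0" if "i \<in> {1..k}" "i > m" for i
  proof -
    have "i \<in> Z \<Longrightarrow> i \<le> m" unfolding m_def by (rule Max_ge[OF Z(1)])
    thus ?thesis using that by (auto simp: Z_def)
  qed
  have b_le: "b i \<le> b m" if "i \<in> {1..k}" "i \<le> m" for i
    using mono[of i m] that m by (cases "i = m") auto
  have c: "coeff (freq_poly b k l) j = (\<Sum>i\<in>{1..k}. if b i = j then l i else 0)" for j
    unfolding freq_poly_def coeff_sum by (intro sum.cong refl) auto
  have "degree (freq_poly b k l) \<le> b m"
  proof (rule degree_le, intro allI impI)
    fix j assume j: "b m < j"
    show "coeff (freq_poly b k l) j = 0"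
      unfolding c
    proof (rule sum.neutral, rule ballI)
      fix i assume i: "i \<in> {1..k}"
      show "(if b i = j then l i else 0) = 0" using above[OF i] b_le[OF i] j by (cases "i \<le> m") auto
    qed
  qed
  moreover have "coeff (freq_poly b k l) (b m) = l m"
  proof -
    have "b i = b m \<longleftrightarrow> i = m" if "i \<in> {1..k}" for i
      using mono[of i m] mono[of m i] that m by (cases i m rule: linorder_cases) auto
    hence "coeff (freq_poly b k l) (b m) = (\<Sum>i\<in>{1..k}. if i = m then l i else 0)"
      unfolding c by (intro sum.cong refl) auto
    thus ?thesis using m by simp
  qed
  ultimately have "degree (freq_poly b k l) = b m" using m le_degree by (metis le_antisym)
  thus thesis using that m by auto
qed

lemma trace_powers_equidistribution:
  defines "q \<equiv> real CARD('a)"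
  shows "\<bar>real (card {M \<in> GL n. \<forall>i\<in>{1..k}. mtrace (M ^\<^sub>m b i) = a i}) / real (card (GL n :: 'a mat set)) - 1 / q ^ k\<bar>
    \<le> (1 + 1 / (q - 1)) ^ n * real ((n + b k - 1) choose n) * q powr (- (real n ^ 2) / (2 * real (b k)))"
    (is "\<bar>?P - _\<bar> \<le> ?B")
proof -
  have q: "q > 1" using card_field_ge_2[where 'a='a] by (simp add: q_def)
  define LL where "LL = {1..k} \<rightarrow>\<^sub>E (UNIV :: 'a set)"
  define z where "z = restrict (\<lambda>_. 0 :: 'a) {1..k}"
  have LL: "finite LL" unfolding LL_def by (intro finite_PiE) auto
  have "card LL = CARD('a) ^ k" unfolding LL_def by (simp add: card_funcsetE)
  hence cLL: "real (card LL) = q ^ k" by (simp add: q_def)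
  have z: "z \<in> LL" by (simp add: z_def LL_def)
  define S where "S = {M \<in> GL n. \<forall>i\<in>{1..k}. mtrace (M ^\<^sub>m b i) = a i}"
  define c where "c = (\<lambda>l. \<psi> (- (\<Sum>i\<in>{1..k}. l i * a i)))"
  have prod_char: "\<psi> (\<Sum>i\<in>I. f i) = (\<Prod>i\<in>I. \<psi> (f i))" if "finite I" for f and I :: "nat set"
    using that by (induction I) (auto simp: char_add)
  \<comment> \<open>Orthogonality of characters: the sum over all frequencies factors over the
    \<open>k\<close> coordinates, and each factor tests one trace condition.\<close>
  have detect: "(\<Sum>l\<in>LL. c l * mat_char (freq_poly b k l) M) = (if M \<in> S then of_real (q ^ k) else 0)"
    if M: "M \<in> GL n" for M
  proof -
    define x where "x = (\<lambda>i. mtrace (M ^\<^sub>m b i) - a i)"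
    have "(\<Sum>l\<in>LL. c l * mat_char (freq_poly b k l) M) = (\<Sum>l\<in>LL. \<Prod>i\<in>{1..k}. \<psi> (l i * x i))"
      unfolding c_def mat_char_freq_poly
      by (intro sum.cong refl)
         (simp add: char_add[symmetric] prod_char[symmetric] x_def right_diff_distrib sum_subtractf)
    also have "\<dots> = (\<Prod>i\<in>{1..k}. \<Sum>l\<in>UNIV. \<psi> (l * x i))"
      unfolding LL_def by (rule prod_sum_PiE[symmetric]) auto
    also have "\<dots> = (\<Prod>i\<in>{1..k}. if x i = 0 then of_real q else 0)"
      by (intro prod.cong refl) (simp add: sum_char_mult q_def)
    also have "\<dots> = (if M \<in> S then of_real (q ^ k) else 0)"
    proof (cases "\<forall>i\<in>{1..k}. x i = 0")
      case True
      hence "M \<in> S" using M by (auto simp: S_def x_def)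
      moreover have "(\<Prod>i\<in>{1..k}. if x i = 0 then of_real q else 0 :: complex) = (\<Prod>i\<in>{1..k}. of_real q)"
        using True by (intro prod.cong) auto
      ultimately show ?thesis by simp
    next
      case False
      hence "M \<notin> S" by (auto simp: S_def x_def)
      moreover have "(\<Prod>i\<in>{1..k}. if x i = 0 then of_real q else 0 :: complex) = 0"
        using False by (intro prod_zero) auto
      ultimately show ?thesis by simp
    qed
    finally show ?thesis .
  qed
  define G where "G = real (card (GL n :: 'a mat set))"
  have G: "G > 0" using card_GL_pos[of n, where 'b='a] by (simp add: G_def)
  have fin: "finite (GL n :: 'a mat set)" by (rule finite_GL)
  have "(\<Sum>l\<in>LL. c l * GL_sum (freq_poly b k l) n) = (\<Sum>M\<in>GL n. \<Sum>l\<in>LL. c l * mat_char (freq_poly b k l) M)"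
    unfolding GL_sum_def sum_distrib_left by (rule sum.swap)
  also have "\<dots> = (\<Sum>M\<in>GL n. if M \<in> S then of_real (q ^ k) else 0)"
    using detect by (intro sum.cong refl) auto
  also have "\<dots> = (\<Sum>M\<in>GL n \<inter> S. of_real (q ^ k))" by (rule sum.inter_restrict[OF fin, symmetric])
  also have "GL n \<inter> S = S" by (auto simp: S_def)
  finally have W: "(\<Sum>l\<in>LL. c l * GL_sum (freq_poly b k l) n) = of_real (real (card S) * q ^ k)" by simp
  have "(\<Sum>l\<in>LL. c l * GL_mean (freq_poly b k l) n) = (\<Sum>l\<in>LL. c l * GL_sum (freq_poly b k l) n) / of_real G"
    by (simp add: GL_mean_def G_def sum_divide_distrib)
  also have "\<dots> = of_real (q ^ k * ?P)" unfolding W by (simp add: S_def G_def)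
  finally have E: "(\<Sum>l\<in>LL. c l * GL_mean (freq_poly b k l) n) = of_real (q ^ k * ?P)" .
  \<comment> \<open>The zero frequency yields the main term.\<close>
  have "GL_mean (freq_poly b k z) n = 1"
  proof -
    have "mat_char (freq_poly b k z) M = 1" for M by (simp add: mat_char_freq_poly z_def)
    thus ?thesis using G by (simp add: GL_mean_def GL_sum_def G_def)
  qed
  moreover have "c z = 1" by (simp add: c_def z_def)
  ultimately have "(\<Sum>l\<in>LL - {z}. c l * GL_mean (freq_poly b k l) n) = of_real (q ^ k * ?P - 1)"
    using E LL z by (subst sum_diff1) auto
  hence "q ^ k * \<bar>?P - 1 / q ^ k\<bar> = cmod (\<Sum>l\<in>LL - {z}. c l * GL_mean (freq_poly b k l) n)"
  proof -
    have "q ^ k * ?P - 1 = q ^ k * (?P - 1 / q ^ k)" using q by (simp add: right_diff_distrib)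
    hence "\<bar>q ^ k * ?P - 1\<bar> = q ^ k * \<bar>?P - 1 / q ^ k\<bar>" using q by (simp add: abs_mult)
    moreover assume "(\<Sum>l\<in>LL - {z}. c l * GL_mean (freq_poly b k l) n) = of_real (q ^ k * ?P - 1)"
    ultimately show ?thesis by (simp only: norm_of_real)
  qed
  also have "\<dots> \<le> (\<Sum>l\<in>LL - {z}. ?B)"
  proof (rule sum_norm_le)
    fix l assume l: "l \<in> LL - {z}"
    have "\<exists>i\<in>{1..k}. l i \<noteq> 0"
    proof (rule ccontr)
      assume "\<not> ?thesis"
      hence "l = z" using l unfolding LL_def z_def by (intro PiE_ext[of l "{1..k}" "\<lambda>_. UNIV"]) auto
      thus False using l by simp
    qed
    then obtain i where i: "1 \<le> i" "i \<le> k" "degree (freq_poly b k l) = b i" using degree_freq_poly by blast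
    have "b i \<le> b k" using mono[of i k] i by (cases "i = k") auto
    hence "cmod (GL_mean (freq_poly b k l) n) \<le> ?B"
      unfolding q_def using i pos[OF i(1,2)] b_nonzero_in_field[OF i(1,2)] by (intro norm_GL_mean_le) auto
    thus "cmod (c l * GL_mean (freq_poly b k l) n) \<le> ?B" by (simp add: norm_mult c_def norm_char)
  qed
  \<comment> \<open>One term for each nonzero frequency; the normalization by \<open>q^k\<close>
    absorbs their number.\<close>
  also have "\<dots> = (q ^ k - 1) * ?B"
  proof -
    have "card LL > 0" using LL z by (auto simp: card_gt_0_iff)
    hence "real (card (LL - {z})) = q ^ k - 1" using z cLL by (simp add: card_Diff_singleton of_nat_diff)
    thus ?thesis by (simp only: sum_constant)
  qed
  also have "\<dots> \<le> q ^ k * ?B" using q by (intro mult_right_mono) auto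
  finally show ?thesis using q by simp
qed

end
end

text \<open>An enumeration of the index type carries its matrices to matrices of numeric size. It
  respects products and the identity, hence powers and invertibility, and it permutes the summands
  of the trace.\<close>

lemma matpow_bridge:
  "\<exists>\<phi> :: 'a::{field,finite}^'n^'n \<Rightarrow> 'a mat. bij_betw \<phi> UNIV (carrier_mat CARD('n) CARD('n)) \<and>
    (\<forall>M. trace M = mtrace (\<phi> M)) \<and> (\<forall>M m. \<phi> (matpow M m) = \<phi> M ^\<^sub>m m) \<and>
    (\<forall>M. invertible M \<longleftrightarrow> \<phi> M \<in> GL CARD('n))"
proof -
  define n where "n = CARD('n)"
  obtain h :: "nat \<Rightarrow> 'n" where h: "bij_betw h {0..<n} UNIV"
    using ex_bij_betw_nat_finite[of "UNIV :: 'n set"] by (auto simp: n_def)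
  define h' where "h' = the_inv_into {0..<n} h"
  have h': "h' x < n" "h (h' x) = x" for x
    using h the_inv_into_into[of h "{0..<n}" x "{0..<n}"] f_the_inv_into_f[of h "{0..<n}" x]
    by (auto simp: h'_def bij_betw_def)
  have h'h: "h' (h i) = i" if "i < n" for i
    using h that the_inv_into_f_f[of h "{0..<n}" i] by (simp add: h'_def bij_betw_def)
  define \<phi> where "\<phi> = (\<lambda>M :: 'a^'n^'n. mat n n (\<lambda>(i, j). vec_nth (vec_nth M (h i)) (h j)))"
  have carr: "\<phi> M \<in> carrier_mat n n" for M by (simp add: \<phi>_def)
  have bij: "bij_betw \<phi> UNIV (carrier_mat n n)"
  proof (rule bij_betwI[of _ _ _ "\<lambda>A. vec_lambda (\<lambda>x. vec_lambda (\<lambda>y. A $$ (h' x, h' y)))"])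
    show "\<phi> (vec_lambda (\<lambda>x. vec_lambda (\<lambda>y. A $$ (h' x, h' y)))) = A" if "A \<in> carrier_mat n n" for A
      using that h'h by (intro eq_matI) (auto simp: \<phi>_def)
    show "vec_lambda (\<lambda>x. vec_lambda (\<lambda>y. \<phi> M $$ (h' x, h' y))) = M" for M
      using h' by (simp add: \<phi>_def vec_eq_iff)
  qed (auto simp: carr)
  have mult: "\<phi> (M ** N) = \<phi> M * \<phi> N" for M N
  proof (rule eq_matI)
    fix i j assume "i < dim_row (\<phi> M * \<phi> N)" "j < dim_col (\<phi> M * \<phi> N)"
    hence ij: "i < n" "j < n" using carr[of M] carr[of N] by auto
    show "\<phi> (M ** N) $$ (i, j) = (\<phi> M * \<phi> N) $$ (i, j)"
      using ij by (simp add: \<phi>_def matrix_matrix_mult_def scalar_prod_def sum.reindex_bij_betw[OF h, symmetric])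
  qed (use carr[of M] carr[of N] carr[of "M ** N"] in auto)
  have one: "\<phi> (Finite_Cartesian_Product.mat 1) = 1\<^sub>m n"
    using h by (intro eq_matI) (auto simp: \<phi>_def Finite_Cartesian_Product.mat_def bij_betw_def inj_on_def)
  have tr: "trace M = mtrace (\<phi> M)" for M
    by (simp add: trace_def mtrace_def \<phi>_def sum.reindex_bij_betw[OF h, symmetric] lessThan_atLeast0)
  have pow: "\<phi> (matpow M m) = \<phi> M ^\<^sub>m m" for M m
  proof (induction m)
    case (Suc m)
    \<comment> \<open>\<open>matpow\<close> multiplies on the left and \<open>^\<^sub>m\<close> on
      the right; a matrix commutes with its powers.\<close>
    have "\<phi> M ^\<^sub>m m * \<phi> M = \<phi> M * \<phi> M ^\<^sub>m m" by (rule pow_mat_intertwine[OF carr carr carr refl])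
    thus ?case by (simp add: mult Suc)
  qed (use one carr[of M] in auto)
  have inv: "invertible M \<longleftrightarrow> \<phi> M \<in> GL n" for M
  proof
    assume "invertible M"
    then obtain N where "M ** N = Finite_Cartesian_Product.mat 1" unfolding invertible_def by blast
    hence "\<phi> M * \<phi> N = 1\<^sub>m n" using mult[of M N] one by simp
    hence "det (\<phi> M) * det (\<phi> N) = 1" using det_mult[OF carr carr, of M N] by simp
    thus "\<phi> M \<in> GL n" using carr by (auto simp: GL_def)
  next
    assume "\<phi> M \<in> GL n"
    then obtain Q where Q: "Q \<in> GL n" "\<phi> M * Q = 1\<^sub>m n" "Q * \<phi> M = 1\<^sub>m n" by (rule GL_inverse)
    then obtain N where N: "Q = \<phi> N" using bij unfolding bij_betw_def GL_def by blast
    have "\<phi> (M ** N) = \<phi> (Finite_Cartesian_Product.mat 1)" "\<phi> (N ** M) = \<phi> (Finite_Cartesian_Product.mat 1)"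
      using Q mult one N by auto
    hence "M ** N = Finite_Cartesian_Product.mat 1" "N ** M = Finite_Cartesian_Product.mat 1"
      using bij by (auto simp: bij_betw_def inj_on_def)
    thus "invertible M" unfolding invertible_def by blast
  qed
  show ?thesis using bij tr pow inv unfolding n_def by (intro exI[of _ \<phi>]) simp
qed

theorem theorem1p1:
  fixes b :: "nat \<Rightarrow> nat" and a :: "nat \<Rightarrow> 'a::{field,finite}" and k :: nat
  defines "q \<equiv> CARD('a)" and "n \<equiv> CARD('n::finite)"
  assumes "k \<ge> 1"
    and "\<And>i j. 1 \<le> i \<Longrightarrow> i < j \<Longrightarrow> j \<le> k \<Longrightarrow> b i < b j"
    and "\<And>i. 1 \<le> i \<Longrightarrow> i \<le> k \<Longrightarrow> b i > 0"
    and "\<And>i. 1 \<le> i \<Longrightarrow> i \<le> k \<Longrightarrow> coprime (b i) CHAR('a)"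
  shows "\<bar>real (card {M :: 'a^'n^'n. invertible M \<and> (\<forall>i\<in>{1..k}. trace (matpow M (b i)) = a i)})
            / real (card {M :: 'a^'n^'n. invertible M}) - real q powr (- real k)\<bar>
         \<le> real q powr (- (real n ^ 2) / (2 * real (b k))) * (1 + 1 / (real q - 1)) ^ n
            * real ((n - 1 + b k) choose n)"
proof -
  obtain \<psi> :: "'a \<Rightarrow> complex" where "\<And>x y. \<psi> (x + y) = \<psi> x * \<psi> y" "\<And>x. cmod (\<psi> x) = 1" "\<exists>x. \<psi> x \<noteq> 1"
    using finite_field_additive_character by metis
  then interpret field_character \<psi> by unfold_locales auto
  obtain \<phi> :: "'a^'n^'n \<Rightarrow> 'a mat" where \<phi>: "bij_betw \<phi> UNIV (carrier_mat n n) \<and>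
    (\<forall>M. trace M = mtrace (\<phi> M)) \<and> (\<forall>M m. \<phi> (matpow M m) = \<phi> M ^\<^sub>m m) \<and>
    (\<forall>M. invertible M \<longleftrightarrow> \<phi> M \<in> GL n)"
    unfolding n_def using matpow_bridge[where 'a='a and 'n='n] by (rule exE)
  from \<phi> have bij: "bij_betw \<phi> UNIV (carrier_mat n n)" by blast
  from \<phi> have tr: "trace M = mtrace (\<phi> M)" for M by blast
  from \<phi> have pow: "\<phi> (matpow M m) = \<phi> M ^\<^sub>m m" for M m by blast
  from \<phi> have inv_iff: "invertible M \<longleftrightarrow> \<phi> M \<in> GL n" for M by blast
  have card_vimage: "card (\<phi> -` Y) = card Y" if Y: "Y \<subseteq> carrier_mat n n" for Y :: "'a mat set"
    using bij Y unfolding bij_betw_def by (intro card_vimage_inj) auto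
  have "card {M :: 'a^'n^'n. invertible M} = card (GL n :: 'a mat set)"
    using card_vimage[of "GL n"] by (simp add: vimage_def inv_iff GL_def subset_iff)
  moreover have "card {M :: 'a^'n^'n. invertible M \<and> (\<forall>i\<in>{1..k}. trace (matpow M (b i)) = a i)}
    = card {M \<in> GL n. \<forall>i\<in>{1..k}. mtrace (M ^\<^sub>m b i) = a i}"
    using card_vimage[of "{M \<in> GL n. \<forall>i\<in>{1..k}. mtrace (M ^\<^sub>m b i) = a i}"]
    by (simp add: vimage_def inv_iff tr pow GL_def subset_iff)
  moreover have "real q powr (- real k) = 1 / real q ^ k"
    by (simp add: powr_minus_divide powr_realpow q_def)
  \<comment> \<open>The natural subtraction is harmless because an index type has at least one
    element.\<close>
  moreover have "n + b k - 1 = n - 1 + b k" by (simp add: n_def)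
  ultimately show ?thesis
    using trace_powers_equidistribution[where k=k and b=b and a=a and n=n] assms(3-6) by (simp add: q_def mult_ac)
qed

end
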